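(* Let $\lambda\in\mathbb{R}$. The Cauchy--Stieltjes transform $G_\lambda$ of the measure $\mu_\lambda$ satisfies $$G_\lambda(z)=\frac{G(z-\lambda)}{1+\lambda G(z-\lambda)}\qquad\text{for all } z\in\mathbb{C}_+ .$$
   Context: Notation: $\mathbb{N}=\{0,1,2,\dots\}$, $[n]=\{1,\dots,n\}$, $\mathbb{C}_+=\{z\in\mathbb{C}:\Im z>0\}$. The Cauchy--Stieltjes transform of a probability measure $\mu$ on $\mathbb{R}$ is $z\mapsto\int_{\mathbb R}\frac{\mu(dx)}{z-x}$. The measure $\mu_\lambda$. A finite word $(i_1,\dots,i_n)$ over $\mathbb{N}$ is a V-word if $n=0$ or there is $m\in[n]$ with $i_1>\dots>i_m<\dots<i_n$; let $\mathcal{V}$ be the set of V-words. The discrete V-monotone Fock space $\mathcal{F}$ is the complex Hilbert space with orthonormal basis $(e_w)_{w\in\mathcal V}$; $\Omega=e_{()}$, and $e_w=0$ for words $w\notin\mathcal V$. For $i\in\mathbb{N}$ the bounded operators $A_i^+,A_i^-,A_i^\circ$ on $\mathcal F$ are determined by: $A_i^+e_w=e_{(i,w)}$ (concatenation) for $w\in\mathcal V$; $A_i^-\Omega=A_i^\circ\Omega=0$; and for $w=(j,w_0)\in\mathcal V$, $A_i^-e_w=\delta_{i,j}e_{w_0}$ and $A_i^\circ e_w=\delta_{i,j}e_w$. Put $\varphi(b)=\langle b\,\Omega,\Omega\rangle$ and $S_N(\lambda)=\sum_{i=1}^N\big(\frac{A_i^++A_i^-}{\sqrt N}+\lambda A_i^\circ\big)$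 for $N\ge1$. Then $\mu_\lambda$ is the limit distribution of $S_N(\lambda)$ as $N\to\infty$: the unique (compactly supported) probability measure on $\mathbb{R}$ with $\int x^n\mu_\lambda(dx)=\lim_{N\to\infty}\varphi(S_N(\lambda)^n)$ for all $n\in\mathbb{N}$. The function $G$. Let $T_0:[0,\infty)\to\mathbb{R}$, $T_0(s)=\int_s^1\frac{t}{t^2-t+1}dt$; it is strictly decreasing with range $(-\infty,\sqrt3\pi/9]$ and inverse $T_0^{-1}$. $\mathrm{Log}$ and $\mathrm{Arg}$ are the principal logarithm and argument, $\mathrm{Arg}\in(-\pi,\pi]$. Let $\Theta=\{(\eta,\xi)\in\mathbb{R}^2:-\pi\le\eta\le0,\ \xi<-\eta\}$ and for $(\eta,\xi)\in\Theta$ $$g(\eta,\xi)=\frac{\sqrt3\,i\,(e^{-\sqrt3(\eta+\xi)+i\xi}-1)}{1-e^{-2\sqrt3(\eta+\xi)}}+\frac{1+\sqrt3 i}{2},$$ $$H(\eta,\xi)=-\frac{\sqrt3}{6}\Big(\mathrm{Arg}\big(e^{-\sqrt3(\eta+\xi)+i\xi}-1\big)-\mathrm{Arg}\big(g(\eta,\xi)-\tfrac{1-\sqrt3 i}{2}\big)+2\Big\lceil\frac{\xi-\pi}{2\pi}\Big\rceil\pi+\frac{\pi}{6}\Big)-\frac{\ln|g(\eta,\xi)^2-g(\eta,\xi)+1|}{2}+\frac{i\eta}{2}.$$ On $D=\{w\in\mathbb{C}:-\pi/2\le\Im w\le0\}$ define $T^{-1}:D\to\mathbb{C}$ by $T^{-1}(w)=T_0^{-1}(w)$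 if $w\in(-\infty,\sqrt3\pi/9]$, and $T^{-1}(w)=g(\eta,\xi)$ if $w=H(\eta,\xi)\in D\setminus(-\infty,\sqrt3\pi/9]$ with $(\eta,\xi)\in\Theta$ (this is well defined on $D$; known from earlier work). For $z\in(\mathbb{C}_+\cup\mathbb{R})\setminus\{-\sqrt2,0,\sqrt2\}$ let $$W(z)=\begin{cases}\frac12\mathrm{Log}\big(1+\frac{2}{z^2-2}\big)& z\notin(0,\sqrt2),\\ \frac12\ln\big(\frac{2}{2-z^2}-1\big)-\frac{i\pi}{2}& z\in(0,\sqrt2).\end{cases}$$ Let $\gamma_0=\frac{2}{e^{2\sqrt3\pi/9}-1}$. Then $G:\mathbb{C}_+\cup(\mathbb{R}\setminus\{\pm\sqrt{2+\gamma_0}\})\to\mathbb{C}$ is defined by $G(z)=\frac{1}{z\,T^{-1}(W(z))}$ if $\Re z\ge0$, $z\ne0,\sqrt2$; $G(0)=-\frac{\sqrt2 i}{2}e^{\sqrt3\pi/9}$; $G(\sqrt2)=\frac{\sqrt2-\sqrt6 i}{4}$; and $G(z)=-\overline{G(-\overline z)}$ if $\Re z<0$. *)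

theory Defs
  imports "HOL-Probability.Probability"
begin

section \<open>The discrete V-monotone Fock space\<close>

text \<open>The letters \<open>i\<^sub>1, \<dots>, i\<^sub>n\<close> decrease strictly up to position \<open>m\<close> and increase strictly from there on;
  position \<open>m\<close> belongs to both pieces.\<close>

definition vword :: "nat list \<Rightarrow> bool" where
  "vword w \<longleftrightarrow> w = [] \<or>
     (\<exists>m\<in>{1..length w}. sorted_wrt (>) (take m w) \<and> sorted_wrt (<) (drop (m - 1) w))"

text \<open>The Hilbert space with orthonormal basis indexed by the V-words, realised as the square-summable
  coefficient families: \<open>f w\<close> is the coefficient of \<open>f\<close> at \<open>e\<^sub>w\<close>, and \<open>f w = 0\<close> off the V-words.\<close>

definition fock :: "(nat list \<Rightarrow> complex) set" where
  "fock = {f. (\<forall>w. \<not> vword w \<longrightarrow> f w = 0) \<and> (\<lambda>w. (cmod (f w))\<^sup>2) summable_on UNIV}"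

definition fock_inner :: "(nat list \<Rightarrow> complex) \<Rightarrow> (nat list \<Rightarrow> complex) \<Rightarrow> complex" where
  "fock_inner f g = (\<Sum>\<^sub>\<infinity>w. f w * cnj (g w))"

definition fock_norm :: "(nat list \<Rightarrow> complex) \<Rightarrow> real" where
  "fock_norm f = sqrt (\<Sum>\<^sub>\<infinity>w. (cmod (f w))\<^sup>2)"

definition basis_vec :: "nat list \<Rightarrow> nat list \<Rightarrow> complex" where
  "basis_vec w = (\<lambda>v. if vword w \<and> v = w then 1 else 0)"

definition vacuum :: "nat list \<Rightarrow> complex" where
  "vacuum = basis_vec []"

text \<open>The operators \<open>A\<^sub>i\<^sup>+\<close>, \<open>A\<^sub>i\<^sup>-\<close> and \<open>A\<^sub>i\<^sup>\<circ>\<close>, in terms of coefficients. Their action on the basis,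
  by which the bounded operators are determined, is derived below.\<close>

definition creation :: "nat \<Rightarrow> (nat list \<Rightarrow> complex) \<Rightarrow> nat list \<Rightarrow> complex" where
  "creation i f = (\<lambda>v. if vword v \<and> v \<noteq> [] \<and> hd v = i then f (tl v) else 0)"

definition annihilation :: "nat \<Rightarrow> (nat list \<Rightarrow> complex) \<Rightarrow> nat list \<Rightarrow> complex" where
  "annihilation i f = (\<lambda>v. f (i # v))"

definition conservation :: "nat \<Rightarrow> (nat list \<Rightarrow> complex) \<Rightarrow> nat list \<Rightarrow> complex" where
  "conservation i f = (\<lambda>v. if v \<noteq> [] \<and> hd v = i then f v else 0)"

lemma vword_Nil [simp]: "vword []"
  by (simp add: vword_def)

lemma vword_tl:
  assumes "vword (i # w)"
  shows "vword w"
proof (cases "w = []")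
  case False
  obtain m where m: "m \<in> {1..length (i # w)}" "sorted_wrt (>) (take m (i # w))"
      "sorted_wrt (<) (drop (m - 1) (i # w))"
    using assms unfolding vword_def by blast
  show ?thesis
  proof (cases "m = 1")
    case True
    then have "sorted_wrt (<) w" using m by simp
    moreover have "sorted_wrt (>) (take 1 w)" using False by (cases w) auto
    ultimately show ?thesis using False unfolding vword_def
      by (intro disjI2 bexI[of _ 1]) (auto simp: Suc_le_eq)
  next
    case m1: False
    then obtain k where k: "m = Suc (Suc k)" using m(1) by (cases m; cases "m - 1") auto
    then show ?thesis using m unfolding vword_def
      by (intro disjI2 bexI[of _ "Suc k"]) auto
  qed
qed simp

lemma fock_inner_basis_vec:
  "fock_inner (basis_vec v) (basis_vec w) = (if v = w \<and> vword v then 1 else 0)"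
proof -
  have "fock_inner (basis_vec v) (basis_vec w) =
      (\<Sum>\<^sub>\<infinity>u\<in>{v}. basis_vec v u * cnj (basis_vec w u))"
    unfolding fock_inner_def by (rule infsum_cong_neutral) (auto simp: basis_vec_def)
  then show ?thesis by (auto simp: basis_vec_def)
qed

lemma fock_inner_basis_right:
  assumes "f \<in> fock"
  shows "fock_inner f (basis_vec w) = f w"
proof -
  have "fock_inner f (basis_vec w) = (\<Sum>\<^sub>\<infinity>u\<in>{w}. f u * cnj (basis_vec w u))"
    unfolding fock_inner_def by (rule infsum_cong_neutral) (auto simp: basis_vec_def)
  then show ?thesis using assms by (auto simp: basis_vec_def fock_def)
qed

lemma creation_basis_vec: "vword w \<Longrightarrow> creation i (basis_vec w) = basis_vec (i # w)"
  by (rule ext) (auto simp: creation_def basis_vec_def neq_Nil_conv)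

lemma annihilation_vacuum: "annihilation i vacuum = (\<lambda>_. 0)"
  by (rule ext) (simp add: annihilation_def vacuum_def basis_vec_def)

lemma annihilation_basis_vec:
  "vword (j # w) \<Longrightarrow> annihilation i (basis_vec (j # w)) = (if i = j then basis_vec w else (\<lambda>_. 0))"
  by (rule ext) (auto simp: annihilation_def basis_vec_def dest: vword_tl)

lemma conservation_vacuum: "conservation i vacuum = (\<lambda>_. 0)"
  by (rule ext) (simp add: conservation_def vacuum_def basis_vec_def)

lemma conservation_basis_vec:
  "vword (j # w) \<Longrightarrow>
     conservation i (basis_vec (j # w)) = (if i = j then basis_vec (j # w) else (\<lambda>_. 0))"
  by (rule ext) (auto simp: conservation_def basis_vec_def)

lemma fock_contraction:
  assumes f: "f \<in> fock"
    and supp: "\<And>v. \<not> vword v \<Longrightarrow> g v = 0"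
    and inj: "inj_on h A"
    and le: "\<And>v. v \<in> A \<Longrightarrow> cmod (g v) \<le> cmod (f (h v))"
    and out: "\<And>v. v \<notin> A \<Longrightarrow> g v = 0"
  shows "g \<in> fock \<and> fock_norm g \<le> fock_norm f"
proof -
  have sf: "(\<lambda>w. (cmod (f w))\<^sup>2) summable_on UNIV"
    using f by (simp add: fock_def)
  then have sh: "(\<lambda>w. (cmod (f w))\<^sup>2) summable_on h ` A"
    by (rule summable_on_subset_banach) simp
  then have sA: "(\<lambda>v. (cmod (f (h v)))\<^sup>2) summable_on A"
    using summable_on_reindex[OF inj, of "\<lambda>w. (cmod (f w))\<^sup>2"] by (simp add: o_def)
  have le2: "(cmod (g v))\<^sup>2 \<le> (cmod (f (h v)))\<^sup>2" if "v \<in> A" for v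
    using le[OF that] by (intro power_mono) auto
  have gA: "(\<lambda>v. (cmod (g v))\<^sup>2) summable_on A"
    by (rule summable_on_comparison_test[OF sA]) (use le2 in auto)
  moreover have "(\<lambda>v. (cmod (g v))\<^sup>2) summable_on UNIV \<longleftrightarrow> (\<lambda>v. (cmod (g v))\<^sup>2) summable_on A"
    by (rule summable_on_cong_neutral) (use out in auto)
  ultimately have "g \<in> fock" using supp by (simp add: fock_def)
  moreover have "(\<Sum>\<^sub>\<infinity>v. (cmod (g v))\<^sup>2) \<le> (\<Sum>\<^sub>\<infinity>w. (cmod (f w))\<^sup>2)"
  proof -
    have "(\<Sum>\<^sub>\<infinity>v. (cmod (g v))\<^sup>2) = (\<Sum>\<^sub>\<infinity>v\<in>A. (cmod (g v))\<^sup>2)"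
      by (rule infsum_cong_neutral) (use out in auto)
    also have "\<dots> \<le> (\<Sum>\<^sub>\<infinity>v\<in>A. (cmod (f (h v)))\<^sup>2)"
      by (rule infsum_mono[OF gA sA]) (use le2 in auto)
    also have "\<dots> = (\<Sum>\<^sub>\<infinity>w\<in>h ` A. (cmod (f w))\<^sup>2)"
      using infsum_reindex[OF inj, of "\<lambda>w. (cmod (f w))\<^sup>2"] by (simp add: o_def)
    also have "\<dots> \<le> (\<Sum>\<^sub>\<infinity>w. (cmod (f w))\<^sup>2)"
      by (rule infsum_mono_neutral[OF sh sf]) auto
    finally show ?thesis .
  qed
  ultimately show ?thesis by (simp add: fock_norm_def)
qed

lemma creation_bounded:
  "f \<in> fock \<Longrightarrow> creation i f \<in> fock \<and> fock_norm (creation i f) \<le> fock_norm f"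
  by (rule fock_contraction[where h = tl and A = "{v. v \<noteq> [] \<and> hd v = i}"])
    (auto simp: creation_def inj_on_def neq_Nil_conv)

lemma annihilation_bounded:
  "f \<in> fock \<Longrightarrow> annihilation i f \<in> fock \<and> fock_norm (annihilation i f) \<le> fock_norm f"
  by (rule fock_contraction[where h = "(#) i" and A = UNIV])
    (auto simp: annihilation_def inj_on_def fock_def dest: vword_tl)

lemma conservation_bounded:
  "f \<in> fock \<Longrightarrow> conservation i f \<in> fock \<and> fock_norm (conservation i f) \<le> fock_norm f"
  by (rule fock_contraction[where h = id and A = UNIV])
    (auto simp: conservation_def inj_on_def fock_def)

section \<open>The limit distribution\<close>

definition vacuum_state :: "((nat list \<Rightarrow> complex) \<Rightarrow> nat list \<Rightarrow> complex) \<Rightarrow> complex" where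
  "vacuum_state b = fock_inner (b vacuum) vacuum"

definition S_op :: "real \<Rightarrow> nat \<Rightarrow> (nat list \<Rightarrow> complex) \<Rightarrow> nat list \<Rightarrow> complex" where
  "S_op l N f = (\<lambda>w. \<Sum>i=1..N.
     (creation i f w + annihilation i f w) / complex_of_real (sqrt (real N))
       + complex_of_real l * conservation i f w)"

text \<open>The defining property of \<open>\<mu>\<^sub>\<lambda>\<close>, for \<open>\<lambda> = l\<close>: a compactly supported probability measure on the
  Borel sets of the real line whose moments are the limits of the vacuum moments of \<open>S_op l N\<close>.\<close>

definition is_limit_distribution :: "real \<Rightarrow> real measure \<Rightarrow> bool" where
  "is_limit_distribution l \<mu> \<longleftrightarrow> real_distribution \<mu> \<and>
     (\<exists>K. compact K \<and> (AE x in \<mu>. x \<in> K)) \<and>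
     (\<forall>n. (\<lambda>N. vacuum_state (S_op l N ^^ n)) \<longlonglongrightarrow> complex_of_real (\<integral>x. x ^ n \<partial>\<mu>))"

definition cauchy_stieltjes :: "real measure \<Rightarrow> complex \<Rightarrow> complex" where
  "cauchy_stieltjes \<mu> z = (\<integral>x. 1 / (z - complex_of_real x) \<partial>\<mu>)"

section \<open>The function G\<close>

text \<open>The interval integral is oriented, so this also covers \<open>s > 1\<close>.\<close>

definition T0 :: "real \<Rightarrow> real" where
  "T0 s = (LBINT t=ereal s..ereal 1. t / (t\<^sup>2 - t + 1))"

definition T0_inv :: "real \<Rightarrow> real" where
  "T0_inv = the_inv_into {0..} T0"

definition Theta :: "(real \<times> real) set" where
  "Theta = {(\<eta>, \<xi>). - pi \<le> \<eta> \<and> \<eta> \<le> 0 \<and> \<xi> < - \<eta>}"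

definition g_fun :: "real \<Rightarrow> real \<Rightarrow> complex" where
  "g_fun \<eta> \<xi> =
     complex_of_real (sqrt 3) * \<i> *
       (exp (complex_of_real (- sqrt 3 * (\<eta> + \<xi>)) + \<i> * complex_of_real \<xi>) - 1)
       / complex_of_real (1 - exp (- 2 * sqrt 3 * (\<eta> + \<xi>)))
     + (1 + complex_of_real (sqrt 3) * \<i>) / 2"

definition H_fun :: "real \<Rightarrow> real \<Rightarrow> complex" where
  "H_fun \<eta> \<xi> =
     complex_of_real
       (- (sqrt 3 / 6) *
          (Arg (exp (complex_of_real (- sqrt 3 * (\<eta> + \<xi>)) + \<i> * complex_of_real \<xi>) - 1)
           - Arg (g_fun \<eta> \<xi> - (1 - complex_of_real (sqrt 3) * \<i>) / 2)
           + 2 * real_of_int \<lceil>(\<xi> - pi) / (2 * pi)\<rceil> * pi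
           + pi / 6)
        - ln (cmod ((g_fun \<eta> \<xi>)\<^sup>2 - g_fun \<eta> \<xi> + 1)) / 2)
     + \<i> * complex_of_real \<eta> / 2"

text \<open>Meaningful on the strip \<open>- pi / 2 \<le> Im w \<le> 0\<close>, where the value \<open>g_fun \<eta> \<xi>\<close> does not depend on
  the choice of \<open>(\<eta>, \<xi>)\<close>.\<close>

definition T_inv :: "complex \<Rightarrow> complex" where
  "T_inv w =
     (if w \<in> \<real> \<and> Re w \<le> sqrt 3 * pi / 9 then complex_of_real (T0_inv (Re w))
      else (THE v. \<exists>(\<eta>, \<xi>)\<in>Theta. w = H_fun \<eta> \<xi> \<and> v = g_fun \<eta> \<xi>))"

definition W_fun :: "complex \<Rightarrow> complex" where
  "W_fun z =
     (if z \<in> \<real> \<and> 0 < Re z \<and> Re z < sqrt 2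
      then complex_of_real (ln (2 / (2 - (Re z)\<^sup>2) - 1) / 2) - \<i> * complex_of_real pi / 2
      else Ln (1 + 2 / (z\<^sup>2 - 2)) / 2)"

definition G_right :: "complex \<Rightarrow> complex" where
  "G_right z =
     (if z = 0 then - (complex_of_real (sqrt 2) * \<i> / 2) * complex_of_real (exp (sqrt 3 * pi / 9))
      else if z = complex_of_real (sqrt 2)
        then (complex_of_real (sqrt 2) - complex_of_real (sqrt 6) * \<i>) / 4
      else 1 / (z * T_inv (W_fun z)))"

text \<open>Meaningful on the closed upper half-plane without the two real points \<open>\<plusminus> sqrt (2 + \<gamma>\<^sub>0)\<close>,
  \<open>\<gamma>\<^sub>0 = 2 / (exp (2 * sqrt 3 * pi / 9) - 1)\<close>, at which the denominator in \<open>G_right\<close> vanishes.\<close>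

definition G_fun :: "complex \<Rightarrow> complex" where
  "G_fun z = (if 0 \<le> Re z then G_right z else - cnj (G_right (- cnj z)))"

end

theory Submission
  imports Defs "HOL-Complex_Analysis.Complex_Analysis"
begin

text \<open>Why the identity holds. The operator \<open>S_op l N\<close> acts on non-empty words over \<open>{1..N}\<close> as a walk that
adds or removes a first letter, shifted by the constant \<open>l\<close>; on the empty word there is no shift.
Whether a letter may be added depends only on the current first letter \<open>j\<close> and on whether the word is
increasing: an increasing word accepts every \<open>i \<noteq> j\<close> (and stays increasing iff \<open>i < j\<close>), any other V-word
accepts only \<open>i > j\<close>. Hence the resolvent vector at \<open>z = l + \<zeta>\<close> is a product over the letters of a word, with
factors given by two one-parameter recursions, and its vacuum coefficient has the form \<open>1 / (l + F\<^sub>N \<zeta>)\<close>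
with \<open>F\<^sub>N\<close> independent of \<open>l\<close> (\<open>moment_series_up_acc\<close>, for \<open>\<zeta> = \<i> * y\<close> with \<open>y\<close> large). So it remains to identify the limit of \<open>F\<^sub>N \<zeta>\<close> as
\<open>1 / G_fun \<zeta> = \<zeta> * T_inv (W_fun \<zeta>)\<close>.

For \<open>\<zeta> = \<i> * y\<close> the recursions are real and positive. They are Euler schemes, with step \<open>1 / N\<close>, for
\<open>r' = - 1 / r\<close> backwards from \<open>r = y\<close> and for \<open>f' = 1 / f - 1 / r\<close>. The equation of the quotient \<open>t = f / r\<close>
separates, and \<open>T0\<close> is exactly the integral that solves it: \<open>T0 t - ln r\<close> is constant in the limit. This gives
\<open>F\<^sub>N (\<i> * y) \<longlonglongrightarrow> \<i> * y * T0_inv (ln (y\<^sup>2 / (y\<^sup>2 + 2)) / 2)\<close> (\<open>up_acc_tendsto\<close>), which proves the claim on the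
imaginary axis far from the origin; there the moment series of \<open>\<mu>\<close> converges and may be compared term by
term with the moments of \<open>S_op l N\<close>.

Everything else is analytic continuation, and for this \<open>T_inv\<close> has to be recognised as the continuation
of \<open>T0_inv\<close>. Partial fractions at the roots \<open>\<omega>\<close>, \<open>cnj \<omega>\<close> of \<open>v\<^sup>2 - v + 1\<close> express the primitive \<open>T\<close> through logarithms
\<open>f\<^sub>1\<close>, \<open>f\<^sub>2\<close> of \<open>v - \<omega>\<close> and \<open>v - cnj \<omega>\<close> (\<open>T_log\<close>). On the universal cover of the upper half-plane without \<open>\<omega>\<close>
the pair \<open>\<eta> = 2 * Im T\<close>, \<open>\<xi> = Im (f\<^sub>1 + f\<^sub>2)\<close> is a coordinate system in which the point is \<open>g_fun \<eta> \<xi>\<close> and the value of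
\<open>T\<close> is \<open>H_fun \<eta> \<xi>\<close> (\<open>H_fun_eq\<close>). For fixed \<open>\<eta>\<close> the real part of \<open>H_fun\<close> strictly decreases in \<open>\<xi>\<close>, so that
\<open>T_inv\<close> is well defined (\<open>T_inv_eqI\<close>), and it runs through all reals, so that \<open>T_inv\<close> lives on the whole open
strip (\<open>strip_lift\<close>). As \<open>T\<close> has no critical point in the closed upper half-plane except 0, \<open>T_inv\<close> is
locally the restriction of a holomorphic function, also at the negative reals, where it is \<open>T0_inv\<close>. The identity
theorem then carries the formula from the imaginary axis to the first quadrant and, through the reflection
\<open>\<zeta> \<mapsto> - cnj \<zeta>\<close>, \<open>l \<mapsto> - l\<close>, to the second.\<close>

section \<open>The vacuum resolvent of the finite sums\<close>

lemma vword_Cons_Cons: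
  "vword (i # j # w) \<longleftrightarrow> (i < j \<and> sorted_wrt (<) (j # w)) \<or> (j < i \<and> vword (j # w))"
proof
  assume "vword (i # j # w)"
  then obtain m where m: "m \<in> {1..length (i # j # w)}" "sorted_wrt (>) (take m (i # j # w))"
      "sorted_wrt (<) (drop (m - 1) (i # j # w))"
    unfolding vword_def by blast
  show "(i < j \<and> sorted_wrt (<) (j # w)) \<or> (j < i \<and> vword (j # w))"
  proof (cases "m = 1")
    case True
    then show ?thesis using m by simp
  next
    case False
    then obtain k where "m = Suc (Suc k)" using m(1) by (cases m; cases "m - 1") auto
    then show ?thesis using m(2) vword_tl[OF \<open>vword (i # j # w)\<close>] by simp
  qed
next
  assume "(i < j \<and> sorted_wrt (<) (j # w)) \<or> (j < i \<and> vword (j # w))"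
  then show "vword (i # j # w)"
  proof
    assume "i < j \<and> sorted_wrt (<) (j # w)"
    then show ?thesis unfolding vword_def by (intro disjI2 bexI[of _ 1]) auto
  next
    assume *: "j < i \<and> vword (j # w)"
    then obtain m where m: "m \<in> {1..length (j # w)}" "sorted_wrt (>) (take m (j # w))"
        "sorted_wrt (<) (drop (m - 1) (j # w))"
      unfolding vword_def by blast
    then obtain k where k: "m = Suc k" by (cases m) auto
    have "sorted_wrt (>) (take (Suc m) (i # j # w))"
      using m(2) * k by auto
    then show ?thesis using m k unfolding vword_def
      by (intro disjI2 bexI[of _ "Suc m"]) auto
  qed
qed

lemma vword_single [simp]: "vword [i]"
  unfolding vword_def by (intro disjI2 bexI[of _ 1]) auto

lemma vacuum_state_eq: "vacuum_state b = b vacuum []"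
proof -
  have "vacuum_state b = (\<Sum>\<^sub>\<infinity>u\<in>{[]}. b vacuum u * cnj (vacuum u))"
    unfolding vacuum_state_def fock_inner_def
    by (rule infsum_cong_neutral) (auto simp: vacuum_def basis_vec_def)
  then show ?thesis by (simp add: vacuum_def basis_vec_def)
qed

lemma S_op_apply:
  fixes f :: "nat list \<Rightarrow> complex"
  shows "S_op l N f w =
     (if w \<noteq> [] \<and> hd w \<in> {1..N}
      then (if vword w then f (tl w) / sqrt N else 0) + l * f w else 0)
     + (\<Sum>i=1..N. f (i # w)) / sqrt N"
proof -
  have eq: "(creation i f w + annihilation i f w) / complex_of_real (sqrt (real N))
       + complex_of_real l * conservation i f w =
     (if i = hd w then (if w \<noteq> [] then (if vword w then f (tl w) / sqrt N else 0) + l * f w else 0) else 0)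
      + f (i # w) / sqrt N" for i
    by (auto simp: creation_def annihilation_def conservation_def add_divide_distrib)
  show ?thesis unfolding S_op_def eq
    by (simp add: sum.distrib sum_divide_distrib)
qed

text \<open>In the sup norm weighted by \<open>sqrt N ^ length w\<close> each of the \<open>N\<close> annihilators contributes \<open>1 / N\<close>, so the norm of
\<open>S_op l N\<close> is at most \<open>2 + \<bar>l\<bar>\<close>, uniformly in \<open>N\<close>. The uniformity is what later permits the exchange of the
limit in \<open>N\<close> with the moment series.\<close>

lemma S_op_bound:
  fixes f :: "nat list \<Rightarrow> complex"
  assumes N: "N \<ge> 1" and M: "M \<ge> 0" and f: "\<And>w. cmod (f w) \<le> M / sqrt N ^ length w"
  shows "cmod (S_op l N f w) \<le> (2 + \<bar>l\<bar>) * M / sqrt N ^ length w"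
proof -
  define q where "q = sqrt (real N)"
  have q: "q > 0" "q * q = N" using N by (auto simp: q_def)
  define B where "B = M / q ^ length w"
  have B: "B \<ge> 0" using M q by (simp add: B_def)
  have f': "cmod (f w) \<le> M / q ^ length w" for w using f by (simp add: q_def)
  have 1: "cmod (f (tl w) / q) \<le> B" if ne: "w \<noteq> []"
  proof -
    obtain a v where w: "w = a # v" using ne by (cases w) auto
    have "cmod (f v) / q \<le> M / q ^ length v / q"
      using f'[of v] q by (intro divide_right_mono) auto
    then show ?thesis using w q by (simp add: norm_divide B_def mult.commute)
  qed
  have 2: "cmod (l * f w) \<le> \<bar>l\<bar> * B"
    using mult_left_mono[OF f'[of w], of "\<bar>l\<bar>"] by (simp add: norm_mult B_def)
  have 3: "cmod ((\<Sum>i=1..N. f (i # w)) / q) \<le> B"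
  proof -
    have "cmod (\<Sum>i=1..N. f (i # w)) \<le> (\<Sum>i=1..N. M / q ^ Suc (length w))"
    proof (rule sum_norm_le)
      fix i
      show "cmod (f (i # w)) \<le> M / q ^ Suc (length w)" using f'[of "i # w"] by simp
    qed
    also have "\<dots> = B * q" using q by (simp add: B_def field_simps)
    finally show ?thesis using q by (simp add: norm_divide divide_le_eq)
  qed
  have split: "S_op l N f w = (if w \<noteq> [] \<and> hd w \<in> {1..N} then (if vword w then f (tl w) / q else 0) + l * f w else 0)
     + (\<Sum>i=1..N. f (i # w)) / q"
    unfolding S_op_apply q_def ..
  have "cmod (if w \<noteq> [] \<and> hd w \<in> {1..N} then (if vword w then f (tl w) / q else 0) + l * f w else 0)
     \<le> B + \<bar>l\<bar> * B"
  proof (cases "w \<noteq> [] \<and> hd w \<in> {1..N}")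
    case True
    have "cmod (if vword w then f (tl w) / q else 0) \<le> B" using 1 True B by auto
    then show ?thesis using True 2 norm_triangle_mono by auto
  qed (use B in auto)
  then have "cmod (S_op l N f w) \<le> (B + \<bar>l\<bar> * B) + B"
    unfolding split using 3 norm_triangle_mono by blast
  then show ?thesis by (simp add: B_def q_def algebra_simps add_divide_distrib)
qed

lemma S_op_linear:
  "S_op l N (\<lambda>w. a * f w + b * g w) = (\<lambda>w. a * S_op l N f w + b * S_op l N g w)"
  by (rule ext)
     (auto simp: S_op_apply sum.distrib sum_distrib_left add_divide_distrib algebra_simps)

lemma S_op_pow_bound:
  fixes f :: "nat list \<Rightarrow> complex"
  assumes N: "N \<ge> 1" and M: "M \<ge> 0" and f: "\<And>w. cmod (f w) \<le> M / sqrt N ^ length w"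
  shows "cmod ((S_op l N ^^ n) f w) \<le> (2 + \<bar>l\<bar>) ^ n * M / sqrt N ^ length w"
proof (induction n arbitrary: w)
  case 0
  then show ?case using f by simp
next
  case (Suc n)
  have "cmod (S_op l N ((S_op l N ^^ n) f) w) \<le> (2 + \<bar>l\<bar>) * ((2 + \<bar>l\<bar>) ^ n * M) / sqrt N ^ length w"
    by (rule S_op_bound) (use N M Suc in auto)
  then show ?case by (simp add: mult.assoc)
qed

lemma vacuum_moment_bound:
  assumes "N \<ge> 1"
  shows "cmod (vacuum_state (S_op l N ^^ n)) \<le> (2 + \<bar>l\<bar>) ^ n"
proof -
  have "cmod (vacuum w) \<le> 1 / sqrt N ^ length w" for w
    by (auto simp: vacuum_def basis_vec_def)
  then show ?thesis using S_op_pow_bound[of N 1 vacuum n l "[]"] assms by (simp add: vacuum_state_eq)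
qed

text \<open>A bounded solution of \<open>(z - S) r = \<Omega>\<close> is the Neumann series: iterating \<open>r = (\<Omega> + S r) / z\<close> leaves the remainder
\<open>S\<^sup>n r / z\<^sup>n\<close>, which the weighted bound makes geometrically small.\<close>

lemma resolvent_series:
  fixes r :: "nat list \<Rightarrow> complex"
  assumes N: "N \<ge> 1" and M: "M \<ge> 0" and f: "\<And>w. cmod (r w) \<le> M / sqrt N ^ length w"
    and z: "cmod z > 2 + \<bar>l\<bar>"
    and eq: "\<And>w. z * r w = vacuum w + S_op l N r w"
  shows "(\<lambda>n. vacuum_state (S_op l N ^^ n) / z ^ Suc n) sums r []"
proof -
  have z0: "z \<noteq> 0" using z by auto
  have eq': "r = (\<lambda>w. (1 / z) * vacuum w + (1 / z) * S_op l N r w)"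
    using eq z0 by (auto simp: field_simps)
  have step: "(S_op l N ^^ n) r = (\<lambda>w. (1 / z) * (S_op l N ^^ n) vacuum w + (1 / z) * (S_op l N ^^ Suc n) r w)" for n
  proof (induction n)
    case 0
    then show ?case using eq' by simp
  next
    case (Suc n)
    have "(S_op l N ^^ Suc n) r = S_op l N ((S_op l N ^^ n) r)" by simp
    also have "\<dots> = S_op l N (\<lambda>w. (1 / z) * (S_op l N ^^ n) vacuum w + (1 / z) * (S_op l N ^^ Suc n) r w)"
      by (subst Suc) (rule refl)
    finally show ?case by (simp only: S_op_linear funpow.simps o_apply)
  qed
  have partial: "(\<Sum>k<n. vacuum_state (S_op l N ^^ k) / z ^ Suc k) = r [] - (S_op l N ^^ n) r [] / z ^ n" for n
  proof (induction n)
    case (Suc n)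
    have "(S_op l N ^^ n) r [] / z ^ n =
        (S_op l N ^^ n) vacuum [] / z ^ Suc n + (S_op l N ^^ Suc n) r [] / z ^ Suc n"
      using fun_cong[OF step[of n], of "[]"] z0 by (simp add: field_simps)
    moreover have "(\<Sum>k<Suc n. vacuum_state (S_op l N ^^ k) / z ^ Suc k) =
        r [] - (S_op l N ^^ n) r [] / z ^ n + (S_op l N ^^ n) vacuum [] / z ^ Suc n"
      by (simp only: sum.lessThan_Suc Suc vacuum_state_eq[of "S_op l N ^^ n"])
    ultimately show ?case by (simp only:) (simp add: algebra_simps)
  qed simp
  define c where "c = (2 + \<bar>l\<bar>) / cmod z"
  have c: "c \<ge> 0" "c < 1" using z by (auto simp: c_def divide_less_eq)
  have "(\<lambda>n. (S_op l N ^^ n) r [] / z ^ n) \<longlonglongrightarrow> 0"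
  proof (rule Lim_null_comparison)
    show "(\<lambda>n. M * c ^ n) \<longlonglongrightarrow> 0"
      using LIMSEQ_power_zero[of c] c by (auto intro: tendsto_mult_right_zero)
    show "eventually (\<lambda>n. norm ((S_op l N ^^ n) r [] / z ^ n) \<le> M * c ^ n) sequentially"
    proof (intro always_eventually allI)
      fix n
      have "cmod ((S_op l N ^^ n) r []) \<le> (2 + \<bar>l\<bar>) ^ n * M"
        using S_op_pow_bound[of N M r n l "[]"] N M f by simp
      then show "norm ((S_op l N ^^ n) r [] / z ^ n) \<le> M * c ^ n"
        using z by (simp add: norm_divide norm_power c_def power_divide divide_right_mono mult.commute)
    qed
  qed
  then have "(\<lambda>n. r [] - (S_op l N ^^ n) r [] / z ^ n) \<longlonglongrightarrow> r [] - 0"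
    by (intro tendsto_intros)
  then show ?thesis unfolding sums_def partial by simp
qed

text \<open>The two recursions behind the resolvent at \<open>z = l + \<i> * y\<close>, with the factors \<open>- \<i>\<close> removed. From a
V-word that is not increasing, with first letter \<open>i\<close>, only larger letters may be added; the reciprocal of its
weight is \<open>y\<close> plus \<open>h = 1 / N\<close> times the sum of their weights, which depends on the distance \<open>k = N - i\<close> only.\<close>

primrec down_den :: "real \<Rightarrow> real \<Rightarrow> nat \<Rightarrow> real" where
  "down_den h y 0 = y"
| "down_den h y (Suc k) = down_den h y k + h / down_den h y k"

text \<open>An increasing word with first letter \<open>i\<close> may receive smaller letters, keeping it increasing, or larger ones,
which turn it into a word of the other kind. The weight depends on the first letter only, and \<open>up_acc h y N i\<close> is \<open>y\<close> plus
\<open>h\<close> times the sum of the weights for the first letters \<open>1, \<dots>, i\<close>; \<open>down_den h y (N - Suc i) - y\<close> is the contribution of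
the letters above \<open>Suc i\<close>.\<close>

primrec up_acc :: "real \<Rightarrow> real \<Rightarrow> nat \<Rightarrow> nat \<Rightarrow> real" where
  "up_acc h y N 0 = y"
| "up_acc h y N (Suc i) = up_acc h y N i + h / (up_acc h y N i + down_den h y (N - Suc i) - y)"

lemma down_den_ge: "y > 0 \<Longrightarrow> h \<ge> 0 \<Longrightarrow> down_den h y k \<ge> y"
proof (induction k)
  case (Suc k)
  then have "down_den h y k \<ge> y" by simp
  then have "h / down_den h y k \<ge> 0" using Suc.prems by (intro divide_nonneg_nonneg) linarith+
  then show ?case using \<open>down_den h y k \<ge> y\<close> unfolding down_den.simps by linarith
qed simp

lemma up_acc_ge: "y > 0 \<Longrightarrow> h \<ge> 0 \<Longrightarrow> up_acc h y N i \<ge> y"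
proof (induction i)
  case (Suc i)
  have "h / (up_acc h y N i + down_den h y (N - Suc i) - y) \<ge> 0"
    using Suc down_den_ge[of y h "N - Suc i"] by simp
  then show ?case using Suc by simp
qed simp

lemma sum_down_den:
  assumes "k \<le> N"
  shows "(\<Sum>j=Suc (N - k)..N. h / down_den h y (N - j)) = down_den h y k - y"
  using assms
proof (induction k)
  case (Suc k)
  then have "{Suc (N - Suc k)..N} = insert (N - k) {Suc (N - k)..N}" by auto
  then show ?case using Suc by simp
qed simp

lemma sum_up_acc:
  "(\<Sum>j=1..i. h / (up_acc h y N (j - 1) + down_den h y (N - j) - y)) = up_acc h y N i - y"
  by (induction i) (simp_all add: sum.cl_ivl_Suc)

definition step_coeff :: "nat \<Rightarrow> real \<Rightarrow> nat list \<Rightarrow> real" where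
  "step_coeff N y w =
     (if sorted_wrt (<) w
      then 1 / (up_acc (1 / N) y N (hd w - 1) + down_den (1 / N) y (N - hd w) - y)
      else 1 / down_den (1 / N) y (N - hd w))"

primrec resolvent_coeff :: "real \<Rightarrow> nat \<Rightarrow> real \<Rightarrow> nat list \<Rightarrow> complex" where
  "resolvent_coeff l N y [] = 1 / (l + \<i> * up_acc (1 / N) y N N)"
| "resolvent_coeff l N y (i # w) = - \<i> * step_coeff N y (i # w) / sqrt N * resolvent_coeff l N y w"

definition resolvent_vec :: "real \<Rightarrow> nat \<Rightarrow> real \<Rightarrow> nat list \<Rightarrow> complex" where
  "resolvent_vec l N y w = (if vword w \<and> set w \<subseteq> {1..N} then resolvent_coeff l N y w else 0)"

lemma step_coeff_bounds:
  assumes "y > 0"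
  shows "0 < step_coeff N y w" "step_coeff N y w \<le> 1 / y"
proof -
  have "down_den (1 / N) y k \<ge> y" "up_acc (1 / N) y N k \<ge> y" for k
    using assms by (auto intro: down_den_ge up_acc_ge)
  then have "y \<le> up_acc (1 / N) y N (hd w - 1) + down_den (1 / N) y (N - hd w) - y"
      "y \<le> down_den (1 / N) y (N - hd w)"
    by (smt (verit))+
  then show "0 < step_coeff N y w" "step_coeff N y w \<le> 1 / y"
    using assms by (auto simp: step_coeff_def intro!: divide_left_mono)
qed

text \<open>The equation \<open>(z - S) r = \<Omega>\<close> at a non-empty word, after division by the coefficient of the word: the weights of
all admissible new letters, each divided by \<open>N\<close>, sum to the reciprocal of the weight of the present one, less \<open>y\<close>.\<close>

lemma sum_step_coeff:
  assumes w: "vword (j # w)" and j: "j \<in> {1..N}" and y: "y > 0"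
  shows "(\<Sum>i=1..N. if vword (i # j # w) then step_coeff N y (i # j # w) / N else 0)
           = 1 / step_coeff N y (j # w) - y"
proof -
  let ?F = "\<lambda>i. if vword (i # j # w) then step_coeff N y (i # j # w) / N else 0"
  let ?h = "1 / real N"
  have "{1..N} = {1..j - 1} \<union> (insert j {Suc j..N})" using j by auto
  then have "sum ?F {1..N} = sum ?F {1..j - 1} + sum ?F (insert j {Suc j..N})"
    using j by (simp only:) (rule sum.union_disjoint, auto)
  also have "sum ?F (insert j {Suc j..N}) = sum ?F {Suc j..N}"
    by (subst sum.insert) (auto simp: vword_Cons_Cons)
  also have "sum ?F {Suc j..N} = (\<Sum>i=Suc j..N. ?h / down_den ?h y (N - i))"
    by (rule sum.cong) (use w in \<open>auto simp: vword_Cons_Cons step_coeff_def\<close>)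
  also have "\<dots> = down_den ?h y (N - j) - y"
    using sum_down_den[of "N - j" N ?h y] j by simp
  also have "sum ?F {1..j - 1} = (if sorted_wrt (<) (j # w) then up_acc ?h y N (j - 1) - y else 0)"
  proof (cases "sorted_wrt (<) (j # w)")
    case True
    have "sum ?F {1..j - 1} = (\<Sum>i=1..j - 1. ?h / (up_acc ?h y N (i - 1) + down_den ?h y (N - i) - y))"
      by (rule sum.cong) (use True in \<open>auto simp: vword_Cons_Cons step_coeff_def\<close>)
    then show ?thesis using True by (simp only: sum_up_acc) simp
  next
    case False
    then show ?thesis by (auto simp: vword_Cons_Cons intro!: sum.neutral)
  qed
  finally show ?thesis by (auto simp: step_coeff_def)
qed

text \<open>At the empty word the diagonal part \<open>l\<close> is missing, so \<open>l\<close> survives in the vacuum coefficient; at every other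
word it cancels against the real part of \<open>z = l + \<i> * y\<close>.\<close>

lemma resolvent_vec_eq:
  assumes y: "y > 0"
  shows "(l + \<i> * y) * resolvent_vec l N y w = vacuum w + S_op l N (resolvent_vec l N y) w"
proof (cases "vword w \<and> set w \<subseteq> {1..N}")
  case False
  then have w: "w \<noteq> []" "resolvent_vec l N y w = 0" by (auto simp: resolvent_vec_def)
  have "resolvent_vec l N y (i # w) = 0" for i
    using False vword_tl by (auto simp: resolvent_vec_def)
  moreover have "resolvent_vec l N y (tl w) = 0" if "vword w" "hd w \<in> {1..N}"
    using False that w by (cases w) (auto simp: resolvent_vec_def)
  ultimately show ?thesis using w by (auto simp: S_op_apply vacuum_def basis_vec_def)
next
  case True
  define q where "q = complex_of_real (sqrt N)"
  define c where "c = (\<Sum>i=1..N. if vword (i # w) then step_coeff N y (i # w) / N else 0)"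
  have qq: "q * q = of_nat N" by (simp add: q_def flip: of_real_mult)
  have qN: "x / q / q = x / of_nat N" for x using qq by simp
  have r: "resolvent_vec l N y w = resolvent_coeff l N y w" using True by (simp add: resolvent_vec_def)
  have "(\<Sum>i=1..N. resolvent_vec l N y (i # w)) / q =
      (\<Sum>i=1..N. - \<i> * resolvent_coeff l N y w * of_real (if vword (i # w) then step_coeff N y (i # w) / N else 0))"
    unfolding sum_divide_distrib
  proof (rule sum.cong)
    fix i assume i: "i \<in> {1..N}"
    show "resolvent_vec l N y (i # w) / q = - \<i> * resolvent_coeff l N y w * of_real (if vword (i # w) then step_coeff N y (i # w) / N else 0)"
    proof (cases "vword (i # w)")
      case v: True
      then have "resolvent_vec l N y (i # w) / q =  (- \<i> * step_coeff N y (i # w) * resolvent_coeff l N y w) / q / q"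
        using True i by (simp add: resolvent_vec_def q_def)
      then show ?thesis using v unfolding qN by simp
    qed (auto simp: resolvent_vec_def)
  qed simp
  also have "\<dots> = - \<i> * resolvent_coeff l N y w * c"
    unfolding c_def of_real_sum sum_distrib_left ..
  finally have sum: "(\<Sum>i=1..N. resolvent_vec l N y (i # w)) / q = - \<i> * resolvent_coeff l N y w * c" .
  show ?thesis
  proof (cases w)
    case Nil
    have "c = (\<Sum>i=1..N. (1 / N) / (up_acc (1 / N) y N (i - 1) + down_den (1 / N) y (N - i) - y))"
      unfolding c_def Nil by (rule sum.cong) (auto simp: step_coeff_def)
    then have c: "c = up_acc (1 / N) y N N - y" by (simp only: sum_up_acc)
    have "up_acc (1 / N) y N N \<ge> y" using y by (intro up_acc_ge) auto
    then have "l + \<i> * up_acc (1 / N) y N N \<noteq> 0" using y by (auto simp: complex_eq_iff)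
    then have "(l + \<i> * up_acc (1 / N) y N N) * resolvent_coeff l N y w = 1" by (simp add: Nil)
    moreover have "complex_of_real (up_acc (1 / N) y N N) = c + y" using c by simp
    ultimately have "(l + \<i> * (c + y)) * resolvent_coeff l N y w = 1" by simp
    then have "(l + \<i> * y) * resolvent_coeff l N y w = 1 + - \<i> * resolvent_coeff l N y w * c"
      by (simp add: algebra_simps)
    then show ?thesis unfolding S_op_apply q_def[symmetric] sum
      using r by (simp add: Nil vacuum_def basis_vec_def)
  next
    case (Cons j v)
    have c: "c = 1 / step_coeff N y w - y"
      unfolding c_def Cons by (rule sum_step_coeff) (use True Cons y in auto)
    have s: "step_coeff N y w > 0" using step_coeff_bounds y by blast
    have q: "q \<noteq> 0" using True Cons by (auto simp: q_def)
    have rv: "resolvent_vec l N y v = resolvent_coeff l N y v"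
      using True Cons vword_tl by (auto simp: resolvent_vec_def)
    have rw: "resolvent_coeff l N y w = - \<i> * step_coeff N y w / q * resolvent_coeff l N y v"
      by (simp add: Cons q_def)
    have "\<i> * resolvent_coeff l N y w / step_coeff N y w = resolvent_coeff l N y v / q"
      unfolding rw using s q by (simp add: field_simps)
    then have "(l + \<i> * y) * resolvent_coeff l N y w =
        resolvent_coeff l N y v / q + l * resolvent_coeff l N y w - \<i> * resolvent_coeff l N y w * c"
      unfolding c using s by (simp add: algebra_simps)
    then show ?thesis unfolding S_op_apply q_def[symmetric] sum
      using True r rv by (simp add: Cons vacuum_def basis_vec_def)
  qed
qed

lemma moment_series_up_acc:
  assumes N: "N \<ge> 1" and y: "y > 2 + \<bar>l\<bar>"
  shows "(\<lambda>n. vacuum_state (S_op l N ^^ n) / (l + \<i> * y) ^ Suc n) sums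
           (1 / (l + \<i> * up_acc (1 / N) y N N))"
proof -
  define M where "M = cmod (resolvent_coeff l N y [])"
  have bound: "cmod (resolvent_coeff l N y w) \<le> M / sqrt N ^ length w" for w
  proof (induction w)
    case (Cons i w)
    have s: "0 < step_coeff N y (i # w)" "step_coeff N y (i # w) \<le> 1"
      using step_coeff_bounds[of y N "i # w"] y divide_le_eq_1[of 1 y] by linarith+
    have "cmod (resolvent_coeff l N y (i # w)) =
        step_coeff N y (i # w) * (cmod (resolvent_coeff l N y w) / sqrt N)"
      using s by (simp add: norm_mult norm_divide)
    also have "\<dots> \<le> 1 * (M / sqrt N ^ length w / sqrt N)"
      using s Cons by (intro mult_mono divide_right_mono) auto
    finally show ?case by (simp add: mult.commute)
  qed (simp add: M_def)
  have "M \<ge> 0" by (simp add: M_def)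
  then have bound': "cmod (resolvent_vec l N y w) \<le> M / sqrt N ^ length w" for w
    using bound[of w] by (auto simp: resolvent_vec_def)
  have "cmod (l + \<i> * y) \<ge> y" using abs_Im_le_cmod[of "l + \<i> * y"] y by simp
  then have z: "cmod (l + \<i> * y) > 2 + \<bar>l\<bar>" using y by simp
  have "(\<lambda>n. vacuum_state (S_op l N ^^ n) / (l + \<i> * y) ^ Suc n) sums resolvent_vec l N y []"
    by (rule resolvent_series[OF N _ bound' z]) (use \<open>M \<ge> 0\<close> y resolvent_vec_eq in auto)
  then show ?thesis by (simp add: resolvent_vec_def)
qed

section \<open>The primitive T and its logarithmic coordinates\<close>

definition sixth_root :: complex where
  "sixth_root = (1 + complex_of_real (sqrt 3) * \<i>) / 2"

text \<open>For logarithms \<open>f\<^sub>1\<close>, \<open>f\<^sub>2\<close> of \<open>v - \<omega>\<close> and \<open>v - cnj \<omega>\<close>, with \<open>\<omega> = exp (\<i> * pi / 3)\<close>, this is the primitive of \<open>- v / (v\<^sup>2 - v + 1)\<close>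
given by partial fractions. The constant makes the branch with principal logarithms vanish at \<open>v = 1\<close>, as
\<open>T0\<close> does. Keeping the logarithms as arguments stands in for working on a universal cover.\<close>

definition T_log :: "complex \<Rightarrow> complex \<Rightarrow> complex" where
  "T_log f\<^sub>1 f\<^sub>2 = - (f\<^sub>1 + f\<^sub>2) / 2 + \<i> * (f\<^sub>1 - f\<^sub>2) / complex_of_real (2 * sqrt 3)
     - complex_of_real (sqrt 3 * pi / 9)"

lemma Re_sixth_root [simp]: "Re sixth_root = 1 / 2" and Im_sixth_root [simp]: "Im sixth_root = sqrt 3 / 2"
  by (auto simp: sixth_root_def)

lemma cnj_sixth_root: "cnj sixth_root = (1 - complex_of_real (sqrt 3) * \<i>) / 2"
  by (simp add: sixth_root_def)

lemma sixth_root_minus_cnj: "sixth_root - cnj sixth_root = complex_of_real (sqrt 3) * \<i>"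
  by (auto simp: complex_eq_iff)

lemma sixth_root_factor: "v\<^sup>2 - v + 1 = (v - sixth_root) * (v - cnj sixth_root)"
proof -
  have "sixth_root + cnj sixth_root = 1" by (auto simp: complex_eq_iff)
  moreover have "sixth_root * cnj sixth_root = 1" by (auto simp: complex_eq_iff)
  ultimately show ?thesis by algebra
qed

lemma Re_T_log: "Re (T_log f g) = - (Re f + Re g) / 2 - (Im f - Im g) / (2 * sqrt 3) - sqrt 3 * pi / 9"
  and Im_T_log: "Im (T_log f g) = - (Im f + Im g) / 2 + (Re f - Re g) / (2 * sqrt 3)"
  by (simp_all add: T_log_def Re_divide_of_real Im_divide_of_real diff_divide_distrib add_divide_distrib
      del: of_real_mult)

lemma norm_diff_sixth_root: "(cmod (v - cnj sixth_root))\<^sup>2 - (cmod (v - sixth_root))\<^sup>2 = 2 * sqrt 3 * Im v"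
  unfolding cmod_power2 by (simp add: power2_eq_square algebra_simps)

lemma norm_sixth_root_less_iff: "cmod (v - sixth_root) < cmod (v - cnj sixth_root) \<longleftrightarrow> Im v > 0"
proof -
  have "cmod (v - sixth_root) < cmod (v - cnj sixth_root) \<longleftrightarrow> (cmod (v - sixth_root))\<^sup>2 < (cmod (v - cnj sixth_root))\<^sup>2"
    by (metis norm_ge_zero power2_less_imp_less power_strict_mono zero_less_numeral)
  moreover have "0 < 2 * sqrt 3 * Im v \<longleftrightarrow> 0 < Im v" by (simp add: zero_less_mult_iff)
  ultimately show ?thesis using norm_diff_sixth_root[of v] by linarith
qed

text \<open>Write \<open>q\<close> for the exponential in \<open>g_fun\<close>. The two coordinates prescribe \<open>\<bar>v - \<omega>\<bar> / \<bar>v - cnj \<omega>\<bar>\<close> and the argument of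
\<open>(v - \<omega>) * (v - cnj \<omega>)\<close>, that is, the modulus and the argument of \<open>q = (v - cnj \<omega>) / cnj (v - \<omega>)\<close>; together with its conjugate
this is a linear system for \<open>v\<close>, and \<open>g_fun\<close> is its solution.\<close>

lemma g_fun_eq:
  assumes v: "Im v > 0" and f1: "exp f\<^sub>1 = v - sixth_root" and f2: "exp f\<^sub>2 = v - cnj sixth_root"
    and \<xi>: "\<xi> = Im f\<^sub>1 + Im f\<^sub>2" and \<eta>: "sqrt 3 * (\<eta> + \<xi>) = Re f\<^sub>1 - Re f\<^sub>2"
  shows "g_fun \<eta> \<xi> = v"
    and "\<eta> + \<xi> < 0"
    and "exp (complex_of_real (- sqrt 3 * (\<eta> + \<xi>)) + \<i> * complex_of_real \<xi>) - 1
           = of_real (2 * Im v * exp (- 2 * Re f\<^sub>1)) * (\<i> * exp f\<^sub>1)"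
proof -
  have nz: "v - sixth_root \<noteq> 0" "v - cnj sixth_root \<noteq> 0" using f1 f2 by (metis exp_not_eq_zero)+
  have "exp (Re f\<^sub>1) < exp (Re f\<^sub>2)"
    using norm_sixth_root_less_iff[of v] v by (simp flip: f1 f2)
  then show neg: "\<eta> + \<xi> < 0" using \<eta>
    by (smt (verit) exp_less_cancel_iff mult_nonneg_nonneg real_sqrt_ge_zero)
  define q where "q = exp (complex_of_real (- sqrt 3 * (\<eta> + \<xi>)) + \<i> * complex_of_real \<xi>)"
  have "complex_of_real (- sqrt 3 * (\<eta> + \<xi>)) + \<i> * complex_of_real \<xi> = f\<^sub>2 - cnj f\<^sub>1"
    using \<eta> \<xi> by (simp add: complex_eq_iff)
  then have q: "q = (v - cnj sixth_root) / cnj (v - sixth_root)"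
    unfolding q_def by (simp add: exp_diff f1 f2 flip: exp_cnj)
  have B: "cnj (v - sixth_root) \<noteq> 0" using nz by simp
  have q1: "q - 1 = (v - cnj v) / cnj (v - sixth_root)" using B by (simp add: q field_simps)
  have vv: "v - cnj v \<noteq> 0" using v by (auto simp: complex_eq_iff)
  have "cmod q = exp (- sqrt 3 * (\<eta> + \<xi>))" by (simp add: q_def)
  then have "exp (- 2 * sqrt 3 * (\<eta> + \<xi>)) = (cmod q)\<^sup>2" by (simp flip: exp_double)
  then have e: "complex_of_real (1 - exp (- 2 * sqrt 3 * (\<eta> + \<xi>))) = 1 - q * cnj q"
    by (simp only: of_real_diff of_real_1 complex_norm_square)
  have "1 - q * cnj q = (v - cnj v) * (sixth_root - cnj sixth_root) / ((v - sixth_root) * cnj (v - sixth_root))"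
    using B nz by (simp add: q divide_simps) (simp add: algebra_simps)
  then have eqq: "1 - q * cnj q = (v - cnj v) * (complex_of_real (sqrt 3) * \<i>) / ((v - sixth_root) * cnj (v - sixth_root))"
    by (simp only: sixth_root_minus_cnj)
  have "complex_of_real (sqrt 3) * \<i> * (q - 1) / (1 - q * cnj q) = v - sixth_root"
    unfolding eqq unfolding q1 sixth_root_minus_cnj using vv B nz by (simp add: divide_simps mult_ac)
  then have "complex_of_real (sqrt 3) * \<i> * (q - 1) / complex_of_real (1 - exp (- 2 * sqrt 3 * (\<eta> + \<xi>))) = v - sixth_root"
    by (simp only: e)
  then show "g_fun \<eta> \<xi> = v"
    unfolding g_fun_def q_def[symmetric] sixth_root_def[symmetric] by simp
  have "exp f\<^sub>1 * cnj (exp f\<^sub>1) = of_real ((cmod (exp f\<^sub>1))\<^sup>2)"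
    by (simp only: complex_norm_square)
  also have "(cmod (exp f\<^sub>1))\<^sup>2 = exp (2 * Re f\<^sub>1)"
    by (simp add: exp_double)
  finally have "cnj (v - sixth_root) * exp f\<^sub>1 = of_real (exp (2 * Re f\<^sub>1))"
    by (simp only: f1 mult.commute)
  then have "1 / cnj (v - sixth_root) = exp f\<^sub>1 * of_real (exp (- 2 * Re f\<^sub>1))"
    using B by (simp add: field_simps exp_minus)
  moreover have "v - cnj v = of_real (2 * Im v) * \<i>" by (simp add: complex_eq_iff)
  ultimately have "q - 1 = of_real (2 * Im v) * \<i> * (exp f\<^sub>1 * of_real (exp (- 2 * Re f\<^sub>1)))"
    unfolding q1 by (simp add: divide_inverse)
  then show "exp (complex_of_real (- sqrt 3 * (\<eta> + \<xi>)) + \<i> * complex_of_real \<xi>) - 1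
           = of_real (2 * Im v * exp (- 2 * Re f\<^sub>1)) * (\<i> * exp f\<^sub>1)"
    unfolding q_def by (simp add: mult_ac)
qed

text \<open>The ceiling in \<open>H_fun\<close> selects the continuous branch of the argument of \<open>q - 1\<close>. As \<open>\<bar>q\<bar> > 1\<close>, this is the one within
\<open>pi / 2\<close> of the argument \<open>\<xi>\<close> of \<open>q\<close>. Subtracting the real number 1 does not move a point across the real axis, so both
arguments reach their principal values by the same multiple of \<open>2 * pi\<close>.\<close>

lemma Arg_minus_one:
  assumes q: "q = of_real r * exp (\<i> * of_real \<xi>)" "r > 0"
    and q1: "q - 1 = of_real \<rho> * exp (\<i> * of_real \<phi>)" "\<rho> > 0"
    and close: "\<bar>\<phi> - \<xi>\<bar> < pi / 2"
  shows "Arg (q - 1) + 2 * real_of_int \<lceil>(\<xi> - pi) / (2 * pi)\<rceil> * pi = \<phi>"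
proof -
  define k where "k = \<lceil>(\<xi> - pi) / (2 * pi)\<rceil>"
  define \<alpha> where "\<alpha> = \<xi> - 2 * of_int k * pi"
  define \<beta> where "\<beta> = \<phi> - 2 * of_int k * pi"
  have "of_int k - 1 < (\<xi> - pi) / (2 * pi)" "(\<xi> - pi) / (2 * pi) \<le> of_int k"
    unfolding k_def by linarith+
  then have \<alpha>: "-pi < \<alpha>" "\<alpha> \<le> pi"
    by (auto simp: \<alpha>_def field_simps)
  have \<alpha>\<beta>: "\<beta> - \<alpha> < pi / 2" "\<alpha> - \<beta> < pi / 2" using close unfolding \<alpha>_def \<beta>_def by linarith+
  have sin_shift: "sin (x - 2 * of_int k * pi) = sin x" "cos (x - 2 * of_int k * pi) = cos x" for x :: real
    using sin.minus_of_int[of x k] cos.minus_of_int[of x k] by (simp_all add: mult.commute mult.left_commute)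
  have "Im q = Im (q - 1)" by simp
  then have s: "r * sin \<alpha> = \<rho> * sin \<beta>"
    unfolding q1(1) unfolding q(1)
    by (simp add: exp_Euler \<alpha>_def \<beta>_def sin_shift sin_of_real cos_of_real)
  have \<beta>: "-pi < \<beta> \<and> \<beta> \<le> pi"
  proof -
    consider "0 < \<alpha>" "\<alpha> < pi" | "\<alpha> = pi" | "\<alpha> = 0" | "\<alpha> < 0" using \<alpha> by linarith
    then show ?thesis
    proof cases
      case 1
      then have "sin \<beta> > 0" using s sin_gt_zero[of \<alpha>] q(2) q1(2)
        by (metis mult_pos_pos zero_less_mult_pos)
      moreover have "sin \<beta> < 0" if "\<beta> > pi"
      proof -
        have "sin (\<beta> - pi) > 0" using that 1 \<alpha>\<beta> by (intro sin_gt_zero) auto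
        then show ?thesis by simp
      qed
      ultimately show ?thesis using 1 \<alpha>\<beta> pi_gt_zero by (cases "\<beta> > pi") auto
    next
      case 2
      then have "sin \<beta> = 0" using s q1(2) by simp
      then have "sin (\<beta> - pi) = 0" by simp
      moreover have "sin (\<beta> - pi) > 0" if "\<beta> > pi"
        using that 2 \<alpha>\<beta> by (intro sin_gt_zero) auto
      ultimately show ?thesis using 2 \<alpha>\<beta> pi_gt_zero by (cases "\<beta> > pi") auto
    next
      case 3
      then show ?thesis using \<alpha>\<beta> pi_gt_zero by auto
    next
      case 4
      then have "sin (- \<alpha>) > 0" using \<alpha> by (intro sin_gt_zero) auto
      then have "r * sin \<alpha> < 0" using q(2) by (simp add: mult_pos_neg)
      then have sb: "sin \<beta> < 0" using s q1(2) by (simp add: mult_less_0_iff)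
      have "sin \<beta> \<ge> 0" if "\<beta> \<le> -pi"
      proof -
        have "sin (\<beta> + 2 * pi) \<ge> 0" using that 4 \<alpha> \<alpha>\<beta> by (intro sin_ge_zero) auto
        then show ?thesis by simp
      qed
      then show ?thesis using sb 4 \<alpha>\<beta> pi_gt_zero by (cases "\<beta> \<le> -pi") auto
    qed
  qed
  have "exp (\<i> * of_real \<phi>) = exp (\<i> * of_real \<beta>)"
    by (simp add: complex_eq_iff Re_exp Im_exp \<beta>_def sin_shift)
  then have "of_real \<rho> * exp (\<i> * of_real \<beta>) = q - 1" using q1 by simp
  then have "Arg (q - 1) = \<beta>" by (rule Arg_unique) (use \<beta> q1 in auto)
  then show ?thesis by (simp add: \<beta>_def k_def)
qed

lemma Im_Ln_minus_cnj_sixth_root: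
  assumes "Im v > - sqrt 3 / 2"
  shows "v \<noteq> cnj sixth_root" "0 < Im (Ln (v - cnj sixth_root))" "Im (Ln (v - cnj sixth_root)) < pi"
proof -
  have "Im (v - cnj sixth_root) > 0" using assms by simp
  then show "v \<noteq> cnj sixth_root" "0 < Im (Ln (v - cnj sixth_root))" "Im (Ln (v - cnj sixth_root)) < pi"
    using Im_Ln_pos_lt_imp by auto
qed

text \<open>In the coordinates \<open>\<eta>\<close>, \<open>\<xi>\<close> the point is \<open>g_fun\<close> and the primitive is \<open>H_fun\<close>. The right
branch of the argument in \<open>H_fun\<close> is recognised as follows: the imaginary part of \<open>Ln (v - cnj \<omega>)\<close> lies in
\<open>{0 <..< pi}\<close>, which places \<open>Im f\<^sub>1 + pi / 2\<close>, an argument of \<open>q - 1\<close>, within \<open>pi / 2\<close> of \<open>\<xi>\<close>.\<close>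

lemma H_fun_eq:
  assumes v: "Im v > 0" and f1: "exp f\<^sub>1 = v - sixth_root"
    and \<xi>: "\<xi> = Im f\<^sub>1 + Im (Ln (v - cnj sixth_root))" and w: "w = T_log f\<^sub>1 (Ln (v - cnj sixth_root))"
    and \<eta>: "\<eta> = 2 * Im w"
  shows "g_fun \<eta> \<xi> = v" "\<eta> + \<xi> < 0" "H_fun \<eta> \<xi> = w"
proof -
  define f2 where "f2 = Ln (v - cnj sixth_root)"
  have "Im v > - sqrt 3 / 2" using v by (intro order.strict_trans[OF _ v]) simp
  note f2b = Im_Ln_minus_cnj_sixth_root[OF this, folded f2_def]
  have ef2: "exp f2 = v - cnj sixth_root" unfolding f2_def using f2b(1) by simp
  have \<eta>\<xi>: "sqrt 3 * (\<eta> + \<xi>) = Re f\<^sub>1 - Re f2"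
    using \<eta> \<xi> w by (simp add: Im_T_log f2_def[symmetric] field_simps)
  have \<xi>': "\<xi> = Im f\<^sub>1 + Im f2" using \<xi> by (simp add: f2_def)
  note g = g_fun_eq[OF v f1 ef2 \<xi>' \<eta>\<xi>]
  show "g_fun \<eta> \<xi> = v" "\<eta> + \<xi> < 0" using g by auto
  define q where "q = exp (complex_of_real (- sqrt 3 * (\<eta> + \<xi>)) + \<i> * complex_of_real \<xi>)"
  have qa: "q = of_real (exp (- sqrt 3 * (\<eta> + \<xi>))) * exp (\<i> * of_real \<xi>)"
    unfolding q_def exp_add exp_of_real ..
  have qb: "q - 1 = of_real (2 * Im v * exp (- Re f\<^sub>1)) * exp (\<i> * of_real (Im f\<^sub>1 + pi / 2))"
  proof -
    have "exp (\<i> * of_real (Im f\<^sub>1 + pi / 2)) = \<i> * exp (\<i> * of_real (Im f\<^sub>1))"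
      by (simp add: complex_eq_iff Re_exp Im_exp cos_add sin_add)
    moreover have "exp f\<^sub>1 = of_real (exp (Re f\<^sub>1)) * exp (\<i> * of_real (Im f\<^sub>1))"
      by (simp add: complex_eq_iff Re_exp Im_exp)
    moreover have e3: "exp (- 2 * Re f\<^sub>1) * exp (Re f\<^sub>1) = exp (- Re f\<^sub>1)"
      by (simp flip: exp_add)
    moreover have "of_real (a * b) * (\<i> * (of_real c * z)) = of_real (a * (b * c)) * (\<i> * z)" for a b c z
      by (simp add: mult_ac)
    ultimately have "of_real (2 * Im v * exp (- 2 * Re f\<^sub>1)) * (\<i> * exp f\<^sub>1) =
        of_real (2 * Im v * (exp (- 2 * Re f\<^sub>1) * exp (Re f\<^sub>1))) * exp (\<i> * of_real (Im f\<^sub>1 + pi / 2))"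
      by (simp only:)
    then show ?thesis
      unfolding q_def g(3) e3 .
  qed
  have qc: "\<bar>Im f\<^sub>1 + pi / 2 - \<xi>\<bar> < pi / 2" using \<xi>' f2b by linarith
  have A: "Arg (q - 1) + 2 * real_of_int \<lceil>(\<xi> - pi) / (2 * pi)\<rceil> * pi = Im f\<^sub>1 + pi / 2"
    by (rule Arg_minus_one[OF qa _ qb _ qc]) (use v in simp_all)
  have A2: "Arg (v - (1 - complex_of_real (sqrt 3) * \<i>) / 2) = Im f2"
    unfolding f2_def cnj_sixth_root[symmetric] using f2b(1) by (simp add: Arg_eq_Im_Ln)
  have "cmod (v\<^sup>2 - v + 1) = exp (Re f\<^sub>1 + Re f2)"
    unfolding sixth_root_factor f1[symmetric] ef2[symmetric] by (simp add: norm_mult exp_add)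
  then have L: "ln (cmod (v\<^sup>2 - v + 1)) = Re f\<^sub>1 + Re f2" by simp
  have *: "Arg (q - 1) - Im f2 + 2 * real_of_int \<lceil>(\<xi> - pi) / (2 * pi)\<rceil> * pi + pi / 6
       = Im f\<^sub>1 - Im f2 + 2 * pi / 3" using A by simp
  have **: "x / (2 * sqrt 3) = sqrt 3 / 6 * x" for x :: real
    by (simp add: field_simps)
  have "H_fun \<eta> \<xi> = complex_of_real (- (sqrt 3 / 6) * (Im f\<^sub>1 - Im f2 + 2 * pi / 3) - (Re f\<^sub>1 + Re f2) / 2)
      + \<i> * complex_of_real \<eta> / 2"
    unfolding H_fun_def g(1) q_def[symmetric] A2 L * ..
  moreover have "Re w = - (sqrt 3 / 6) * (Im f\<^sub>1 - Im f2 + 2 * pi / 3) - (Re f\<^sub>1 + Re f2) / 2"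
  proof -
    have "sqrt 3 / 6 * (Im f\<^sub>1 - Im f2 + 2 * pi / 3) = sqrt 3 / 6 * (Im f\<^sub>1 - Im f2) + sqrt 3 * pi / 9"
      by (simp add: distrib_left)
    then show ?thesis unfolding w f2_def[symmetric] Re_T_log ** mult_minus_left by linarith
  qed
  ultimately show "H_fun \<eta> \<xi> = w"
    using \<eta> by (simp add: complex_eq_iff)
qed

section \<open>Uniqueness: the real part decreases in the second coordinate\<close>

text \<open>The reciprocal of the exponential in \<open>g_fun\<close>. For \<open>\<eta> + \<xi> < 0\<close> it lies in the unit disc, so that \<open>1 - cover_pt \<eta> \<xi>\<close> has a principal
logarithm depending smoothly on \<open>\<xi>\<close>.\<close>

definition cover_pt :: "real \<Rightarrow> real \<Rightarrow> complex" where
  "cover_pt \<eta> \<xi> = exp (of_real (sqrt 3 * (\<eta> + \<xi>)) - \<i> * of_real \<xi>)"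

text \<open>The real part of \<open>H_fun\<close> for \<open>\<eta> + \<xi> < 0\<close>, in a form that is visibly smooth in \<open>\<xi>\<close>.\<close>

definition H_re :: "real \<Rightarrow> real \<Rightarrow> real" where
  "H_re \<eta> \<xi> = ln (1 - exp (2 * sqrt 3 * (\<eta> + \<xi>))) - sqrt 3 * (\<eta> + \<xi>) / 2 - \<xi> / (2 * sqrt 3)
     - Re (Ln (1 - cover_pt \<eta> \<xi>)) - Im (Ln (1 - cover_pt \<eta> \<xi>)) / sqrt 3
     + (pi / (2 * sqrt 3) - ln 3 / 2 - sqrt 3 * pi / 9)"

lemma cmod_cover_pt: "cmod (cover_pt \<eta> \<xi>) = exp (sqrt 3 * (\<eta> + \<xi>))"
  by (simp add: cover_pt_def)

lemma cmod_cover_pt_lt_1: "\<eta> + \<xi> < 0 \<Longrightarrow> cmod (cover_pt \<eta> \<xi>) < 1"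
  by (simp add: cmod_cover_pt mult_pos_neg)

lemma Re_one_minus_cover_pt: 
  assumes "\<eta> + \<xi> < 0"
  shows "Re (1 - cover_pt \<eta> \<xi>) > 0"
  using cmod_cover_pt_lt_1[OF assms] complex_Re_le_cmod[of "cover_pt \<eta> \<xi>"] by simp

text \<open>Every parameter pair comes from a point of the upper half-plane together with a logarithm. The witness is
read off from \<open>q = 1 / p\<close>: one has \<open>v - \<omega> = - \<i> * c * cnj p * (1 - p)\<close> and \<open>v - cnj \<omega> = \<i> * c * (1 - cnj p)\<close> with
\<open>c = sqrt 3 / (1 - \<bar>p\<bar>\<^sup>2)\<close>, and all factors have explicit logarithms.\<close>

lemma Theta_lift:
  assumes "\<eta> + \<xi> < 0"
  obtains v f\<^sub>1 where "Im v > 0" "exp f\<^sub>1 = v - sixth_root"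
    "\<xi> = Im f\<^sub>1 + Im (Ln (v - cnj sixth_root))"
    "T_log f\<^sub>1 (Ln (v - cnj sixth_root)) = Complex (H_re \<eta> \<xi>) (\<eta> / 2)"
proof -
  define s where "s = sqrt 3 * (\<eta> + \<xi>)"
  have s: "s < 0" using assms by (simp add: s_def mult_pos_neg)
  define p where "p = cover_pt \<eta> \<xi>"
  define L where "L = Ln (1 - p)"
  define \<kappa> where "\<kappa> = ln 3 / 2 - ln (1 - exp (2 * s))"
  define f1 where "f1 = of_real (\<kappa> + s) + L + \<i> * of_real (\<xi> - pi / 2)"
  define f2 where "f2 = of_real \<kappa> + cnj L + \<i> * of_real (pi / 2)"
  define v where "v = cnj sixth_root + exp f2"
  have e2s: "1 - exp (2 * s) > 0" using s by simp
  have Re1p: "Re (1 - p) > 0" using Re_one_minus_cover_pt[OF assms] by (simp add: p_def)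
  have p1: "1 - p \<noteq> 0" using Re1p by force
  have eL: "exp L = 1 - p" using p1 by (simp add: L_def)
  have "\<bar>Im L\<bar> < pi / 2" unfolding L_def using Re1p by (rule Re_Ln_pos_lt_imp)
  then have Imf2: "0 < Im f2" "Im f2 < pi" by (auto simp: f2_def)
  have Lnf2: "Ln (v - cnj sixth_root) = f2"
    using Imf2 by (simp add: v_def)
  have "exp (ln 3 / 2) = sqrt (3::real)" by (simp add: ln_sqrt[symmetric])
  then have e\<kappa>: "exp \<kappa> = sqrt 3 / (1 - exp (2 * s))"
    using e2s by (simp add: \<kappa>_def exp_diff)
  have ei: "exp (- (\<i> * of_real (pi / 2))) = - \<i>" "exp (\<i> * of_real (pi / 2)) = \<i>"
    by (simp_all add: complex_eq_iff Re_exp Im_exp)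
  have pc: "cnj p = of_real (exp s) * exp (\<i> * of_real \<xi>)"
    unfolding p_def cover_pt_def s_def[symmetric] exp_cnj by (simp add: exp_add exp_of_real)
  have pp: "p * cnj p = of_real (exp (2 * s))"
    unfolding complex_norm_square[symmetric] by (simp add: p_def cmod_cover_pt s_def exp_double)
  have ef2: "exp f2 = of_real (sqrt 3 / (1 - exp (2 * s))) * (1 - cnj p) * \<i>"
    unfolding f2_def exp_add ei exp_cnj[symmetric] eL e\<kappa>[symmetric] exp_of_real by simp
  have "f1 = of_real \<kappa> + of_real s + L + (\<i> * of_real \<xi> + - (\<i> * of_real (pi / 2)))"
    by (simp add: f1_def algebra_simps)
  then have "exp f1 = exp (of_real \<kappa>) * exp (of_real s) * exp L * (exp (\<i> * of_real \<xi>) * exp (- (\<i> * of_real (pi / 2))))"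
    by (simp only: exp_add)
  also have "\<dots> = of_real (exp \<kappa>) * (of_real (exp s) * exp (\<i> * of_real \<xi>)) * (1 - p) * (- \<i>)"
    unfolding ei eL by (simp only: exp_of_real mult_ac)
  also have "\<dots> = of_real (sqrt 3 / (1 - exp (2 * s))) * (cnj p * (1 - p)) * (- \<i>)"
    unfolding pc[symmetric] e\<kappa> by (simp only: mult_ac)
  finally have ef1: "exp f1 = of_real (sqrt 3 / (1 - exp (2 * s))) * (cnj p * (1 - p)) * (- \<i>)" .
  have "exp f2 - exp f1 = of_real (sqrt 3 / (1 - exp (2 * s))) * (1 - p * cnj p) * \<i>"
    unfolding ef1 ef2 by algebra
  also have "\<dots> = of_real (sqrt 3 / (1 - exp (2 * s)) * (1 - exp (2 * s))) * \<i>"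
    unfolding pp by simp
  also have "\<dots> = sixth_root - cnj sixth_root"
    using e2s by (simp add: sixth_root_minus_cnj)
  finally have f1: "exp f1 = v - sixth_root" by (simp add: v_def algebra_simps)
  have "cmod (v - sixth_root) < cmod (v - cnj sixth_root)"
  proof -
    have "v - cnj sixth_root = exp f2" by (simp add: v_def)
    then show ?thesis unfolding f1[symmetric] using s by (simp add: f1_def f2_def)
  qed
  then have v: "Im v > 0" by (simp add: norm_sixth_root_less_iff)
  have "T_log f1 f2 = Complex (H_re \<eta> \<xi>) (\<eta> / 2)"
  proof (rule complex_eqI)
    show "Im (T_log f1 f2) = Im (Complex (H_re \<eta> \<xi>) (\<eta> / 2))"
      by (simp add: Im_T_log f1_def f2_def s_def field_simps)
    have "Re (T_log f1 f2) = - (2 * \<kappa> + s + 2 * Re L) / 2 - (2 * Im L + \<xi> - pi) / (2 * sqrt 3) - sqrt 3 * pi / 9"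
      by (simp add: Re_T_log f1_def f2_def)
    also have "\<dots> = H_re \<eta> \<xi>"
      unfolding H_re_def \<kappa>_def p_def[symmetric] L_def[symmetric]
      by (simp add: s_def add_divide_distrib diff_divide_distrib mult.assoc)
    finally show "Re (T_log f1 f2) = Re (Complex (H_re \<eta> \<xi>) (\<eta> / 2))" by simp
  qed
  then show thesis using that[OF v f1] Lnf2 by (simp add: f1_def f2_def)
qed

lemma H_fun_eq_H_re:
  assumes "\<eta> + \<xi> < 0"
  shows "H_fun \<eta> \<xi> = Complex (H_re \<eta> \<xi>) (\<eta> / 2)"
proof -
  obtain v f1 where v: "Im v > 0" "exp f1 = v - sixth_root" "\<xi> = Im f1 + Im (Ln (v - cnj sixth_root))"
    "T_log f1 (Ln (v - cnj sixth_root)) = Complex (H_re \<eta> \<xi>) (\<eta> / 2)" by (rule Theta_lift[OF assms])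
  show ?thesis using H_fun_eq(3)[OF v(1,2,3) refl, of \<eta>] v(4) by simp
qed

text \<open>After clearing denominators the claim is \<open>B < A\<close> with \<open>B\<close> linear in \<open>(x, y)\<close>. Cauchy-Schwarz bounds \<open>B\<^sup>2\<close> by
\<open>12 * P * (1 + P + P\<^sup>2)\<close>, and \<open>A\<^sup>2\<close> exceeds this by exactly \<open>(1 - P) ^ 4\<close>.\<close>

lemma disc_inequality:
  fixes x y P :: real
  assumes P: "P = x\<^sup>2 + y\<^sup>2" "P < 1"
  shows "(x - P + sqrt 3 * y) / (1 - 2 * x + P) < 1 + 3 * P / (1 - P)"
proof -
  define A where "A = 1 + 4 * P + P\<^sup>2"
  define B where "B = 3 * (1 + P) * x + sqrt 3 * (1 - P) * y"
  have P0: "P \<ge> 0" using P by simp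
  have x1: "x < 1"
  proof (rule ccontr)
    assume "\<not> x < 1"
    then have "1 \<le> x\<^sup>2" by (simp add: one_le_power)
    then show False using P by (smt (verit) zero_le_power2)
  qed
  have M: "1 - 2 * x + P > 0"
  proof -
    have "1 - 2 * x + P = (1 - x)\<^sup>2 + y\<^sup>2" using P by (simp add: power2_eq_square algebra_simps)
    moreover have "(1 - x)\<^sup>2 > 0" using x1 by simp
    ultimately show ?thesis by (smt (verit) zero_le_power2)
  qed
  have "B\<^sup>2 + (sqrt 3 * (1 - P) * x - 3 * (1 + P) * y)\<^sup>2 = (9 * (1 + P)\<^sup>2 + (sqrt 3)\<^sup>2 * (1 - P)\<^sup>2) * (x\<^sup>2 + y\<^sup>2)"
    unfolding B_def by algebra
  also have "\<dots> = A\<^sup>2 - (1 - P) ^ 4"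
    unfolding P(1)[symmetric] A_def real_sqrt_pow2[of 3, simplified] by simp algebra
  finally have "B\<^sup>2 \<le> A\<^sup>2 - (1 - P) ^ 4" by (smt (verit) zero_le_power2)
  moreover have "(1 - P) ^ 4 > 0" using P by simp
  ultimately have "B\<^sup>2 < A\<^sup>2" by linarith
  moreover have "A > 0" using P0 by (simp add: A_def add_pos_nonneg)
  ultimately have "B < A" using power2_less_imp_less[of B A] by simp
  then have "(x - P + sqrt 3 * y) * (1 - P) < (1 + 2 * P) * (1 - 2 * x + P)"
    unfolding A_def B_def by (simp add: power2_eq_square algebra_simps)
  then have "(x - P + sqrt 3 * y) / (1 - 2 * x + P) < (1 + 2 * P) / (1 - P)"
    using M P by (simp add: divide_simps mult.commute)
  also have "\<dots> = 1 + 3 * P / (1 - P)" using P by (simp add: field_simps)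
  finally show ?thesis .
qed

text \<open>Along a curve on which \<open>Im T\<close> is constant, \<open>d\<xi> = Im (1 / v) * dT\<close>, so the derivative is \<open>- \<bar>v\<bar>\<^sup>2 / Im v < 0\<close>. In terms of
\<open>p = cover_pt \<eta> \<xi>\<close> this positivity is \<open>disc_inequality\<close>.\<close>

lemma H_re_deriv:
  assumes "\<eta> + \<xi> < 0"
  shows "\<exists>D<0. ((H_re \<eta>) has_real_derivative D) (at \<xi>)"
proof -
  define p where "p = cover_pt \<eta> \<xi>"
  define x y P where "x = Re p" and "y = Im p" and "P = exp (2 * sqrt 3 * (\<eta> + \<xi>))"
  define M where "M = 1 - 2 * x + P"
  have "(cmod p)\<^sup>2 = P" by (simp add: p_def P_def cmod_cover_pt flip: exp_double)
  then have P: "P = x\<^sup>2 + y\<^sup>2" by (simp add: cmod_power2 x_def y_def)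
  have P1: "P < 1" using assms by (simp add: P_def mult_pos_neg)
  have Re1p: "Re (1 - p) > 0" using Re_one_minus_cover_pt[OF assms] by (simp add: p_def)
  have M: "M = (1 - x)\<^sup>2 + y\<^sup>2" unfolding M_def P by (simp add: power2_eq_square algebra_simps)
  have M0: "M > 0" unfolding M using Re1p by (intro add_pos_nonneg) (auto simp: x_def)
  define L' where "L' = - ((of_real (sqrt 3) - \<i>) * p) / (1 - p)"
  have "(cover_pt \<eta> has_vector_derivative (of_real (sqrt 3) - \<i>) * p) (at \<xi>)"
  proof -
    have "((\<lambda>u. exp (of_real (sqrt 3) * (of_real \<eta> + u) - \<i> * u)) has_field_derivative
        (of_real (sqrt 3) - \<i>) * p) (at (of_real \<xi>))"
      unfolding p_def cover_pt_def by (auto intro!: derivative_eq_intros simp: algebra_simps)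
    from has_vector_derivative_real_field[OF this] show ?thesis
      unfolding cover_pt_def[abs_def] by simp
  qed
  then have d1: "((\<lambda>\<xi>. 1 - cover_pt \<eta> \<xi>) has_vector_derivative - ((of_real (sqrt 3) - \<i>) * p)) (at \<xi>)"
    by (auto intro!: derivative_eq_intros)
  have "(Ln has_field_derivative inverse (1 - p)) (at (1 - cover_pt \<eta> \<xi>))"
    using Re1p unfolding p_def by (intro has_field_derivative_Ln) (auto simp: complex_nonpos_Reals_iff)
  from field_vector_diff_chain_at[OF d1 this]
  have dL: "((\<lambda>\<xi>. Ln (1 - cover_pt \<eta> \<xi>)) has_vector_derivative L') (at \<xi>)"
    by (simp add: o_def L'_def divide_inverse)
  have dRe: "((\<lambda>\<xi>. Re (Ln (1 - cover_pt \<eta> \<xi>))) has_real_derivative Re L') (at \<xi>)"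
    unfolding has_real_derivative_iff_has_vector_derivative
    by (rule bounded_linear.has_vector_derivative[OF bounded_linear_Re dL])
  have dIm: "((\<lambda>\<xi>. Im (Ln (1 - cover_pt \<eta> \<xi>))) has_real_derivative Im L') (at \<xi>)"
    unfolding has_real_derivative_iff_has_vector_derivative
    by (rule bounded_linear.has_vector_derivative[OF bounded_linear_Im dL])
  define D where "D = - (2 * sqrt 3 * P) / (1 - P) - sqrt 3 / 2 - 1 / (2 * sqrt 3) - Re L' - Im L' / sqrt 3"
  have dA: "((\<lambda>\<xi>. ln (1 - exp (2 * sqrt 3 * (\<eta> + \<xi>)))) has_real_derivative - (2 * sqrt 3 * P) / (1 - P)) (at \<xi>)"
    using P1 unfolding P_def by (auto intro!: derivative_eq_intros)
  have d1: "((\<lambda>\<xi>. sqrt 3 * (\<eta> + \<xi>) / 2) has_real_derivative sqrt 3 / 2) (at \<xi>)"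
    by (auto intro!: derivative_eq_intros)
  have d2: "((\<lambda>\<xi>. \<xi> / (2 * sqrt 3)) has_real_derivative 1 / (2 * sqrt 3)) (at \<xi>)"
    by (rule DERIV_cdivide[OF DERIV_ident])
  have "(H_re \<eta> has_real_derivative D) (at \<xi>)"
    unfolding H_re_def[abs_def] D_def
    by (rule DERIV_cong[OF DERIV_add[OF DERIV_diff[OF DERIV_diff[OF DERIV_diff[OF DERIV_diff[OF dA d1] d2] dRe]
          DERIV_cdivide[OF dIm]] DERIV_const]]) simp
  moreover have "D < 0"
  proof -
    have cm: "(1 - p) * cnj (1 - p) = of_real M"
      unfolding complex_norm_square[symmetric] cmod_power2 by (simp add: M x_def y_def)
    have "p * cnj (1 - p) = p - of_real P"
      using \<open>(cmod p)\<^sup>2 = P\<close> by (simp add: algebra_simps flip: complex_norm_square)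
    then have "L' * ((1 - p) * cnj (1 - p)) = - ((of_real (sqrt 3) - \<i>) * (p - of_real P))"
      unfolding L'_def using Re1p by (auto simp: mult.assoc)
    then have "L' = - ((of_real (sqrt 3) - \<i>) * (p - of_real P)) / of_real M"
      unfolding cm using M0 by (simp add: field_simps)
    then have L': "Re L' = - (sqrt 3 * (x - P) + y) / M" "Im L' = - (sqrt 3 * y - (x - P)) / M"
      by (simp_all add: Re_divide_of_real Im_divide_of_real x_def y_def algebra_simps)
    have s3: "z / sqrt 3 = sqrt 3 / 3 * z" "z / (2 * sqrt 3) = sqrt 3 / 6 * z" for z :: real
      by (simp_all add: field_simps)
    have "sqrt 3 * (sqrt 3 * y) = 3 * y" by (simp flip: mult.assoc)
    then have "sqrt 3 * (x - P) + y + sqrt 3 / 3 * (sqrt 3 * y - (x - P)) = 2 * sqrt 3 / 3 * (x - P + sqrt 3 * y)"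
      by (simp add: algebra_simps)
    then have "(sqrt 3 * (x - P) + y) / M + sqrt 3 / 3 * ((sqrt 3 * y - (x - P)) / M)
        = 2 * sqrt 3 / 3 * ((x - P + sqrt 3 * y) / M)"
      by (simp only: times_divide_eq_right add_divide_distrib[symmetric])
    moreover have "D = - (2 * sqrt 3 * P / (1 - P)) - 2 * sqrt 3 / 3
        + ((sqrt 3 * (x - P) + y) / M + sqrt 3 / 3 * ((sqrt 3 * y - (x - P)) / M))"
      unfolding D_def L' s3 minus_divide_left[symmetric] mult_minus_right by linarith
    moreover have "2 * sqrt 3 / 3 * (3 * P / (1 - P)) = 2 * sqrt 3 * P / (1 - P)" by simp
    ultimately have D: "D = 2 * sqrt 3 / 3 * ((x - P + sqrt 3 * y) / M - (1 + 3 * P / (1 - P)))"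
      unfolding right_diff_distrib distrib_left by linarith
    have "(x - P + sqrt 3 * y) / M < 1 + 3 * P / (1 - P)"
      unfolding M_def by (rule disc_inequality[OF P P1])
    then have "2 * sqrt 3 / 3 * ((x - P + sqrt 3 * y) / M - (1 + 3 * P / (1 - P))) < 0"
      by (intro mult_pos_neg) auto
    then show ?thesis unfolding D .
  qed
  ultimately show ?thesis by blast
qed

lemma H_re_strict_antimono:
  assumes "\<eta> + \<xi>\<^sub>2 < 0" "\<xi>\<^sub>1 < \<xi>\<^sub>2"
  shows "H_re \<eta> \<xi>\<^sub>2 < H_re \<eta> \<xi>\<^sub>1"
proof (rule DERIV_neg_imp_decreasing[OF assms(2)])
  fix x assume "\<xi>\<^sub>1 \<le> x" "x \<le> \<xi>\<^sub>2"
  then have "\<eta> + x < 0" using assms by simp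
  from H_re_deriv[OF this] show "\<exists>y. DERIV (H_re \<eta>) x :> y \<and> y < 0" by blast
qed

text \<open>The only property of \<open>T_inv\<close> off the real axis that is used below: it inverts every branch of \<open>T\<close> over the
upper half-plane, as far as its values lie in the strip. The coordinate \<open>\<eta>\<close> is determined by \<open>Im w\<close>, and then \<open>\<xi>\<close> by \<open>Re w\<close>, by monotonicity.\<close>

lemma T_inv_eqI:
  assumes v: "Im v > 0" and f1: "exp f\<^sub>1 = v - sixth_root"
    and w: "w = T_log f\<^sub>1 (Ln (v - cnj sixth_root))" and strip: "- pi / 2 \<le> Im w" "Im w < 0"
  shows "T_inv w = v"
proof -
  define \<eta> where "\<eta> = 2 * Im w"
  define \<xi> where "\<xi> = Im f\<^sub>1 + Im (Ln (v - cnj sixth_root))"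
  note H = H_fun_eq[OF v f1 \<xi>_def w \<eta>_def]
  have "(THE v. \<exists>(\<eta>, \<xi>)\<in>Theta. w = H_fun \<eta> \<xi> \<and> v = g_fun \<eta> \<xi>) = v"
  proof (rule the_equality)
    show "\<exists>(\<eta>, \<xi>)\<in>Theta. w = H_fun \<eta> \<xi> \<and> v = g_fun \<eta> \<xi>"
      by (rule bexI[of _ "(\<eta>, \<xi>)"]) (use H strip in \<open>auto simp: Theta_def \<eta>_def\<close>)
  next
    fix v' assume "\<exists>(\<eta>, \<xi>)\<in>Theta. w = H_fun \<eta> \<xi> \<and> v' = g_fun \<eta> \<xi>"
    then obtain \<eta>' \<xi>' where "(\<eta>', \<xi>') \<in> Theta" and *: "w = H_fun \<eta>' \<xi>'" "v' = g_fun \<eta>' \<xi>'"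
      by blast
    then have neg: "\<eta>' + \<xi>' < 0" by (simp add: Theta_def)
    have eq: "Complex (H_re \<eta> \<xi>) (\<eta> / 2) = Complex (H_re \<eta>' \<xi>') (\<eta>' / 2)"
      using H_fun_eq_H_re[OF neg] H_fun_eq_H_re[OF H(2)] H(3) *(1) by metis
    then have \<eta>: "\<eta>' = \<eta>" by simp
    then have "H_re \<eta> \<xi> = H_re \<eta> \<xi>'" using eq by simp
    then have "\<xi>' = \<xi>"
      using H_re_strict_antimono[of \<eta> \<xi> \<xi>'] H_re_strict_antimono[of \<eta> \<xi>' \<xi>] neg H(2) \<eta>
      by (cases \<xi> \<xi>' rule: linorder_cases) auto
    then show "v' = v" using * H(1) \<eta> by simp
  qed
  moreover have "w \<notin> \<real>" using strip by (auto simp: complex_is_Real_iff)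
  ultimately show ?thesis by (simp add: T_inv_def)
qed

section \<open>Existence: every point of the open strip is attained\<close>

text \<open>Intermediate value theorem in \<open>\<xi>\<close> for fixed \<open>\<eta>\<close>.\<close>

lemma strip_lift:
  assumes "- pi / 2 < Im w" "Im w < 0"
  obtains v f\<^sub>1 where "Im v > 0" "exp f\<^sub>1 = v - sixth_root" "w = T_log f\<^sub>1 (Ln (v - cnj sixth_root))"
proof -
  define \<eta> where "\<eta> = 2 * Im w"
  have \<eta>: "- pi < \<eta>" "\<eta> < 0" using assms by (auto simp: \<eta>_def)
  define C where "C = pi / (2 * sqrt 3) - ln 3 / 2 - sqrt 3 * pi / 9"
  have cont: "continuous_on {..< - \<eta>} (H_re \<eta>)"
  proof (intro continuous_at_imp_continuous_on ballI)
    fix x assume "x \<in> {..< - \<eta>}"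
    then obtain D where "(H_re \<eta> has_real_derivative D) (at x)" using H_re_deriv[of \<eta> x] by auto
    then show "isCont (H_re \<eta>) x" by (rule DERIV_isCont)
  qed
  have Imb: "\<bar>Im (Ln (1 - cover_pt \<eta> \<xi>)) / sqrt 3\<bar> \<le> pi / 2" if "\<xi> < - \<eta>" for \<xi>
  proof -
    have "\<bar>Im (Ln (1 - cover_pt \<eta> \<xi>))\<bar> < pi / 2"
      using Re_one_minus_cover_pt[of \<eta> \<xi>] that by (intro Re_Ln_pos_lt_imp) auto
    moreover have "\<bar>Im (Ln (1 - cover_pt \<eta> \<xi>))\<bar> / sqrt 3 \<le> \<bar>Im (Ln (1 - cover_pt \<eta> \<xi>))\<bar> / 1"
      by (intro divide_left_mono) auto
    moreover have "\<bar>Im (Ln (1 - cover_pt \<eta> \<xi>)) / sqrt 3\<bar> = \<bar>Im (Ln (1 - cover_pt \<eta> \<xi>))\<bar> / sqrt 3"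
      by (simp add: abs_divide)
    ultimately show ?thesis by linarith
  qed
  \<comment> \<open>As \<open>\<xi>\<close> tends to minus infinity the linear terms dominate; the other terms are bounded for \<open>\<eta> + \<xi> \<le> - 1\<close>.\<close>
  obtain \<xi>\<^sub>1 where \<xi>1: "\<xi>\<^sub>1 < - \<eta>" "H_re \<eta> \<xi>\<^sub>1 \<ge> Re w"
  proof -
    define K where "K = ln (1 - exp (2 * sqrt 3 * - 1)) - ln 2 - pi / 2 + C"
    define \<xi> where "\<xi> = min (- \<eta> - 1) (- 2 * \<bar>Re w - K\<bar>)"
    have \<xi>4: "\<xi> \<le> - \<eta> - 1" and \<xi>3: "\<xi> \<le> - 2 * \<bar>Re w - K\<bar>"
      unfolding \<xi>_def by (rule min.cobounded1, rule min.cobounded2)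
    have "- 2 * \<bar>Re w - K\<bar> \<le> 0" by simp
    with \<xi>3 have "\<xi> \<le> 0" by (rule order_trans)
    moreover have "\<eta> + \<xi> \<le> -1" using \<xi>4 by simp
    ultimately have \<xi>: "\<eta> + \<xi> \<le> -1" "\<xi> \<le> 0" by blast+
    have "exp (2 * sqrt 3 * (\<eta> + \<xi>)) \<le> exp (2 * sqrt 3 * - 1)"
      unfolding exp_le_cancel_iff by (rule mult_left_mono[OF \<xi>(1)]) simp
    moreover have "exp (2 * sqrt 3 * - 1) < exp 0" unfolding exp_less_cancel_iff by simp
    moreover have ln_mono: "ln (1 - B) \<le> ln (1 - A)" if "A \<le> B" "B < exp 0" for A B :: real
      using that by simp
    ultimately have "ln (1 - exp (2 * sqrt 3 * (\<eta> + \<xi>))) \<ge> ln (1 - exp (2 * sqrt 3 * - 1))"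
      by blast
    moreover have "Re (Ln (1 - cover_pt \<eta> \<xi>)) \<le> ln 2"
    proof -
      have p1: "1 - cover_pt \<eta> \<xi> \<noteq> 0" using Re_one_minus_cover_pt[of \<eta> \<xi>] \<xi> by force
      have "cmod (1 - cover_pt \<eta> \<xi>) \<le> 2"
        using norm_triangle_ineq4[of 1 "cover_pt \<eta> \<xi>"] cmod_cover_pt_lt_1[of \<eta> \<xi>] \<xi> by simp
      then show ?thesis using p1 by (simp add: Re_Ln)
    qed
    moreover have "sqrt 3 * (\<eta> + \<xi>) / 2 \<le> \<xi> / 2"
    proof -
      have "sqrt 3 * (\<eta> + \<xi>) \<le> 1 * (\<eta> + \<xi>)" using \<xi> by (intro mult_right_mono_neg) auto
      then show ?thesis using \<eta> by simp
    qed
    moreover have "\<xi> / (2 * sqrt 3) \<le> 0" using \<xi> by (simp add: divide_nonpos_pos)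
    moreover have "\<bar>Im (Ln (1 - cover_pt \<eta> \<xi>)) / sqrt 3\<bar> \<le> pi / 2" by (rule Imb) (use \<xi> in simp)
    ultimately have "H_re \<eta> \<xi> \<ge> K - \<xi> / 2"
      unfolding H_re_def C_def[symmetric] K_def by linarith
    then have "H_re \<eta> \<xi> \<ge> Re w" using \<xi>3 abs_ge_self[of "Re w - K"] by argo
    then show thesis using that[of \<xi>] \<xi> by simp
  qed
  \<comment> \<open>As \<open>\<xi>\<close> increases to \<open>- \<eta>\<close> the first logarithm tends to minus infinity; \<open>Ln (1 - p)\<close> stays bounded, as
    \<open>p\<close> tends to \<open>exp (\<i> * \<eta>) \<noteq> 1\<close>.\<close>
  obtain \<xi>\<^sub>2 where \<xi>2: "\<xi>\<^sub>2 < - \<eta>" "\<xi>\<^sub>2 > \<xi>\<^sub>1" "H_re \<eta> \<xi>\<^sub>2 \<le> Re w"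
  proof -
    have ne: "exp (\<i> * of_real \<eta>) \<noteq> 1"
    proof
      assume "exp (\<i> * of_real \<eta>) = 1"
      then have "Im (exp (\<i> * of_real \<eta>)) = 0" by simp
      then have "sin \<eta> = 0" by (simp add: Im_exp)
      moreover have "sin (- \<eta>) > 0" using \<eta> by (intro sin_gt_zero) auto
      ultimately show False by simp
    qed
    have F: "(cover_pt \<eta> \<longlongrightarrow> cover_pt \<eta> (- \<eta>)) (at_left (- \<eta>))"
      unfolding cover_pt_def[abs_def] by (intro tendsto_intros)
    have ne': "1 - cover_pt \<eta> (- \<eta>) \<noteq> 0" using ne by (simp add: cover_pt_def)
    have lim1: "((\<lambda>\<xi>. ln (cmod (1 - cover_pt \<eta> \<xi>))) \<longlongrightarrow> ln (cmod (1 - cover_pt \<eta> (- \<eta>)))) (at_left (- \<eta>))"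
      by (intro tendsto_intros F) (use ne' in auto)
    define A where "A \<xi> = - sqrt 3 * (\<eta> + \<xi>) / 2 - \<xi> / (2 * sqrt 3) - ln (cmod (1 - cover_pt \<eta> \<xi>)) + pi / 2 + C" for \<xi>
    define B where "B \<xi> = ln (1 - exp (2 * sqrt 3 * (\<eta> + \<xi>)))" for \<xi>
    have lim2: "(A \<longlongrightarrow> A (- \<eta>)) (at_left (- \<eta>))"
      unfolding A_def by (intro tendsto_intros lim1) auto
    have "((\<lambda>\<xi>. 1 - exp (2 * sqrt 3 * (\<eta> + \<xi>))) \<longlongrightarrow> 1 - exp (2 * sqrt 3 * (\<eta> + - \<eta>))) (at_left (- \<eta>))"
      by (intro tendsto_intros)
    then have "((\<lambda>\<xi>. 1 - exp (2 * sqrt 3 * (\<eta> + \<xi>))) \<longlongrightarrow> 0) (at_left (- \<eta>))" by simp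
    moreover have "eventually (\<lambda>\<xi>. \<xi> \<in> {\<xi>\<^sub>1 <..< - \<eta>}) (at_left (- \<eta>))"
      using \<xi>1(1) by (rule eventually_at_left_real)
    then have "eventually (\<lambda>\<xi>. 1 - exp (2 * sqrt 3 * (\<eta> + \<xi>)) > 0) (at_left (- \<eta>))"
    proof eventually_elim
      case (elim \<xi>)
      then have "2 * sqrt 3 * (\<eta> + \<xi>) < 0" by (intro mult_pos_neg) auto
      then show ?case by simp
    qed
    ultimately have "filterlim (\<lambda>\<xi>. 1 - exp (2 * sqrt 3 * (\<eta> + \<xi>))) (at_right 0) (at_left (- \<eta>))"
      by (auto simp: filterlim_at elim: eventually_mono)
    then have "filterlim B at_bot (at_left (- \<eta>))"
      unfolding B_def by (rule filterlim_compose[OF ln_at_0])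
    then have "filterlim (\<lambda>\<xi>. A \<xi> + B \<xi>) at_bot (at_left (- \<eta>))"
      by (simp only: filterlim_tendsto_add_at_bot_iff[OF lim2])
    then have "eventually (\<lambda>\<xi>. A \<xi> + B \<xi> \<le> Re w) (at_left (- \<eta>))"
      unfolding filterlim_at_bot by blast
    moreover have "eventually (\<lambda>\<xi>. \<xi> \<in> {\<xi>\<^sub>1 <..< - \<eta>}) (at_left (- \<eta>))"
      using \<xi>1(1) by (rule eventually_at_left_real)
    ultimately have "eventually (\<lambda>\<xi>. \<xi>\<^sub>1 < \<xi> \<and> \<xi> < - \<eta> \<and> H_re \<eta> \<xi> \<le> Re w) (at_left (- \<eta>))"
    proof eventually_elim
      case (elim \<xi>)
      then have \<xi>: "\<xi>\<^sub>1 < \<xi>" "\<xi> < - \<eta>" by auto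
      have "1 - cover_pt \<eta> \<xi> \<noteq> 0" using Re_one_minus_cover_pt[of \<eta> \<xi>] \<xi> by force
      then have "Re (Ln (1 - cover_pt \<eta> \<xi>)) = ln (cmod (1 - cover_pt \<eta> \<xi>))" by (rule Re_Ln)
      then have "H_re \<eta> \<xi> \<le> Re w"
        using elim(1) Imb[OF \<xi>(2)] unfolding H_re_def C_def[symmetric] A_def B_def by linarith
      then show ?case using \<xi> by simp
    qed
    then have "\<exists>\<xi>. \<xi>\<^sub>1 < \<xi> \<and> \<xi> < - \<eta> \<and> H_re \<eta> \<xi> \<le> Re w"
      using eventually_happens'[OF trivial_limit_at_left_real] by blast
    then show thesis using that by blast
  qed
  have "\<exists>\<xi>\<ge>\<xi>\<^sub>1. \<xi> \<le> \<xi>\<^sub>2 \<and> H_re \<eta> \<xi> = Re w"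
    by (rule IVT2') (use \<xi>1 \<xi>2 in \<open>auto intro!: continuous_on_subset[OF cont]\<close>)
  then obtain \<xi> where \<xi>: "\<eta> + \<xi> < 0" "H_re \<eta> \<xi> = Re w" using \<xi>2 by force
  obtain v f1 where v: "Im v > 0" "exp f1 = v - sixth_root"
    "T_log f1 (Ln (v - cnj sixth_root)) = Complex (H_re \<eta> \<xi>) (\<eta> / 2)" by (rule Theta_lift[OF \<xi>(1)])
  have "w = T_log f1 (Ln (v - cnj sixth_root))" unfolding v(3) using \<xi>(2) by (simp add: complex_eq_iff \<eta>_def)
  then show thesis using that v by blast
qed

section \<open>The real primitive\<close>

lemma quad_pos: "(s::real)\<^sup>2 - s + 1 > 0"
proof -
  have "s\<^sup>2 - s + 1 = (s - 1 / 2)\<^sup>2 + 3 / 4" by (simp add: power2_eq_square algebra_simps)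
  moreover have "(s - 1 / 2)\<^sup>2 + 3 / 4 > 0" by (rule add_nonneg_pos) simp_all
  ultimately show ?thesis by (simp only:)
qed

lemma T_log_cnj: "T_log f (cnj f) = of_real (- Re f - Im f / sqrt 3 - sqrt 3 * pi / 9)"
proof (rule complex_eqI)
  have "(Im f - Im (cnj f)) / (2 * c) = Im f / c" for c by simp
  then show "Re (T_log f (cnj f)) = Re (of_real (- Re f - Im f / sqrt 3 - sqrt 3 * pi / 9))"
    unfolding Re_T_log Re_complex_of_real by simp
qed (simp add: Im_T_log)

lemma T0_deriv: "(T0 has_real_derivative - s / (s\<^sup>2 - s + 1)) (at s)"
  and T0_eq_T_log: "complex_of_real (T0 s) = T_log (Ln (of_real s - sixth_root)) (Ln (of_real s - cnj sixth_root))"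
proof -
  define F where "F t = - Re (Ln (of_real t - sixth_root)) - Im (Ln (of_real t - sixth_root)) / sqrt 3" for t
  have dF: "(F has_real_derivative - t / (t\<^sup>2 - t + 1)) (at t)" for t
  proof -
    have "complex_of_real t - sixth_root \<notin> \<real>\<^sub>\<le>\<^sub>0" by (auto simp: complex_nonpos_Reals_iff)
    then have "((\<lambda>u. Ln (u - sixth_root)) has_field_derivative 1 / (of_real t - sixth_root)) (at (of_real t))"
      by (auto intro!: derivative_eq_intros simp: inverse_eq_divide)
    from has_vector_derivative_real_field[OF this]
    have d: "((\<lambda>t. Ln (of_real t - sixth_root)) has_vector_derivative 1 / (of_real t - sixth_root)) (at t)" .
    have dRe: "((\<lambda>t. Re (Ln (of_real t - sixth_root))) has_real_derivative Re (1 / (of_real t - sixth_root))) (at t)"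
      unfolding has_real_derivative_iff_has_vector_derivative
      by (rule bounded_linear.has_vector_derivative[OF bounded_linear_Re d])
    have dIm: "((\<lambda>t. Im (Ln (of_real t - sixth_root))) has_real_derivative Im (1 / (of_real t - sixth_root))) (at t)"
      unfolding has_real_derivative_iff_has_vector_derivative
      by (rule bounded_linear.has_vector_derivative[OF bounded_linear_Im d])
    have "(Re (of_real t - sixth_root))\<^sup>2 + (Im (of_real t - sixth_root))\<^sup>2 = t\<^sup>2 - t + 1"
      by (simp add: power2_eq_square algebra_simps)
    then have e: "Re (1 / (of_real t - sixth_root)) = (t - 1 / 2) / (t\<^sup>2 - t + 1)"
        "Im (1 / (of_real t - sixth_root)) = (sqrt 3 / 2) / (t\<^sup>2 - t + 1)"
      by (simp_all add: Re_divide Im_divide)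
    have "- Re (1 / (of_real t - sixth_root)) - Im (1 / (of_real t - sixth_root)) / sqrt 3 = - t / (t\<^sup>2 - t + 1)"
    proof -
      have "sqrt 3 / 2 / Q / sqrt 3 = 1 / 2 / Q" for Q by simp
      then show ?thesis unfolding e by (simp add: diff_divide_distrib)
    qed
    then show ?thesis unfolding F_def[abs_def]
      by (intro DERIV_cong[OF DERIV_diff[OF DERIV_minus[OF dRe] DERIV_cdivide[OF dIm]]])
  qed
  have F1: "F 1 = sqrt 3 * pi / 9"
  proof -
    have "1 - sixth_root = exp (\<i> * of_real (- pi / 3))"
      by (simp add: complex_eq_iff Re_exp Im_exp sin_60 cos_60)
    moreover have "Ln (exp (\<i> * of_real (- pi / 3))) = \<i> * of_real (- pi / 3)"
    proof (rule Ln_exp)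
      have "- pi < - pi / 3" "- pi / 3 \<le> pi" using pi_gt_zero by linarith+
      then show "- pi < Im (\<i> * of_real (- pi / 3))" "Im (\<i> * of_real (- pi / 3)) \<le> pi"
        by (simp_all only: Im_i_times Re_complex_of_real)
    qed
    ultimately have "Ln (1 - sixth_root) = \<i> * of_real (- pi / 3)" by (simp only:)
    then have "F 1 = pi / 3 / sqrt 3" by (simp add: F_def)
    also have "\<dots> = sqrt 3 * pi / 9" by (simp add: field_simps)
    finally show ?thesis .
  qed
  have T0F: "T0 s = F s - sqrt 3 * pi / 9" for s
  proof -
    have "(LBINT t=ereal s..ereal 1. t / (t\<^sup>2 - t + 1)) = - F 1 - - F s"
    proof (rule interval_integral_FTC_finite)
      show "continuous_on {min s 1..max s 1} (\<lambda>t. t / (t\<^sup>2 - t + 1))"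
        by (intro continuous_intros ballI order.strict_implies_not_eq[OF quad_pos, symmetric])
      fix x
      have "((\<lambda>x. - F x) has_real_derivative x / (x\<^sup>2 - x + 1)) (at x)"
        by (rule DERIV_cong[OF DERIV_minus[OF dF]]) simp
      then show "((\<lambda>x. - F x) has_vector_derivative x / (x\<^sup>2 - x + 1)) (at x within {min s 1..max s 1})"
        by (simp add: has_real_derivative_iff_has_vector_derivative has_vector_derivative_at_within)
    qed
    then show ?thesis by (simp add: T0_def F1)
  qed
  show "(T0 has_real_derivative - s / (s\<^sup>2 - s + 1)) (at s)"
    unfolding T0F[abs_def] by (rule DERIV_cong[OF DERIV_diff[OF dF DERIV_const]]) simp
  have nonpos: "complex_of_real s - sixth_root \<notin> \<real>\<^sub>\<le>\<^sub>0" by (auto simp: complex_nonpos_Reals_iff)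
  have conj: "Ln (of_real s - cnj sixth_root) = cnj (Ln (of_real s - sixth_root))"
    by (simp only: cnj_Ln[OF nonpos] complex_cnj_diff complex_cnj_complex_of_real)
  show "complex_of_real (T0 s) = T_log (Ln (of_real s - sixth_root)) (Ln (of_real s - cnj sixth_root))"
    unfolding conj T_log_cnj T0F F_def ..
qed

lemma T0_strict_antimono:
  assumes "0 \<le> a" "a < b"
  shows "T0 b < T0 a"
proof (rule DERIV_neg_imp_decreasing_open[OF assms(2)])
  fix x assume "a < x" "x < b"
  then have "- x / (x\<^sup>2 - x + 1) < 0" using assms quad_pos[of x] by (intro divide_neg_pos) auto
  then show "\<exists>y. DERIV T0 x :> y \<and> y < 0" using T0_deriv by blast
next
  show "continuous_on {a..b} T0"
    by (intro continuous_at_imp_continuous_on ballI DERIV_isCont[OF T0_deriv])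
qed

lemma T0_1 [simp]: "T0 1 = 0"
  by (simp add: T0_def)

lemma T0_inv_T0: "0 \<le> s \<Longrightarrow> T0_inv (T0 s) = s"
  unfolding T0_inv_def
proof (rule the_inv_into_f_f)
  show "inj_on T0 {0..}"
  proof (rule inj_onI)
    fix x y :: real assume "x \<in> {0..}" "y \<in> {0..}" "T0 x = T0 y"
    then show "x = y"
      using T0_strict_antimono[of x y] T0_strict_antimono[of y x] by (cases x y rule: linorder_cases) auto
  qed
qed simp_all

text \<open>Intermediate value theorem on \<open>{1..s1}\<close>: as \<open>T0 s\<close> is at most \<open>pi - ln (s - 1)\<close>, the endpoint \<open>1 + exp (pi - w)\<close> suffices.\<close>

lemma T0_surj_neg:
  assumes "w < 0"
  obtains s where "s > 1" "T0 s = w"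
proof -
  define s1 where "s1 = 1 + exp (pi - w)"
  have s1: "s1 > 1" by (simp add: s1_def)
  have "T0 s1 \<le> w"
  proof -
    define f where "f = Ln (of_real s1 - sixth_root)"
    have nz: "of_real s1 - sixth_root \<noteq> 0" by (auto simp: complex_eq_iff)
    have "exp (pi - w) \<le> Re (of_real s1 - sixth_root)" by (simp add: s1_def)
    also have "\<dots> \<le> cmod (of_real s1 - sixth_root)" by (rule complex_Re_le_cmod)
    finally have "ln (exp (pi - w)) \<le> ln (cmod (of_real s1 - sixth_root))"
      using nz by (subst ln_le_cancel_iff) auto
    then have Ref: "Re f \<ge> pi - w" unfolding f_def using nz by (simp add: Re_Ln)
    have "\<bar>Im f\<bar> \<le> pi" unfolding f_def using nz mpi_less_Im_Ln[OF nz] Im_Ln_le_pi[OF nz] by linarith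
    moreover have "\<bar>Im f\<bar> / sqrt 3 \<le> \<bar>Im f\<bar> / 1" by (intro divide_left_mono) auto
    moreover have "\<bar>Im f / sqrt 3\<bar> = \<bar>Im f\<bar> / sqrt 3" by (simp add: abs_divide)
    ultimately have Imf: "- (Im f / sqrt 3) \<le> pi" by linarith
    have c: "Ln (of_real s1 - cnj sixth_root) = cnj f"
      unfolding f_def by (subst cnj_Ln) (auto simp: complex_nonpos_Reals_iff)
    have "T0 s1 = Re (T_log f (cnj f))"
      using T0_eq_T_log[of s1] unfolding c f_def[symmetric] by (metis Re_complex_of_real)
    also have "\<dots> = - Re f - Im f / sqrt 3 - sqrt 3 * pi / 9"
      by (simp only: T_log_cnj Re_complex_of_real)
    also have "\<dots> \<le> w" 
    proof -
      have "sqrt 3 * pi / 9 \<ge> 0" by simp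
      then show ?thesis using Ref Imf by linarith
    qed
    finally show ?thesis .
  qed
  moreover have "continuous_on {1..s1} T0"
    by (intro continuous_at_imp_continuous_on ballI DERIV_isCont[OF T0_deriv])
  ultimately have "\<exists>s\<ge>1. s \<le> s1 \<and> T0 s = w"
    using s1 assms by (intro IVT2') auto
  then obtain s where "s \<ge> 1" "T0 s = w" by blast
  moreover from this assms have "s \<noteq> 1" by auto
  ultimately show thesis using that by force
qed

section \<open>Local holomorphic extensions of the inverse\<close>

lemma holomorphic_local_inverse:
  assumes "f holomorphic_on S" "open S" "v\<^sub>0 \<in> S" "deriv f v\<^sub>0 \<noteq> 0"
  obtains \<epsilon> V where "\<epsilon> > 0" "V holomorphic_on ball (f v\<^sub>0) \<epsilon>"
    "\<And>w. w \<in> ball (f v\<^sub>0) \<epsilon> \<Longrightarrow> V w \<in> S \<and> f (V w) = w"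
proof -
  obtain r where r: "r > 0" "ball v\<^sub>0 r \<subseteq> S" "open (f ` ball v\<^sub>0 r)" "inj_on f (ball v\<^sub>0 r)"
    by (rule has_complex_derivative_locally_invertible[OF assms(1,3,2,4)])
  have hol: "f holomorphic_on ball v\<^sub>0 r"
    using assms(1) r(2) by (rule holomorphic_on_subset)
  obtain V where V: "V holomorphic_on f ` ball v\<^sub>0 r" "\<And>v. v \<in> ball v\<^sub>0 r \<Longrightarrow> V (f v) = v"
    by (rule holomorphic_has_inverse[OF hol open_ball r(4)], rule that)
  have "f v\<^sub>0 \<in> f ` ball v\<^sub>0 r" using r(1) by simp
  then obtain \<epsilon> where \<epsilon>: "\<epsilon> > 0" "ball (f v\<^sub>0) \<epsilon> \<subseteq> f ` ball v\<^sub>0 r"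
    using r(3) open_contains_ball by blast
  show thesis
  proof (rule that[OF \<epsilon>(1)])
    show "V holomorphic_on ball (f v\<^sub>0) \<epsilon>" using V(1) \<epsilon>(2) by (rule holomorphic_on_subset)
    fix w assume "w \<in> ball (f v\<^sub>0) \<epsilon>"
    then obtain v where v: "v \<in> ball v\<^sub>0 r" "w = f v" using \<epsilon>(2) by blast
    then have "V w = v" using V(2) by blast
    then show "V w \<in> S \<and> f (V w) = w" using subsetD[OF r(2) v(1)] v(2) by simp
  qed
qed

lemma T_log_has_field_derivative:
  assumes f1: "(f\<^sub>1 has_field_derivative 1 / (v - sixth_root)) (at v)"
    and f2: "(f\<^sub>2 has_field_derivative 1 / (v - cnj sixth_root)) (at v)"
    and nz: "v \<noteq> sixth_root" "v \<noteq> cnj sixth_root"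
  shows "((\<lambda>v. T_log (f\<^sub>1 v) (f\<^sub>2 v)) has_field_derivative - v / (v\<^sup>2 - v + 1)) (at v)"
proof -
  define A B where "A = v - sixth_root" and "B = v - cnj sixth_root"
  have AB: "A \<noteq> 0" "B \<noteq> 0" using nz by (auto simp: A_def B_def)
  have BA: "B - A = complex_of_real (sqrt 3) * \<i>" using sixth_root_minus_cnj by (simp add: A_def B_def)
  have "sixth_root + cnj sixth_root = 1" by (auto simp: complex_eq_iff)
  then have sum: "A + B = 2 * v - 1" unfolding A_def B_def by algebra
  have d: "((\<lambda>v. T_log (f\<^sub>1 v) (f\<^sub>2 v)) has_field_derivative
      - (1 / A + 1 / B) / 2 + \<i> * (1 / A - 1 / B) / complex_of_real (2 * sqrt 3) - 0) (at v)"
    unfolding T_log_def A_def B_def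
    by (intro DERIV_diff DERIV_add DERIV_cdivide DERIV_minus DERIV_cmult f1 f2 DERIV_const)
  have "1 / A + 1 / B = (2 * v - 1) / (A * B)"
    unfolding sum[symmetric] using AB by (simp add: field_simps)
  moreover have "1 / A - 1 / B = complex_of_real (sqrt 3) * \<i> / (A * B)"
    unfolding BA[symmetric] using AB by (simp add: field_simps)
  moreover have "\<i> * (complex_of_real (sqrt 3) * \<i> / P) / complex_of_real (2 * sqrt 3) = - (1 / P) / 2" for P
  proof -
    have "\<i> * (s * \<i>) = - s" for s :: complex by (simp add: complex_eq_iff)
    then have "\<i> * (complex_of_real (sqrt 3) * \<i> / P) = - complex_of_real (sqrt 3) / P"
      by (simp only: times_divide_eq_right)
    moreover have "- complex_of_real (sqrt 3) / P / complex_of_real (2 * sqrt 3) = - (1 / P) / 2"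
      by simp
    ultimately show ?thesis by (simp only:)
  qed
  ultimately have "- (1 / A + 1 / B) / 2 + \<i> * (1 / A - 1 / B) / complex_of_real (2 * sqrt 3) - 0
      = - ((2 * v - 1) / (A * B)) / 2 + - (1 / (A * B)) / 2"
    by (simp only: diff_zero)
  also have "\<dots> = - v / (A * B)" 
  proof -
    have "- ((2 * v - 1) / P) / 2 + - (1 / P) / 2 = - v / P" for P
      by (cases "P = 0") (auto simp: field_simps)
    then show ?thesis .
  qed
  also have "\<dots> = - v / (v\<^sup>2 - v + 1)" by (simp only: sixth_root_factor A_def B_def)
  finally show ?thesis by (rule DERIV_cong[OF d])
qed

text \<open>Continue the given logarithm of \<open>v\<^sub>0 - \<omega>\<close> along a small disc around \<open>v\<^sub>0\<close> by the principal logarithm of the quotient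
\<open>(v - \<omega>) / (v\<^sub>0 - \<omega>)\<close>, which is close to 1. The resulting branch of \<open>T\<close> has a local inverse, and this inverse is \<open>T_inv\<close> by
\<open>T_inv_eqI\<close>.\<close>

lemma T_inv_local_interior:
  assumes w0: "- pi / 2 < Im w\<^sub>0" "Im w\<^sub>0 < 0"
  shows "\<exists>\<epsilon>>0. \<exists>V. V holomorphic_on ball w\<^sub>0 \<epsilon> \<and> (\<forall>w\<in>ball w\<^sub>0 \<epsilon>. Im w \<le> 0 \<longrightarrow> T_inv w = V w)"
proof -
  obtain v0 f0 where v0: "Im v0 > 0" "exp f0 = v0 - sixth_root" "w\<^sub>0 = T_log f0 (Ln (v0 - cnj sixth_root))"
    using strip_lift[OF w0] by blast
  have nz: "v0 - sixth_root \<noteq> 0" using v0(2) by (metis exp_not_eq_zero)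
  define F where "F v = f0 + Ln ((v - sixth_root) / (v0 - sixth_root))" for v
  define \<Phi> where "\<Phi> v = T_log (F v) (Ln (v - cnj sixth_root))" for v
  define S where "S = ball v0 (min (Im v0) (cmod (v0 - sixth_root)))"
  have S: "Im v > 0" "(v - sixth_root) / (v0 - sixth_root) \<notin> \<real>\<^sub>\<le>\<^sub>0" "v \<noteq> sixth_root" if "v \<in> S" for v
  proof -
    have d: "cmod (v - v0) < Im v0" "cmod (v - v0) < cmod (v0 - sixth_root)"
      using that by (auto simp: S_def dist_norm norm_minus_commute)
    then show "Im v > 0" using abs_Im_le_cmod[of "v - v0"] by simp
    have "(v - sixth_root) / (v0 - sixth_root) = 1 + (v - v0) / (v0 - sixth_root)" using nz by (simp add: field_simps)
    moreover have "cmod ((v - v0) / (v0 - sixth_root)) < 1" using d(2) nz by (simp add: norm_divide)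
    ultimately have pos: "Re ((v - sixth_root) / (v0 - sixth_root)) > 0"
      using abs_Re_le_cmod[of "(v - v0) / (v0 - sixth_root)"] by simp
    then show "(v - sixth_root) / (v0 - sixth_root) \<notin> \<real>\<^sub>\<le>\<^sub>0" by (auto simp: complex_nonpos_Reals_iff)
    show "v \<noteq> sixth_root" using pos by auto
  qed
  have der: "(\<Phi> has_field_derivative - v / (v\<^sup>2 - v + 1)) (at v)" if "v \<in> S" for v
    unfolding \<Phi>_def[abs_def]
  proof (rule T_log_has_field_derivative)
    note Sv = S[OF that]
    have Im: "Im (v - cnj sixth_root) > 0" using Sv(1) by (simp add: add_pos_pos)
    show "v \<noteq> cnj sixth_root" using Im by force
    show "v \<noteq> sixth_root" by fact
    show "((\<lambda>v. Ln (v - cnj sixth_root)) has_field_derivative 1 / (v - cnj sixth_root)) (at v)"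
      using Im by (auto intro!: derivative_eq_intros simp: complex_nonpos_Reals_iff inverse_eq_divide)
    have "(F has_field_derivative 0 + inverse ((v - sixth_root) / (v0 - sixth_root)) * ((1 - 0) / (v0 - sixth_root))) (at v)"
      unfolding F_def[abs_def]
      by (intro DERIV_add DERIV_const DERIV_chain2[OF has_field_derivative_Ln] DERIV_cdivide DERIV_diff DERIV_ident Sv(2))
    then show "(F has_field_derivative 1 / (v - sixth_root)) (at v)"
      using nz by (simp add: field_simps)
  qed
  have hol: "\<Phi> holomorphic_on S"
    unfolding holomorphic_on_def field_differentiable_def
    using der has_field_derivative_at_within by blast
  have v0S: "v0 \<in> S" using v0(1) nz by (simp add: S_def)
  have F0: "F v0 = f0" using nz by (simp add: F_def)
  have "v0 \<noteq> 0" using v0(1) by auto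
  moreover have "v0\<^sup>2 - v0 + 1 \<noteq> 0"
    unfolding sixth_root_factor using nz S(3)[OF v0S] v0(1) Im_Ln_minus_cnj_sixth_root(1)[of v0] by (auto intro: order.strict_trans[rotated])
  ultimately have dnz: "deriv \<Phi> v0 \<noteq> 0"
    using DERIV_imp_deriv[OF der[OF v0S]] by simp
  have openS: "open S" by (simp add: S_def)
  have \<Phi>0: "\<Phi> v0 = w\<^sub>0" by (simp only: \<Phi>_def F0 v0(3))
  obtain \<epsilon> V where V: "\<epsilon> > 0" "V holomorphic_on ball w\<^sub>0 \<epsilon>"
    "\<And>w. w \<in> ball w\<^sub>0 \<epsilon> \<Longrightarrow> V w \<in> S \<and> \<Phi> (V w) = w"
    by (rule holomorphic_local_inverse[OF hol openS v0S dnz, unfolded \<Phi>0], rule that)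
  define \<delta> where "\<delta> = min \<epsilon> (min (- Im w\<^sub>0) (Im w\<^sub>0 + pi / 2))"
  show ?thesis
  proof (intro exI conjI ballI impI)
    show "\<delta> > 0" using V(1) w0 by (simp add: \<delta>_def)
    show "V holomorphic_on ball w\<^sub>0 \<delta>"
      using V(2) by (rule holomorphic_on_subset) (auto simp: \<delta>_def)
    fix w assume w: "w \<in> ball w\<^sub>0 \<delta>"
    then have "w \<in> ball w\<^sub>0 \<epsilon>" by (simp add: \<delta>_def)
    note Vw = V(3)[OF this]
    have "(V w - sixth_root) / (v0 - sixth_root) \<noteq> 0" using nz S(3)[of "V w"] Vw by simp
    then have expF: "exp (F (V w)) = V w - sixth_root"
      unfolding F_def exp_add v0(2) exp_Ln using nz by simp
    have wF: "w = T_log (F (V w)) (Ln (V w - cnj sixth_root))" using Vw by (simp only: \<Phi>_def)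
    have "cmod (w - w\<^sub>0) < - Im w\<^sub>0" "cmod (w - w\<^sub>0) < Im w\<^sub>0 + pi / 2"
      using w by (auto simp: \<delta>_def dist_norm norm_minus_commute)
    then have "- pi / 2 \<le> Im w" "Im w < 0" using abs_Im_le_cmod[of "w - w\<^sub>0"] by auto
    moreover have "Im (V w) > 0" using S(1)[of "V w"] Vw by blast
    ultimately show "T_inv w = V w" by (intro T_inv_eqI[OF _ expF wF])
  qed
qed

text \<open>The branch of \<open>T\<close> with principal logarithms extends \<open>T0\<close> to a neighbourhood of the real points \<open>v > 1\<close>. Its
derivative has negative real part there, so it maps points above the real axis below it and conversely. Its local
inverse is therefore \<open>T_inv\<close> on the lower half of a disc, by \<open>T_inv_eqI\<close>, and \<open>T0_inv\<close> on the diameter.\<close>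

lemma T_inv_local_boundary:
  assumes w0: "Im w\<^sub>0 = 0" "Re w\<^sub>0 < 0"
  shows "\<exists>\<epsilon>>0. \<exists>V. V holomorphic_on ball w\<^sub>0 \<epsilon> \<and> (\<forall>w\<in>ball w\<^sub>0 \<epsilon>. Im w \<le> 0 \<longrightarrow> T_inv w = V w)"
proof -
  obtain s0 where s0: "s0 > 1" "T0 s0 = Re w\<^sub>0" using T0_surj_neg[OF w0(2)] by blast
  define F where "F v = T_log (Ln (v - sixth_root)) (Ln (v - cnj sixth_root))" for v
  define S where "S = {v. Re v > 1} \<inter> {v. Im v < sqrt 3 / 2} \<inter> {v. Im v > - (sqrt 3 / 2)}"
  have openS: "open S"
    unfolding S_def by (intro open_Int open_halfspace_Re_gt open_halfspace_Im_lt open_halfspace_Im_gt)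
  have der: "(F has_field_derivative - v / (v\<^sup>2 - v + 1)) (at v)" if "v \<in> S" for v
    unfolding F_def[abs_def]
  proof (rule T_log_has_field_derivative)
    have Im: "Im (v - cnj sixth_root) > 0" "Im (v - sixth_root) < 0" using that by (auto simp: S_def)
    show "v \<noteq> cnj sixth_root" "v \<noteq> sixth_root" using Im by force+
    show "((\<lambda>v. Ln (v - cnj sixth_root)) has_field_derivative 1 / (v - cnj sixth_root)) (at v)"
      "((\<lambda>v. Ln (v - sixth_root)) has_field_derivative 1 / (v - sixth_root)) (at v)"
      using Im by (auto intro!: derivative_eq_intros simp: complex_nonpos_Reals_iff inverse_eq_divide)
  qed
  have hol: "F holomorphic_on S"
    unfolding holomorphic_on_def field_differentiable_def
    using der has_field_derivative_at_within by blast
  have s0S: "of_real s0 \<in> S" using s0 by (simp add: S_def)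
  have Freal: "F (of_real s) = of_real (T0 s)" for s by (simp only: F_def T0_eq_T_log)
  have Re_neg: "Re (- v / (v\<^sup>2 - v + 1)) < 0" if "v \<in> S" for v
  proof -
    have v: "Re v > 1" using that by (simp add: S_def)
    have "v \<noteq> sixth_root" "v \<noteq> cnj sixth_root" using v by auto
    then have nz: "v\<^sup>2 - v + 1 \<noteq> 0" unfolding sixth_root_factor by simp
    have "Re (v * cnj (v\<^sup>2 - v + 1)) = ((Re v)\<^sup>2 + (Im v)\<^sup>2) * (Re v - 1) + Re v"
      by (simp add: power2_eq_square algebra_simps)
    also have "\<dots> > 0" using v by (intro add_nonneg_pos mult_nonneg_nonneg) auto
    finally have "Re (v * cnj (v\<^sup>2 - v + 1)) > 0" .
    moreover have "Re (v / Q) = Re (v * cnj Q) / (cmod Q)\<^sup>2" for Q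
      by (subst complex_div_cnj) (simp only: Re_divide_of_real flip: of_real_power)
    ultimately have "Re (v / (v\<^sup>2 - v + 1)) > 0"
      using nz by (simp only:) (simp add: divide_pos_pos)
    then show ?thesis by simp
  qed
  \<comment> \<open>Along a vertical line the imaginary part decreases, as the derivative has negative real part.\<close>
  have decr: "Im (F (Complex x b)) < Im (F (Complex x a))"
    if "a < b" "x > 1" "- (sqrt 3 / 2) < a" "b < sqrt 3 / 2" for x a b
  proof (rule DERIV_neg_imp_decreasing[OF that(1), of "\<lambda>t. Im (F (Complex x t))"])
    fix t assume "a \<le> t" "t \<le> b"
    then have tS: "Complex x t \<in> S" using that by (simp add: S_def)
    have "((\<lambda>t. Complex x t) has_vector_derivative \<i>) (at t)"
      unfolding Complex_eq by (auto intro!: derivative_eq_intros)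
    from field_vector_diff_chain_at[OF this der[OF tS]]
    have d: "((\<lambda>t. F (Complex x t)) has_vector_derivative \<i> * (- Complex x t / ((Complex x t)\<^sup>2 - Complex x t + 1))) (at t)"
      by (simp only: o_def)
    have "((\<lambda>t. Im (F (Complex x t))) has_real_derivative Re (- Complex x t / ((Complex x t)\<^sup>2 - Complex x t + 1))) (at t)"
      unfolding has_real_derivative_iff_has_vector_derivative
      using bounded_linear.has_vector_derivative[OF bounded_linear_Im d] by (simp only: Im_i_times)
    then show "\<exists>y. ((\<lambda>t. Im (F (Complex x t))) has_real_derivative y) (at t) \<and> y < 0"
      using Re_neg[OF tS] by blast
  qed
  have Fx: "Im (F (Complex x 0)) = 0" for x
    using Freal[of x] by (simp add: complex_of_real_def)
  have sign: "Im (F v) < 0 \<longleftrightarrow> Im v > 0" "Im (F v) = 0 \<longleftrightarrow> Im v = 0" if "v \<in> S" for v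
  proof -
    have v: "Re v > 1" "Im v < sqrt 3 / 2" "- (sqrt 3 / 2) < Im v" using that by (auto simp: S_def)
    have s3: "0 < sqrt 3 / 2" "- (sqrt 3 / 2) < (0::real)" by simp_all
    have "Im (F v) < 0" if "Im v > 0"
      using decr[OF that v(1) s3(2) v(2)] Fx by simp
    moreover have "Im (F v) > 0" if "Im v < 0"
      using decr[OF that v(1) v(3) s3(1)] Fx by simp
    moreover have "Im (F v) = 0" if "Im v = 0"
      using that Fx[of "Re v"] by (metis complex_surj)
    ultimately show "Im (F v) < 0 \<longleftrightarrow> Im v > 0" "Im (F v) = 0 \<longleftrightarrow> Im v = 0"
      by (cases "Im v" "0 :: real" rule: linorder_cases; force)+
  qed
  have w0': "F (of_real s0) = w\<^sub>0" using Freal s0 w0 by (simp add: complex_eq_iff)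
  have "deriv F (of_real s0) \<noteq> 0"
    using DERIV_imp_deriv[OF der[OF s0S]] Re_neg[OF s0S] by (metis less_irrefl zero_complex.sel(1))
  note dnz = this
  obtain \<epsilon> V where V: "\<epsilon> > 0" "V holomorphic_on ball w\<^sub>0 \<epsilon>"
    "\<And>w. w \<in> ball w\<^sub>0 \<epsilon> \<Longrightarrow> V w \<in> S \<and> F (V w) = w"
    by (rule holomorphic_local_inverse[OF hol openS s0S dnz, unfolded w0'], rule that)
  define \<delta> where "\<delta> = min \<epsilon> (min (pi / 2) (- Re w\<^sub>0))"
  show ?thesis
  proof (intro exI conjI ballI impI)
    show "\<delta> > 0" using V(1) w0 by (simp add: \<delta>_def)
    show "V holomorphic_on ball w\<^sub>0 \<delta>"
      using V(2) by (rule holomorphic_on_subset) (auto simp: \<delta>_def)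
    fix w assume w: "w \<in> ball w\<^sub>0 \<delta>" and Imw: "Im w \<le> 0"
    then have "w \<in> ball w\<^sub>0 \<epsilon>" by (simp add: \<delta>_def)
    note Vw = V(3)[OF this]
    have d: "cmod (w - w\<^sub>0) < pi / 2" "cmod (w - w\<^sub>0) < - Re w\<^sub>0"
      using w by (auto simp: \<delta>_def dist_norm norm_minus_commute)
    show "T_inv w = V w"
    proof (cases "Im w = 0")
      case True
      then have "Im (V w) = 0" using sign(2)[of "V w"] Vw by simp
      then have Vr: "V w = of_real (Re (V w))" by (simp add: complex_eq_iff)
      then have "of_real (T0 (Re (V w))) = w" using Vw Freal by metis
      then have Tw: "T0 (Re (V w)) = Re w" by (metis Re_complex_of_real)
      have "Re w < 0" using abs_Re_le_cmod[of "w - w\<^sub>0"] d(2) by simp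
      moreover have "sqrt 3 * pi / 9 \<ge> 0" by simp
      ultimately have "Re w \<le> sqrt 3 * pi / 9" by linarith
      then have "T_inv w = of_real (T0_inv (Re w))"
        using True by (simp add: T_inv_def complex_is_Real_iff)
      also have "T0_inv (Re w) = Re (V w)"
        unfolding Tw[symmetric] using Vw by (intro T0_inv_T0) (simp add: S_def)
      finally show ?thesis using Vr by simp
    next
      case False
      then have Im: "Im w < 0" "- pi / 2 \<le> Im w" using Imw abs_Im_le_cmod[of "w - w\<^sub>0"] d(1) w0(1) by auto
      have v: "Im (V w) > 0" using sign(1)[of "V w"] Vw Im by simp
      have "V w - sixth_root \<noteq> 0" using Vw by (auto simp: S_def)
      then have "exp (Ln (V w - sixth_root)) = V w - sixth_root" by simp
      moreover have "w = T_log (Ln (V w - sixth_root)) (Ln (V w - cnj sixth_root))" using Vw by (simp only: F_def)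
      ultimately show ?thesis by (rule T_inv_eqI[OF v _ _ Im(2,1)])
    qed
  qed
qed

lemma T_inv_nonzero:
  assumes "- pi / 2 < Im w" "Im w \<le> 0" "Im w = 0 \<Longrightarrow> Re w < 0"
  shows "T_inv w \<noteq> 0"
proof (cases "Im w = 0")
  case False
  then have w: "- pi / 2 < Im w" "Im w < 0" using assms by auto
  obtain v f where v: "Im v > 0" "exp f = v - sixth_root" "w = T_log f (Ln (v - cnj sixth_root))"
    using strip_lift[OF w] by blast
  then have "T_inv w = v" using T_inv_eqI[OF v less_imp_le[OF w(1)] w(2)] by blast
  then show ?thesis using \<open>Im v > 0\<close> by auto
next
  case True
  then obtain s where s: "s > 1" "T0 s = Re w" using T0_surj_neg assms(3) by blast
  have "sqrt 3 * pi / 9 \<ge> 0" by simp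
  then have "Re w \<le> sqrt 3 * pi / 9" using assms(3) True by linarith
  then have "T_inv w = of_real (T0_inv (Re w))"
    using True by (simp add: T_inv_def complex_is_Real_iff)
  also have "T0_inv (Re w) = s" unfolding s(2)[symmetric] using s by (intro T0_inv_T0) simp
  finally show ?thesis using s by simp
qed

section \<open>The limit of many letters\<close>

text \<open>The recursion is the Euler scheme of \<open>(r\<^sup>2)' = 2\<close>; squaring shows that its error is the sum of the terms \<open>h\<^sup>2 / r\<^sup>2\<close>.\<close>

lemma down_den_square_bounds:
  assumes y: "y > 0" and h: "h \<ge> 0"
  shows "y\<^sup>2 + 2 * h * k \<le> (down_den h y k)\<^sup>2" "(down_den h y k)\<^sup>2 \<le> y\<^sup>2 + 2 * h * k + h\<^sup>2 * k / y\<^sup>2"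
proof (induction k)
  case (Suc k)
  define d where "d = down_den h y k"
  have d: "d \<ge> y" unfolding d_def using y h by (rule down_den_ge)
  then have d0: "d > 0" using y by linarith
  have eq: "(down_den h y (Suc k))\<^sup>2 = d\<^sup>2 + 2 * h + h\<^sup>2 / d\<^sup>2"
    using d0 by (simp add: d_def[symmetric] power2_eq_square field_simps)
  have "h\<^sup>2 / d\<^sup>2 \<le> h\<^sup>2 / y\<^sup>2" using d y by (intro divide_left_mono power_mono) auto
  moreover have "h\<^sup>2 / d\<^sup>2 \<ge> 0" by simp
  moreover have "h\<^sup>2 * real (Suc k) / y\<^sup>2 = h\<^sup>2 * real k / y\<^sup>2 + h\<^sup>2 / y\<^sup>2" "2 * h * real (Suc k) = 2 * h * k + 2 * h"
    by (simp_all add: algebra_simps add_divide_distrib)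
  ultimately show "y\<^sup>2 + 2 * h * Suc k \<le> (down_den h y (Suc k))\<^sup>2"
      "(down_den h y (Suc k))\<^sup>2 \<le> y\<^sup>2 + 2 * h * Suc k + h\<^sup>2 * Suc k / y\<^sup>2"
    unfolding eq using Suc[folded d_def] by linarith+
qed simp_all

text \<open>One step of the coupled recursion, in terms of the quotient \<open>t\<close>: with \<open>\<kappa> = h / e\<^sup>2\<close> it changes \<open>t\<close> by
\<open>\<kappa> * (t + 1 / t - 1) = \<kappa> * (t\<^sup>2 - t + 1) / t\<close> and \<open>ln E\<close> by \<open>- \<kappa>\<close>, up to \<open>O(\<kappa>\<^sup>2)\<close>. Hence \<open>T0 t - ln E\<close> changes by
\<open>O(\<kappa>\<^sup>2)\<close> only. The derivative of \<open>T0\<close> is Lipschitz with constant 1 to the right of 1, which bounds the Taylor remainder.\<close>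

lemma T0_step:
  assumes h: "h > 0" and e: "e > 0" and t: "t \<ge> 1"
    and E: "E = e + h / e" and F: "F = t * E" and t': "t' = (F + h / F - h / e) / e"
  shows "t \<le> t'"
    and "\<bar>T0 t' - T0 t - (ln e - ln E)\<bar> \<le> ((t + 1)\<^sup>2 + 2) * (h / e\<^sup>2)\<^sup>2"
proof -
  define \<kappa> where "\<kappa> = h / e\<^sup>2"
  define c where "c = 1 + \<kappa>"
  define \<psi> where "\<psi> s = s / (s\<^sup>2 - s + 1)" for s :: real
  define \<Delta> where "\<Delta> = \<kappa> * (t + 1 / (t * c) - 1)"
  have \<kappa>: "\<kappa> > 0" using h e by (simp add: \<kappa>_def)
  have c: "c > 1" using \<kappa> by (simp add: c_def)
  have Ec: "E = e * c" using e by (simp add: E c_def \<kappa>_def field_simps power2_eq_square)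
  have hk: "h = \<kappa> * e * e" using e by (simp add: \<kappa>_def power2_eq_square)
  have t't: "t' = t + \<Delta>"
  proof -
    have "F / e = t * c" "h / F / e = \<kappa> / (t * c)" "h / e / e = \<kappa>"
      unfolding F Ec hk using e c t by (simp_all add: field_simps)
    then have "t' = t * c + \<kappa> / (t * c) - \<kappa>"
      unfolding t' by (simp add: add_divide_distrib diff_divide_distrib)
    then show ?thesis by (simp add: \<Delta>_def c_def algebra_simps)
  qed
  have tc: "0 < 1 / (t * c)" "1 / (t * c) \<le> 1" using t c mult_mono[of 1 t 1 c] by auto
  have "0 \<le> \<kappa> * (t + 1 / (t * c) - 1)" using \<kappa> t tc by (intro mult_nonneg_nonneg; linarith)
  then have \<Delta>0: "0 \<le> \<Delta>" by (simp add: \<Delta>_def)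
  have \<Delta>1: "\<Delta> \<le> \<kappa> * (t + 1)" unfolding \<Delta>_def using \<kappa> tc by (intro mult_left_mono; linarith)
  show "t \<le> t'" using t't \<Delta>0 by simp
  have Q: "s \<le> s\<^sup>2 - s + 1" for s :: real
    using zero_le_power2[of "s - 1"] by (simp add: power2_eq_square algebra_simps)
  have lip: "\<bar>\<psi> t - \<psi> s\<bar> \<le> s - t" if "t \<le> s" for s
  proof -
    define p q where "p = t\<^sup>2 - t + 1" and "q = s\<^sup>2 - s + 1"
    have pq: "p > 0" "q > 0" unfolding p_def q_def by (rule quad_pos)+
    have "t \<le> p" "s \<le> q" unfolding p_def q_def by (rule Q)+
    then have "t * s \<le> p * q" using pq t that by (intro mult_mono) auto
    moreover have "1 \<le> t * s" using t that mult_mono[of 1 t 1 s] by simp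
    moreover have "\<psi> t - \<psi> s = (s - t) * ((t * s - 1) / (p * q))"
    proof -
      have "\<psi> t - \<psi> s = (t * q - s * p) / (p * q)"
        using pq by (simp add: \<psi>_def p_def[symmetric] q_def[symmetric] diff_frac_eq)
      also have "t * q - s * p = (s - t) * (t * s - 1)"
        unfolding p_def q_def by (simp add: power2_eq_square algebra_simps)
      finally show ?thesis by simp
    qed
    ultimately have "0 \<le> (t * s - 1) / (p * q)" "(t * s - 1) / (p * q) \<le> 1"
      using pq by (auto simp: divide_le_eq)
    then have "\<bar>(t * s - 1) / (p * q)\<bar> \<le> 1" by simp
    then show ?thesis unfolding \<open>\<psi> t - \<psi> s = _\<close> abs_mult using that mult_left_le[of "\<bar>(t * s - 1) / (p * q)\<bar>" "s - t"] by simp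
  qed
  have mvt: "\<bar>T0 t' - T0 t + \<psi> t * \<Delta>\<bar> \<le> \<Delta>\<^sup>2"
  proof (cases "\<Delta> = 0")
    case True
    then show ?thesis by (simp add: t't)
  next
    case False
    then have "t < t'" using t't \<Delta>0 by simp
    from MVT2[OF this T0_deriv] obtain s where s: "t < s" "s < t'" "T0 t' - T0 t = (t' - t) * (- s / (s\<^sup>2 - s + 1))"
      by blast
    then have "T0 t' - T0 t + \<psi> t * \<Delta> = (\<psi> t - \<psi> s) * \<Delta>"
      using t't by (simp add: \<psi>_def algebra_simps)
    moreover have "\<bar>(\<psi> t - \<psi> s) * \<Delta>\<bar> \<le> \<Delta> * \<Delta>"
      unfolding abs_mult using lip[of s] s t't \<Delta>0 by (intro mult_mono) auto
    ultimately show ?thesis by (simp add: power2_eq_square)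
  qed
  have psi: "\<bar>\<psi> t * \<Delta> - \<kappa>\<bar> \<le> \<kappa>\<^sup>2"
  proof -
    have q: "t\<^sup>2 - t + 1 > 0" by (rule quad_pos)
    have one: "\<psi> t * (t + 1 / t - 1) = 1"
    proof -
      have "t * (t + 1 / t - 1) = t\<^sup>2 - t + 1" using t by (simp add: power2_eq_square algebra_simps)
      then show ?thesis using q by (simp add: \<psi>_def)
    qed
    have "\<psi> t * \<Delta> - \<kappa> = \<kappa> * (\<psi> t * (t + 1 / (t * c) - 1) - \<psi> t * (t + 1 / t - 1))"
      unfolding one by (simp add: \<Delta>_def algebra_simps)
    also have "\<psi> t * (t + 1 / (t * c) - 1) - \<psi> t * (t + 1 / t - 1) = \<psi> t * (1 / (t * c) - 1 / t)"
      by (simp add: algebra_simps)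
    also have "1 / (t * c) - 1 / t = (1 - c) / (t * c)" using t c by (simp add: field_simps)
    also have "1 - c = - \<kappa>" by (simp add: c_def)
    finally have eq: "\<psi> t * \<Delta> - \<kappa> = - (\<kappa> * (\<psi> t * (\<kappa> * (1 / (t * c)))))" by simp
    have \<psi>: "0 \<le> \<psi> t" "\<psi> t \<le> 1" unfolding \<psi>_def using Q[of t] q t by (auto simp: divide_le_eq)
    have "\<psi> t * (\<kappa> * (1 / (t * c))) \<le> 1 * (\<kappa> * 1)"
      using \<psi> tc \<kappa> by (intro mult_mono mult_nonneg_nonneg) auto
    then have "\<kappa> * (\<psi> t * (\<kappa> * (1 / (t * c)))) \<le> \<kappa> * \<kappa>"
      using \<kappa> by (intro mult_left_mono) auto
    moreover have "0 \<le> \<kappa> * (\<psi> t * (\<kappa> * (1 / (t * c))))"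
      using \<psi> tc \<kappa> by (intro mult_nonneg_nonneg) auto
    ultimately show ?thesis unfolding eq by (simp add: power2_eq_square)
  qed
  have ln: "\<bar>ln e - ln E + \<kappa>\<bar> \<le> \<kappa>\<^sup>2"
  proof -
    have "ln E = ln e + ln c" unfolding Ec using e c by (simp add: ln_mult)
    moreover have "ln c \<le> \<kappa>" unfolding c_def using \<kappa> by (intro ln_add_one_self_le_self) auto
    moreover have "\<kappa> - \<kappa>\<^sup>2 \<le> ln c"
    proof -
      have "1 - 1 / c \<le> ln c"
        using ln_le_minus_one[of "1 / c"] c by (simp add: ln_div)
      moreover have "\<kappa> - \<kappa>\<^sup>2 \<le> 1 - 1 / c"
      proof -
        have "(\<kappa> - \<kappa>\<^sup>2) * c \<le> \<kappa>" using \<kappa> by (simp add: c_def power2_eq_square algebra_simps)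
        then have "\<kappa> - \<kappa>\<^sup>2 \<le> \<kappa> / c" using c by (simp add: pos_le_divide_eq)
        also have "\<kappa> / c = 1 - 1 / c" using c by (simp add: c_def field_simps)
        finally show ?thesis .
      qed
      ultimately show ?thesis by linarith
    qed
    ultimately show ?thesis by (simp add: abs_le_iff)
  qed
  have "\<Delta>\<^sup>2 \<le> (\<kappa> * (t + 1))\<^sup>2" using \<Delta>0 \<Delta>1 by (intro power_mono)
  then have "\<bar>T0 t' - T0 t - (ln e - ln E)\<bar> \<le> (\<kappa> * (t + 1))\<^sup>2 + \<kappa>\<^sup>2 + \<kappa>\<^sup>2"
    using mvt psi ln by linarith
  also have "(\<kappa> * (t + 1))\<^sup>2 + \<kappa>\<^sup>2 + \<kappa>\<^sup>2 = ((t + 1)\<^sup>2 + 2) * \<kappa>\<^sup>2"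
    by (simp only: power_mult_distrib) (simp add: algebra_simps)
  finally show "\<bar>T0 t' - T0 t - (ln e - ln E)\<bar> \<le> ((t + 1)\<^sup>2 + 2) * (h / e\<^sup>2)\<^sup>2"
    by (simp only: \<kappa>_def)
qed

lemma up_acc_le: "y > 0 \<Longrightarrow> h \<ge> 0 \<Longrightarrow> up_acc h y N k \<le> y + k * (h / y)"
proof (induction k)
  case (Suc k)
  define F where "F = up_acc h y N k + down_den h y (N - Suc k) - y"
  have "F \<ge> y" unfolding F_def
    using up_acc_ge[OF Suc.prems, of N k] down_den_ge[OF Suc.prems, of "N - Suc k"] by linarith
  then have "h / F \<le> h / y" using Suc.prems by (intro divide_left_mono) auto
  moreover have "up_acc h y N (Suc k) = up_acc h y N k + h / F" by (simp add: F_def)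
  moreover have "real (Suc k) * (h / y) = k * (h / y) + h / y" by (simp add: algebra_simps)
  ultimately show ?case using Suc by linarith
qed simp

lemma down_den_le: "y > 0 \<Longrightarrow> h \<ge> 0 \<Longrightarrow> down_den h y k \<le> y + k * (h / y)"
proof (induction k)
  case (Suc k)
  have "h / down_den h y k \<le> h / y"
    using Suc.prems down_den_ge[OF Suc.prems, of k] by (intro divide_left_mono mult_pos_pos) linarith+
  moreover have "real (Suc k) * (h / y) = k * (h / y) + h / y" by (simp add: algebra_simps)
  ultimately show ?case using Suc by simp
qed simp

text \<open>Summing the errors of the single steps. The constant \<open>C\<close> comes from \<open>T0_step\<close> with the a priori bounds
\<open>F k / E k \<le> (y + 2 / y) / y\<close> and \<open>E k \<ge> y\<close>.\<close>

lemma T0_ratio_estimate: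
  fixes y C :: real and E F :: "nat \<Rightarrow> real" and N k :: nat
  assumes y: "y > 0" and N: "N \<ge> 1"
  defines "E \<equiv> \<lambda>k. down_den (1 / N) y (N - Suc k)"
  defines "F \<equiv> \<lambda>k. up_acc (1 / N) y N k + E k - y"
  defines "C \<equiv> (((y + 2 / y) / y + 1)\<^sup>2 + 2) / y ^ 4"
  assumes k: "k < N"
  shows "F k / E k \<ge> 1 \<and> \<bar>T0 (F k / E k) - (ln (E k) - ln (E 0))\<bar> \<le> k * (C / (real N)\<^sup>2)"
  using k
proof (induction k)
  case 0
  have "E 0 \<ge> y" unfolding E_def using y by (intro down_den_ge) auto
  then show ?case using y by (simp add: F_def)
next
  case (Suc k)
  define h where "h = 1 / real N"
  have h: "h > 0" using N by (simp add: h_def)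
  have Ey: "E j \<ge> y" for j unfolding E_def using y by (intro down_den_ge) auto
  then have Epos: "E j > 0" for j using y less_le_trans by blast
  have up: "up_acc h y N j \<ge> y" for j using y h by (intro up_acc_ge) auto
  have Fpos: "F j > 0" for j using up[of j] Epos[of j] by (simp add: F_def h_def)
  have "N - Suc k = Suc (N - Suc (Suc k))" using Suc.prems by simp
  then have E: "E k = E (Suc k) + h / E (Suc k)" by (simp add: E_def h_def)
  define t where "t = F k / E k"
  have Ft: "F k = t * E k" using Epos[of k] by (simp add: t_def)
  have "up_acc h y N (Suc k) = up_acc h y N k + h / F k" by (simp add: F_def E_def h_def)
  then have "F (Suc k) = F k + h / F k - h / E (Suc k)"
    using E by (simp add: F_def h_def)
  then have t': "F (Suc k) / E (Suc k) = (F k + h / F k - h / E (Suc k)) / E (Suc k)" by simp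
  have IH: "t \<ge> 1" "\<bar>T0 t - (ln (E k) - ln (E 0))\<bar> \<le> k * (C / (real N)\<^sup>2)"
    using Suc by (auto simp: t_def)
  note step = T0_step[OF h Epos IH(1) E Ft t']
  have tB: "t \<le> (y + 2 / y) / y"
  proof -
    have kN: "real j * (h / y) \<le> 1 / y" if "j \<le> N" for j
    proof -
      have "real j * h \<le> 1" using that N by (simp add: h_def)
      then have "real j * h / y \<le> 1 / y" using y by (intro divide_right_mono) auto
      then show ?thesis by simp
    qed
    have "up_acc h y N k \<le> y + 1 / y"
      using up_acc_le[of y h N k] kN[of k] y h Suc.prems by simp
    moreover have "E k \<le> y + 1 / y"
      using down_den_le[of y h "N - Suc k"] kN[of "N - Suc k"] y h by (simp add: E_def h_def)
    ultimately have "F k \<le> y + 2 / y" by (simp add: F_def h_def)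
    then have "F k / E k \<le> (y + 2 / y) / y"
      using Fpos[of k] Ey[of k] y by (intro frac_le) auto
    then show ?thesis by (simp add: t_def)
  qed
  have "((t + 1)\<^sup>2 + 2) * (h / (E (Suc k))\<^sup>2)\<^sup>2 \<le> (((y + 2 / y) / y + 1)\<^sup>2 + 2) * (h / y\<^sup>2)\<^sup>2"
    using tB IH(1) h y Ey[of "Suc k"]
    by (intro mult_mono add_mono power_mono divide_left_mono mult_pos_pos) auto
  also have "\<dots> = C / (real N)\<^sup>2"
    by (simp add: C_def h_def power_divide power_mult[symmetric] field_simps)
  finally have "\<bar>T0 (F (Suc k) / E (Suc k)) - T0 t - (ln (E (Suc k)) - ln (E k))\<bar> \<le> C / (real N)\<^sup>2"
    using step(2) by linarith
  moreover have "real (Suc k) * (C / (real N)\<^sup>2) = k * (C / (real N)\<^sup>2) + C / (real N)\<^sup>2"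
    by (simp add: algebra_simps add_divide_distrib)
  ultimately show ?case using IH step(1) by linarith
qed

text \<open>The last quotient \<open>t\<close> has denominator \<open>y\<close>, and the first one is 1, with denominator tending to \<open>sqrt (y\<^sup>2 + 2)\<close>. So
\<open>T0 t\<close> tends to \<open>ln y - ln (y\<^sup>2 + 2) / 2\<close>, and \<open>t\<close> converges because \<open>T0\<close> is strictly decreasing. The final summand of
\<open>up_acc\<close>, which is not part of this quotient, is of order \<open>1 / N\<close>.\<close>

lemma up_acc_tendsto:
  assumes y: "y > 0"
  shows "(\<lambda>N. up_acc (1 / N) y N N) \<longlonglongrightarrow> y * T0_inv (ln (y\<^sup>2 / (y\<^sup>2 + 2)) / 2)"
proof -
  define w where "w = ln (y\<^sup>2 / (y\<^sup>2 + 2)) / 2"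
  have y2: "y\<^sup>2 + 2 > 0" by (intro add_nonneg_pos) auto
  have "y\<^sup>2 / (y\<^sup>2 + 2) > 0" "y\<^sup>2 / (y\<^sup>2 + 2) < 1" using y y2 by auto
  then have "w < 0" by (simp add: w_def)
  then obtain s where s: "s > 1" "T0 s = w" using T0_surj_neg by blast
  define E0 where "E0 N = down_den (1 / real (Suc N)) y N" for N
  define F where "F N = up_acc (1 / real (Suc N)) y (Suc N) N" for N
  define C where "C = (((y + 2 / y) / y + 1)\<^sup>2 + 2) / y ^ 4"
  have Fy: "F N \<ge> y" for N unfolding F_def using y by (intro up_acc_ge) auto
  have E0y: "E0 N \<ge> y" for N unfolding E0_def using y by (intro down_den_ge) auto
  have est: "F N / y \<ge> 1" "\<bar>T0 (F N / y) - (ln y - ln (E0 N))\<bar> \<le> C / real (Suc N)" for N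
  proof -
    have *: "F N / y \<ge> 1 \<and> \<bar>T0 (F N / y) - (ln y - ln (E0 N))\<bar> \<le> N * (C / (real (Suc N))\<^sup>2)"
      using T0_ratio_estimate[OF y, of "Suc N" N] by (simp add: F_def E0_def C_def)
    have C: "C \<ge> 0" by (simp add: C_def)
    have "N * (C / (real (Suc N))\<^sup>2) \<le> Suc N * (C / (real (Suc N))\<^sup>2)"
      using C by (intro mult_right_mono) auto
    also have "\<dots> = C / real (Suc N)" by (simp add: power2_eq_square del: of_nat_Suc)
    finally show "F N / y \<ge> 1" "\<bar>T0 (F N / y) - (ln y - ln (E0 N))\<bar> \<le> C / real (Suc N)" using * by auto
  qed
  have inv0: "(\<lambda>N. c / real (Suc N)) \<longlonglongrightarrow> 0" for c :: real
    using LIMSEQ_Suc[OF lim_const_over_n[of c]] by simp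
  have E0sq: "(\<lambda>N. (E0 N)\<^sup>2) \<longlonglongrightarrow> y\<^sup>2 + 2"
  proof (rule tendsto_sandwich)
    show "eventually (\<lambda>N. y\<^sup>2 + 2 - 2 / real (Suc N) \<le> (E0 N)\<^sup>2) sequentially"
    proof (intro always_eventually allI)
      fix N
      have "2 * (1 / real (Suc N)) * N = 2 - 2 / real (Suc N)" by (simp add: field_simps)
      then show "y\<^sup>2 + 2 - 2 / real (Suc N) \<le> (E0 N)\<^sup>2"
        using down_den_square_bounds(1)[OF y, of "1 / real (Suc N)" N] by (simp add: E0_def)
    qed
    show "eventually (\<lambda>N. (E0 N)\<^sup>2 \<le> y\<^sup>2 + 2 + (1 / y\<^sup>2) / real (Suc N)) sequentially"
    proof (intro always_eventually allI)
      fix N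
      have "2 * (1 / real (Suc N)) * N \<le> 2" by (simp add: field_simps)
      moreover have "(1 / real (Suc N))\<^sup>2 * N / y\<^sup>2 \<le> (1 / y\<^sup>2) / real (Suc N)"
      proof -
        have "(1 / real (Suc N))\<^sup>2 * N \<le> (1 / real (Suc N))\<^sup>2 * Suc N" by (intro mult_left_mono) auto
        also have "\<dots> = 1 / real (Suc N)" by (simp add: power2_eq_square del: of_nat_Suc)
        finally have "(1 / real (Suc N))\<^sup>2 * N / y\<^sup>2 \<le> 1 / real (Suc N) / y\<^sup>2" by (intro divide_right_mono) auto
        then show ?thesis by (simp add: mult.commute)
      qed
      ultimately show "(E0 N)\<^sup>2 \<le> y\<^sup>2 + 2 + (1 / y\<^sup>2) / real (Suc N)"
        using down_den_square_bounds(2)[OF y, of "1 / real (Suc N)" N] unfolding E0_def by (smt (verit) zero_le_divide_1_iff of_nat_0_le_iff)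
    qed
    show "(\<lambda>N. y\<^sup>2 + 2 - 2 / real (Suc N)) \<longlonglongrightarrow> y\<^sup>2 + 2"
      using tendsto_diff[OF tendsto_const inv0] by simp
    show "(\<lambda>N. y\<^sup>2 + 2 + (1 / y\<^sup>2) / real (Suc N)) \<longlonglongrightarrow> y\<^sup>2 + 2"
      using tendsto_add[OF tendsto_const[of "y\<^sup>2 + 2"] inv0[of "1 / y\<^sup>2"]] by (simp only: add_0_right)
  qed
  have "(\<lambda>N. ln y - ln ((E0 N)\<^sup>2) / 2) \<longlonglongrightarrow> ln y - ln (y\<^sup>2 + 2) / 2"
    using y2 by (intro tendsto_intros E0sq) auto
  moreover have "ln y - ln ((E0 N)\<^sup>2) / 2 = ln y - ln (E0 N)" for N
    using E0y[of N] y by (simp add: ln_realpow)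
  moreover have "ln y - ln (y\<^sup>2 + 2) / 2 = w"
    using y y2 by (simp add: w_def ln_div ln_realpow)
  ultimately have lnlim: "(\<lambda>N. ln y - ln (E0 N)) \<longlonglongrightarrow> w" by simp
  have "(\<lambda>N. T0 (F N / y) - (ln y - ln (E0 N))) \<longlonglongrightarrow> 0"
    by (rule Lim_null_comparison[OF _ inv0[of C]]) (use est(2) in auto)
  from tendsto_add[OF this lnlim] have T0lim: "(\<lambda>N. T0 (F N / y)) \<longlonglongrightarrow> T0 s" using s by simp
  have "(\<lambda>N. F N / y) \<longlonglongrightarrow> s"
  proof (rule LIMSEQ_I)
    fix r :: real assume r: "r > 0"
    define \<epsilon> where "\<epsilon> = min r 1"
    have \<epsilon>: "\<epsilon> > 0" "\<epsilon> \<le> 1" "\<epsilon> \<le> r" using r by (auto simp: \<epsilon>_def)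
    have "T0 (s + \<epsilon>) < T0 s" "T0 s < T0 (s - \<epsilon>)" using s \<epsilon> by (auto intro!: T0_strict_antimono)
    then have "eventually (\<lambda>N. T0 (s + \<epsilon>) < T0 (F N / y) \<and> T0 (F N / y) < T0 (s - \<epsilon>)) sequentially"
      using order_tendstoD[OF T0lim] by (intro eventually_conj) auto
    then obtain M where M: "\<And>N. N \<ge> M \<Longrightarrow> T0 (s + \<epsilon>) < T0 (F N / y) \<and> T0 (F N / y) < T0 (s - \<epsilon>)"
      unfolding eventually_sequentially by blast
    have "norm (F N / y - s) < r" if "N \<ge> M" for N
    proof -
      have "F N / y < s + \<epsilon>"
        using M[OF that] T0_strict_antimono[of "s + \<epsilon>" "F N / y"] s \<epsilon>
        by (cases "F N / y" "s + \<epsilon>" rule: linorder_cases) auto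
      moreover have "s - \<epsilon> < F N / y"
        using M[OF that] T0_strict_antimono[of "F N / y" "s - \<epsilon>"] est(1)[of N]
        by (cases "F N / y" "s - \<epsilon>" rule: linorder_cases) auto
      ultimately show ?thesis using \<epsilon> by (simp add: abs_less_iff)
    qed
    then show "\<exists>no. \<forall>n\<ge>no. norm (F n / y - s) < r" by blast
  qed
  then have "(\<lambda>N. y * (F N / y)) \<longlonglongrightarrow> y * s" by (intro tendsto_intros)
  then have Flim: "F \<longlonglongrightarrow> y * s" using y by simp
  have "(\<lambda>N. (1 / real (Suc N)) / F N) \<longlonglongrightarrow> 0"
  proof (rule Lim_null_comparison[OF _ inv0[of "1 / y"]], intro always_eventually allI)
    fix N
    have "(1 / real (Suc N)) / F N \<le> (1 / real (Suc N)) / y" using Fy[of N] y by (intro divide_left_mono) auto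
    moreover have "(1 / real (Suc N)) / F N \<ge> 0" using Fy[of N] y by simp
    ultimately show "norm ((1 / real (Suc N)) / F N) \<le> 1 / y / real (Suc N)" by (simp add: mult.commute)
  qed
  from tendsto_add[OF Flim this]
  have "(\<lambda>N. up_acc (1 / real (Suc N)) y (Suc N) (Suc N)) \<longlonglongrightarrow> y * s" by (simp add: F_def)
  then have "(\<lambda>N. up_acc (1 / N) y N N) \<longlonglongrightarrow> y * s" by (rule LIMSEQ_imp_Suc)
  moreover have "T0_inv w = s" using T0_inv_T0[of s] s by simp
  ultimately show ?thesis by (simp add: w_def)
qed

section \<open>Analytic continuation from the imaginary axis\<close>

text \<open>The reciprocal of \<open>G_fun\<close> in the right half of the upper half-plane.\<close>

definition G_recip :: "complex \<Rightarrow> complex" where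
  "G_recip z = z * T_inv (W_fun z)"

definition W_log :: "complex \<Rightarrow> complex" where
  "W_log z = Ln (1 + 2 / (z\<^sup>2 - 2)) / 2"

lemma W_fun_upper: "Im z > 0 \<Longrightarrow> W_fun z = W_log z"
  by (auto simp: W_fun_def W_log_def complex_is_Real_iff)

lemma W_log_arg:
  assumes "Im z > 0"
  shows "z\<^sup>2 \<noteq> 2" "1 + 2 / (z\<^sup>2 - 2) \<notin> \<real>\<^sub>\<le>\<^sub>0"
    "Im (1 + 2 / (z\<^sup>2 - 2)) = - (4 * (Re z * Im z)) / (cmod (z\<^sup>2 - 2))\<^sup>2"
    "Re z = 0 \<Longrightarrow> 1 + 2 / (z\<^sup>2 - 2) = of_real ((Im z)\<^sup>2 / ((Im z)\<^sup>2 + 2))"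
proof -
  have sq: "Re (z\<^sup>2) = (Re z)\<^sup>2 - (Im z)\<^sup>2" "Im (z\<^sup>2) = 2 * (Re z * Im z)"
    by (simp_all add: power2_eq_square)
  show ne: "z\<^sup>2 \<noteq> 2"
  proof
    assume *: "z\<^sup>2 = 2"
    then have "Im (z\<^sup>2) = 0" by simp
    then have "Re z = 0" using assms unfolding sq by simp
    then have "Re (z\<^sup>2) \<le> 0" unfolding sq by simp
    then show False using * by simp
  qed
  show im: "Im (1 + 2 / (z\<^sup>2 - 2)) = - (4 * (Re z * Im z)) / (cmod (z\<^sup>2 - 2))\<^sup>2"
    unfolding cmod_power2 by (simp add: Im_divide sq)
  show re: "1 + 2 / (z\<^sup>2 - 2) = of_real ((Im z)\<^sup>2 / ((Im z)\<^sup>2 + 2))" if "Re z = 0"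
  proof -
    have "z\<^sup>2 = - of_real ((Im z)\<^sup>2)" using that sq by (simp add: complex_eq_iff)
    moreover have "1 + 2 / (- x - 2) = x / (x + 2)" if "x + 2 \<noteq> 0" for x :: complex
    proof -
      have "- x - 2 \<noteq> 0" using that by (metis add.commute add_eq_0_iff diff_conv_add_uminus minus_add_distrib neg_equal_0_iff_equal)
      then show ?thesis using that by (simp add: divide_simps) (simp add: algebra_simps)?
    qed
    moreover have "complex_of_real ((Im z)\<^sup>2) + 2 \<noteq> 0"
    proof -
      have "(Im z)\<^sup>2 + 2 > 0" by (intro add_nonneg_pos) auto
      then have "complex_of_real ((Im z)\<^sup>2 + 2) \<noteq> 0" by (simp only: of_real_eq_0_iff)
      then show ?thesis by simp
    qed
    ultimately show ?thesis by simp
  qed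
  show "1 + 2 / (z\<^sup>2 - 2) \<notin> \<real>\<^sub>\<le>\<^sub>0"
  proof (cases "Re z = 0")
    case True
    have "(Im z)\<^sup>2 / ((Im z)\<^sup>2 + 2) > 0"
      using assms by (intro divide_pos_pos add_nonneg_pos) auto
    then show ?thesis unfolding re[OF True] by (simp add: not_le del: of_real_divide)
  next
    case False
    have "(cmod (z\<^sup>2 - 2))\<^sup>2 > 0" using ne by simp
    then have "Im (1 + 2 / (z\<^sup>2 - 2)) \<noteq> 0" unfolding im using assms False by simp
    then show ?thesis by (auto simp: complex_nonpos_Reals_iff)
  qed
qed

lemma W_log_strip:
  assumes "Im z > 0" "Re z \<ge> 0"
  shows "- pi / 2 < Im (W_log z)" "Im (W_log z) \<le> 0" "Im (W_log z) = 0 \<Longrightarrow> Re (W_log z) < 0"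
proof -
  define u where "u = 1 + 2 / (z\<^sup>2 - 2)"
  note u = W_log_arg[OF assms(1), folded u_def]
  have W: "Im (W_log z) = Im (Ln u) / 2" "Re (W_log z) = Re (Ln u) / 2"
    by (simp_all add: W_log_def u_def)
  have u0: "u \<noteq> 0" using u(2) by auto
  show "- pi / 2 < Im (W_log z)" unfolding W using mpi_less_Im_Ln[OF u0] by simp
  consider "Re z = 0" | "Re z > 0" using assms(2) by linarith
  then have "Im (Ln u) \<le> 0 \<and> (Im (Ln u) = 0 \<longrightarrow> Re (Ln u) < 0)"
  proof cases
    case 1
    define r where "r = (Im z)\<^sup>2 / ((Im z)\<^sup>2 + 2)"
    have "(Im z)\<^sup>2 + 2 > 0" by (intro add_nonneg_pos) auto
    then have r: "r > 0" "r < 1" using assms(1) by (auto simp: r_def)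
    have "Ln u = of_real (ln r)" unfolding u(4)[OF 1] r_def[symmetric] using r(1) by (rule Ln_of_real)
    then show ?thesis using r by simp
  next
    case 2
    have "(cmod (z\<^sup>2 - 2))\<^sup>2 > 0" using u(1) by simp
    then have "Im u < 0" unfolding u(3) using 2 assms(1) by (intro divide_neg_pos) auto
    then have "Im (cnj u) > 0" by simp
    then have "Im (Ln (cnj u)) > 0" using Im_Ln_pos_lt_imp by blast
    then have "Im (Ln u) < 0" using cnj_Ln[OF u(2)] by (metis cnj.sel(2) neg_0_less_iff_less)
    then show ?thesis by simp
  qed
  then show "Im (W_log z) \<le> 0" "Im (W_log z) = 0 \<Longrightarrow> Re (W_log z) < 0"
    unfolding W by auto
qed

lemma open_upper_half_plane: "open {z. Im z > 0}"
  using open_halfspace_Im_gt[of 0] by simp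

lemma W_log_holomorphic: "W_log holomorphic_on {z. Im z > 0}"
  unfolding W_log_def[abs_def] using W_log_arg(1,2) by (auto intro!: holomorphic_intros)

text \<open>On the imaginary axis the argument \<open>W_fun z\<close> is a negative real number, at the edge of the domain of \<open>T_inv\<close>; the local
extension of \<open>T_inv\<close> across this edge extends \<open>G_recip\<close> across the axis.\<close>

lemma G_recip_local_extension:
  assumes z0: "Im z\<^sub>0 > 0" "Re z\<^sub>0 \<ge> 0"
  obtains \<delta> Q where "\<delta> > 0" "ball z\<^sub>0 \<delta> \<subseteq> {z. Im z > 0}" "Q holomorphic_on ball z\<^sub>0 \<delta>"
    "\<And>z. z \<in> ball z\<^sub>0 \<delta> \<Longrightarrow> Re z \<ge> 0 \<Longrightarrow> G_recip z = Q z"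
proof -
  define w0 where "w0 = W_log z\<^sub>0"
  note w0 = W_log_strip[OF z0, folded w0_def]
  have "\<exists>\<epsilon>>0. \<exists>V. V holomorphic_on ball w0 \<epsilon> \<and> (\<forall>w\<in>ball w0 \<epsilon>. Im w \<le> 0 \<longrightarrow> T_inv w = V w)"
  proof (cases "Im w0 = 0")
    case True
    then show ?thesis using T_inv_local_boundary w0(3) by blast
  next
    case False
    then have "Im w0 < 0" using w0(2) by simp
    then show ?thesis by (rule T_inv_local_interior[OF w0(1)])
  qed
  then obtain \<epsilon> V where V: "\<epsilon> > 0" "V holomorphic_on ball w0 \<epsilon>"
    "\<And>w. w \<in> ball w0 \<epsilon> \<Longrightarrow> Im w \<le> 0 \<Longrightarrow> T_inv w = V w" by blast
  have "open (W_log -` ball w0 \<epsilon> \<inter> {z. Im z > 0})"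
    by (rule continuous_open_preimage[OF holomorphic_on_imp_continuous_on[OF W_log_holomorphic]
          open_upper_half_plane open_ball, unfolded Int_commute[of "{z. Im z > 0}"]])
  moreover have "z\<^sub>0 \<in> W_log -` ball w0 \<epsilon> \<inter> {z. Im z > 0}" using z0 V(1) by (simp add: w0_def)
  ultimately obtain \<delta> where \<delta>: "\<delta> > 0" "ball z\<^sub>0 \<delta> \<subseteq> W_log -` ball w0 \<epsilon> \<inter> {z. Im z > 0}"
    using open_contains_ball by blast
  show thesis
  proof (rule that[of \<delta> "\<lambda>z. z * V (W_log z)"])
    show "\<delta> > 0" by (rule \<delta>(1))
    show sub: "ball z\<^sub>0 \<delta> \<subseteq> {z. Im z > 0}" using \<delta>(2) by blast
    have "V \<circ> W_log holomorphic_on ball z\<^sub>0 \<delta>"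
      by (rule holomorphic_on_compose_gen[OF holomorphic_on_subset[OF W_log_holomorphic sub] V(2)])
         (use \<delta>(2) in blast)
    then show "(\<lambda>z. z * V (W_log z)) holomorphic_on ball z\<^sub>0 \<delta>"
      unfolding o_def by (intro holomorphic_intros)
    fix z assume z: "z \<in> ball z\<^sub>0 \<delta>" "Re z \<ge> 0"
    then have "Im z > 0" using sub by blast
    moreover have "T_inv (W_log z) = V (W_log z)"
      using z \<delta>(2) W_log_strip(2)[OF \<open>Im z > 0\<close> z(2)] by (intro V(3)) auto
    ultimately show "G_recip z = z * V (W_log z)" by (simp add: G_recip_def W_fun_upper)
  qed
qed

lemma G_recip_nonzero: "Im z > 0 \<Longrightarrow> Re z \<ge> 0 \<Longrightarrow> G_recip z \<noteq> 0"
  using T_inv_nonzero W_log_strip[of z] by (auto simp: G_recip_def W_fun_upper)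

lemma G_recip_imaginary_axis:
  assumes "y > 0"
  shows "G_recip (\<i> * of_real y) = \<i> * of_real (y * T0_inv (ln (y\<^sup>2 / (y\<^sup>2 + 2)) / 2))"
proof -
  define r where "r = y\<^sup>2 / (y\<^sup>2 + 2)"
  have y2: "y\<^sup>2 + 2 > 0" by (intro add_nonneg_pos) auto
  then have r: "r > 0" "r < 1" using assms by (auto simp: r_def)
  have "W_log (\<i> * of_real y) = Ln (of_real r) / 2"
    using W_log_arg(4)[of "\<i> * of_real y"] assms unfolding W_log_def r_def by simp
  also have "Ln (of_real r) = of_real (ln r)" using r(1) by (rule Ln_of_real)
  finally have W: "W_log (\<i> * of_real y) = of_real (ln r / 2)" by simp
  have "ln r / 2 \<le> sqrt 3 * pi / 9"
  proof -
    have "ln r < 0" using r by simp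
    moreover have "sqrt 3 * pi / 9 \<ge> 0" by simp
    ultimately show ?thesis by linarith
  qed
  then have "T_inv (W_log (\<i> * of_real y)) = of_real (T0_inv (ln r / 2))"
    unfolding W T_inv_def by (simp del: of_real_divide)
  then show ?thesis using assms by (simp add: G_recip_def W_fun_upper r_def)
qed

definition quadrant :: "complex set" where
  "quadrant = {z. Re z > 0} \<inter> {z. Im z > 0}"

lemma open_quadrant: "open quadrant"
  unfolding quadrant_def by (intro open_Int open_upper_half_plane open_halfspace_Re_gt)

lemma connected_quadrant: "connected quadrant"
  unfolding quadrant_def
  by (intro convex_connected convex_Int convex_halfspace_Im_gt convex_halfspace_Re_gt)

lemma G_recip_holomorphic: "G_recip holomorphic_on quadrant"
  unfolding holomorphic_on_def
proof
  fix z assume z: "z \<in> quadrant"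
  then have zpos: "Im z > 0" "Re z \<ge> 0" by (auto simp: quadrant_def)
  obtain \<delta> Q where Q: "\<delta> > 0" "Q holomorphic_on ball z \<delta>"
    "\<And>u. u \<in> ball z \<delta> \<Longrightarrow> Re u \<ge> 0 \<Longrightarrow> G_recip u = Q u"
    by (rule G_recip_local_extension[OF zpos], rule that)
  have "Q holomorphic_on ball z \<delta> \<inter> quadrant" using Q(2) by (rule holomorphic_on_subset) auto
  then have "G_recip holomorphic_on ball z \<delta> \<inter> quadrant"
    by (rule holomorphic_transform) (use Q(3) in \<open>auto simp: quadrant_def\<close>)
  then have "G_recip field_differentiable at z"
    by (rule holomorphic_on_imp_differentiable_at) (use z Q(1) open_quadrant in auto)
  then show "G_recip field_differentiable at z within quadrant" by (rule field_differentiable_at_within)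
qed

text \<open>On the axis above \<open>y\<^sub>0\<close> the identity holds by assumption; the local extension at one such point carries it to a
neighbourhood, hence into the quadrant, where it holds throughout by connectedness. At the remaining points of the
axis it follows by taking the local extension in the opposite direction.\<close>

lemma upper_right_continuation:
  assumes J: "J holomorphic_on {z. Im z > 0}"
    and axis: "\<And>y. y > y\<^sub>0 \<Longrightarrow> J (\<i> * of_real y) * (c + G_recip (\<i> * of_real y)) = 1"
    and y0: "y\<^sub>0 > 0" and z: "Im z > 0" "Re z \<ge> 0"
  shows "J z * (c + G_recip z) = 1"
proof -
  define \<Psi> where "\<Psi> z = J z * (c + G_recip z) - 1" for z
  have hol: "\<Psi> holomorphic_on quadrant"
    unfolding \<Psi>_def[abs_def]
    by (intro holomorphic_intros G_recip_holomorphic holomorphic_on_subset[OF J]) (auto simp: quadrant_def)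
  \<comment> \<open>The points of the axis are limits of points of the quadrant, so zeros in the quadrant determine a local extension.\<close>
  have limpt: "b islimpt ball b \<delta> \<inter> quadrant" if "\<delta> > 0" "Re b = 0" "Im b > 0" for b \<delta>
    unfolding islimpt_approachable
  proof (intro allI impI)
    fix e :: real assume e: "e > 0"
    define t where "t = min e \<delta> / 2"
    have "t > 0" "t < e" "t < \<delta>" using e that by (auto simp: t_def)
    then show "\<exists>x'\<in>ball b \<delta> \<inter> quadrant. x' \<noteq> b \<and> dist x' b < e"
      using that by (intro bexI[of _ "b + of_real t"]) (auto simp: quadrant_def dist_norm complex_eq_iff)
  qed
  have ext: "\<exists>\<delta>>0. \<exists>\<Phi>. \<Phi> holomorphic_on ball b \<delta> \<and> (\<forall>u\<in>ball b \<delta>. Re u \<ge> 0 \<longrightarrow> \<Phi> u = \<Psi> u)"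
    if b: "Re b = 0" "Im b > 0" for b
  proof -
    have "Re b \<ge> 0" using b by simp
    then obtain \<delta> Q where Q: "\<delta> > 0" "ball b \<delta> \<subseteq> {z. Im z > 0}" "Q holomorphic_on ball b \<delta>"
      "\<And>u. u \<in> ball b \<delta> \<Longrightarrow> Re u \<ge> 0 \<Longrightarrow> G_recip u = Q u"
      using G_recip_local_extension[OF b(2)] by metis
    have "(\<lambda>u. J u * (c + Q u) - 1) holomorphic_on ball b \<delta>"
      by (intro holomorphic_intros Q(3) holomorphic_on_subset[OF J Q(2)])
    then show ?thesis using Q(1,4) by (intro exI[of _ \<delta>] conjI exI[of _ "\<lambda>u. J u * (c + Q u) - 1"]) (auto simp: \<Psi>_def)
  qed
  define b where "b = \<i> * complex_of_real (y\<^sub>0 + 1)"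
  have b: "Re b = 0" "Im b > 0" using y0 by (auto simp: b_def)
  obtain \<delta> \<Phi> where \<Phi>: "\<delta> > 0" "\<Phi> holomorphic_on ball b \<delta>" "\<And>u. u \<in> ball b \<delta> \<Longrightarrow> Re u \<ge> 0 \<Longrightarrow> \<Phi> u = \<Psi> u"
    using ext[OF b] by blast
  define U where "U = {u \<in> ball b \<delta>. Re u = 0 \<and> Im u > y\<^sub>0}"
  have "b islimpt U"
    unfolding islimpt_approachable
  proof (intro allI impI)
    fix e :: real assume e: "e > 0"
    define t where "t = min e \<delta> / 2"
    have t: "t > 0" "t < e" "t < \<delta>" using e \<Phi>(1) by (auto simp: t_def)
    show "\<exists>x'\<in>U. x' \<noteq> b \<and> dist x' b < e"
      by (rule bexI[of _ "b + \<i> * of_real t"]) (use t in \<open>auto simp: U_def b_def dist_norm norm_mult\<close>)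
  qed
  have \<Phi>0: "\<Phi> u = 0" if "u \<in> ball b \<delta>" for u
  proof (rule analytic_continuation[OF \<Phi>(2) open_ball connected_ball _ _ \<open>b islimpt U\<close> _ that])
    show "U \<subseteq> ball b \<delta>" by (auto simp: U_def)
    show "b \<in> ball b \<delta>" using \<Phi>(1) by simp
    fix z assume z: "z \<in> U"
    then have "z = \<i> * of_real (Im z)" by (simp add: U_def complex_eq_iff)
    then have "\<Psi> z = 0" using axis[of "Im z"] z by (simp add: \<Psi>_def U_def)
    then show "\<Phi> z = 0" using \<Phi>(3)[of z] z by (simp add: U_def)
  qed
  have quad: "\<Psi> u = 0" if "u \<in> quadrant" for u
  proof -
    define p where "p = b + of_real (\<delta> / 2)"
    have p: "p \<in> ball b \<delta> \<inter> quadrant" using \<Phi>(1) b by (simp add: p_def dist_norm quadrant_def)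
    have "open (ball b \<delta> \<inter> quadrant)" using open_quadrant by blast
    then have lim: "p islimpt ball b \<delta> \<inter> quadrant" using p by (simp add: open_imp_islimpt)
    show ?thesis
    proof (rule analytic_continuation[OF hol open_quadrant connected_quadrant _ _ lim _ that])
      show "p \<in> quadrant" using p by blast
      fix z assume "z \<in> ball b \<delta> \<inter> quadrant"
      then show "\<Psi> z = 0" using \<Phi>0[of z] \<Phi>(3)[of z] by (simp add: quadrant_def)
    qed blast
  qed
  have "\<Psi> z = 0"
  proof (cases "Re z = 0")
    case True
    obtain \<delta>' \<Phi>' where \<Phi>': "\<delta>' > 0" "\<Phi>' holomorphic_on ball z \<delta>'"
      "\<And>u. u \<in> ball z \<delta>' \<Longrightarrow> Re u \<ge> 0 \<Longrightarrow> \<Phi>' u = \<Psi> u"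
      using ext[OF True z(1)] by blast
    have zin: "z \<in> ball z \<delta>'" using \<Phi>'(1) by simp
    have "\<Phi>' z = 0"
    proof (rule analytic_continuation[OF \<Phi>'(2) open_ball connected_ball _ zin limpt[OF \<Phi>'(1) True z(1)] _ zin])
      fix u assume "u \<in> ball z \<delta>' \<inter> quadrant"
      then show "\<Phi>' u = 0" using \<Phi>'(3)[of u] quad[of u] by (simp add: quadrant_def)
    qed blast
    then show ?thesis using \<Phi>'(3)[OF zin] True by simp
  next
    case False
    then show ?thesis using z by (intro quad) (auto simp: quadrant_def)
  qed
  then show ?thesis by (simp add: \<Psi>_def)
qed

lemma G_fun_continuation:
  assumes J: "J holomorphic_on {z. Im z > 0}"
    and axis: "\<And>y. y > y\<^sub>0 \<Longrightarrow> J (\<i> * of_real y) * (of_real l + G_recip (\<i> * of_real y)) = 1"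
    and y0: "y\<^sub>0 > 0" and z: "Im z > 0"
  shows "J z = G_fun z / (1 + of_real l * G_fun z)"
proof -
  have G_right: "G_right u = 1 / G_recip u" if "Im u > 0" for u
    using that by (auto simp: G_right_def G_recip_def)
  have fin: "j = (1 / Z) / (1 + of_real l * (1 / Z))" if "Z \<noteq> 0" "j * (of_real l + Z) = 1" for Z j :: complex
  proof -
    have "of_real l + Z \<noteq> 0" using that(2) by auto
    then have "j = 1 / (of_real l + Z)" using that(2) by (simp add: eq_divide_eq)
    also have "of_real l + Z = Z * (1 + of_real l * (1 / Z))" using that(1) by (simp add: field_simps)
    finally show ?thesis by simp
  qed
  show ?thesis
  proof (cases "Re z \<ge> 0")
    case True
    have "J z * (of_real l + G_recip z) = 1"
      by (rule upper_right_continuation[OF J axis y0 z True])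
    then show ?thesis using fin[OF G_recip_nonzero[OF z True]] True G_right[OF z] by (simp add: G_fun_def)
  next
    case False
    \<comment> \<open>The function \<open>J'\<close> has the same properties for \<open>- l\<close>, since \<open>G_recip\<close> is purely imaginary on the axis;
      this matches the definition of \<open>G_fun\<close> on the left half-plane.\<close>
    define J' where "J' u = - cnj (J (- cnj u))" for u
    have hJ': "J' holomorphic_on {z. Im z > 0}"
    proof -
      have "(\<lambda>u. J (- u)) holomorphic_on cnj ` {z. Im z > 0}"
      proof -
        have "(\<lambda>u. J (- u)) = J \<circ> uminus" by auto
        moreover have "J \<circ> uminus holomorphic_on cnj ` {z. Im z > 0}"
          by (rule holomorphic_on_compose_gen[OF _ J]) (auto intro!: holomorphic_intros)
        ultimately show ?thesis by simp
      qed
      from holomorphic_on_compose_cnj_cnj[OF this open_upper_half_plane]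
      have "(\<lambda>u. cnj (J (- cnj u))) holomorphic_on {z. Im z > 0}" by (simp add: o_def)
      then show ?thesis unfolding J'_def[abs_def] by (intro holomorphic_intros)
    qed
    have axis': "J' (\<i> * of_real y) * (of_real (- l) + G_recip (\<i> * of_real y)) = 1" if "y > y\<^sub>0" for y
    proof -
      define t where "t = y * T0_inv (ln (y\<^sup>2 / (y\<^sup>2 + 2)) / 2)"
      have G_recip: "G_recip (\<i> * of_real y) = \<i> * of_real t"
        using G_recip_imaginary_axis[of y] that y0 by (simp add: t_def)
      have "J' (\<i> * of_real y) * (of_real (- l) + G_recip (\<i> * of_real y))
          = cnj (J (\<i> * of_real y) * (of_real l + G_recip (\<i> * of_real y)))"
        unfolding G_recip J'_def by (simp add: algebra_simps)
      then show ?thesis using axis[OF that] by simp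
    qed
    have z': "Im (- cnj z) > 0" "Re (- cnj z) \<ge> 0" using z False by auto
    have "J' (- cnj z) * (of_real (- l) + G_recip (- cnj z)) = 1"
      by (rule upper_right_continuation[OF hJ' axis' y0 z'])
    then have "cnj (- cnj (J z) * (of_real (- l) + G_recip (- cnj z))) = 1" by (simp add: J'_def)
    then have "J z * (of_real l + - cnj (G_recip (- cnj z))) = 1" by (simp add: algebra_simps)
    moreover have "- cnj (G_recip (- cnj z)) \<noteq> 0" using G_recip_nonzero[OF z'] by simp
    ultimately have "J z = (1 / - cnj (G_recip (- cnj z))) / (1 + of_real l * (1 / - cnj (G_recip (- cnj z))))"
      by (intro fin)
    moreover have "G_fun z = 1 / - cnj (G_recip (- cnj z))"
      using False G_right[OF z'(1)] by (simp add: G_fun_def)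
    ultimately show ?thesis by simp
  qed
qed

section \<open>The Cauchy-Stieltjes transform\<close>

text \<open>The kernel is bounded by \<open>1 / Im z\<close>, so the difference quotient at \<open>a\<close> differs from the integral of the derivative of the
kernel by at most a multiple of \<open>\<bar>z - a\<bar>\<close>.\<close>

lemma cauchy_stieltjes_holomorphic:
  assumes "real_distribution \<mu>"
  shows "(\<lambda>z. cauchy_stieltjes \<mu> (z + of_real l)) holomorphic_on {z. Im z > 0}"
proof -
  interpret real_distribution \<mu> by fact
  let ?K = "\<lambda>z x. 1 / (z + of_real l - complex_of_real x)"
  have K_bound: "cmod (?K z x) \<le> 1 / Im z" if "Im z > 0" for z x
  proof -
    have "Im z \<le> cmod (z + of_real l - of_real x)"
      using abs_Im_le_cmod[of "z + of_real l - of_real x"] by simp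
    then show ?thesis using that by (simp add: norm_divide frac_le)
  qed
  have K_nz: "z + of_real l - complex_of_real x \<noteq> 0" if "Im z > 0" for z x
    using that by (auto simp: complex_eq_iff)
  have meas [measurable]: "?K z \<in> borel_measurable \<mu>" for z by measurable
  have int: "integrable \<mu> (?K z)" if "Im z > 0" for z
    by (rule integrable_const_bound[of _ "1 / Im z"]) (use K_bound[OF that] in auto)
  have int2: "integrable \<mu> (\<lambda>x. ?K z x * ?K z x)" if "Im z > 0" for z
    by (rule integrable_const_bound[of _ "1 / Im z * (1 / Im z)"])
       (use K_bound[OF that] that in \<open>auto simp: norm_mult simp del: times_divide_eq_left times_divide_eq_right intro!: mult_mono\<close>)
  show ?thesis
    unfolding holomorphic_on_def
  proof
    fix a assume "a \<in> {z. Im z > 0}"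
    then have a: "Im a > 0" by simp
    define D where "D = - (\<integral>x. ?K a x * ?K a x \<partial>\<mu>)"
    define C where "C = 2 / Im a * (1 / Im a * (1 / Im a))"
    have quot: "cmod ((cauchy_stieltjes \<mu> (z + of_real l) - cauchy_stieltjes \<mu> (a + of_real l)) / (z - a) - D) \<le> C * cmod (z - a)"
      if z: "z \<noteq> a" "dist z a < Im a / 2" for z
    proof -
      have "\<bar>Im z - Im a\<bar> < Im a / 2" using z(2) abs_Im_le_cmod[of "z - a"] by (simp add: dist_norm)
      then have Imz: "Im z > 0" "Im a / 2 \<le> Im z" using a by linarith+
      have id: "(?K z x - ?K a x) / (z - a) + ?K a x * ?K a x = (z - a) * (?K z x * (?K a x * ?K a x))" for x
      proof -
        define A B where "A = z + of_real l - complex_of_real x" and "B = a + of_real l - complex_of_real x"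
        have nz: "A \<noteq> 0" "B \<noteq> 0" using K_nz[OF Imz(1)] K_nz[OF a] by (auto simp: A_def B_def)
        have za: "z - a = A - B" "A - B \<noteq> 0" using z(1) by (auto simp: A_def B_def)
        show ?thesis unfolding za(1) A_def[symmetric] B_def[symmetric]
          using nz za(2) by (simp add: divide_simps) (simp add: algebra_simps)
      qed
      have bound: "cmod ((z - a) * (?K z x * (?K a x * ?K a x))) \<le> C * cmod (z - a)" for x
      proof -
        have "1 / Im z \<le> 2 / Im a" using Imz a by (simp add: divide_simps)
        then have "cmod (?K z x) \<le> 2 / Im a" using K_bound[OF Imz(1), of x] by linarith
        then have "cmod (?K z x) * (cmod (?K a x) * cmod (?K a x)) \<le> C"
          unfolding C_def using K_bound[OF a, of x] a by (intro mult_mono) auto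
        then have "cmod (z - a) * (cmod (?K z x) * (cmod (?K a x) * cmod (?K a x))) \<le> cmod (z - a) * C"
          by (intro mult_left_mono) auto
        then show ?thesis by (simp only: norm_mult mult.commute)
      qed
      have "(cauchy_stieltjes \<mu> (z + of_real l) - cauchy_stieltjes \<mu> (a + of_real l)) / (z - a) - D
          = (\<integral>x. (?K z x - ?K a x) / (z - a) + ?K a x * ?K a x \<partial>\<mu>)"
        unfolding cauchy_stieltjes_def D_def using int[OF Imz(1)] int[OF a] int2[OF a] by simp
      also have "\<dots> = (\<integral>x. (z - a) * (?K z x * (?K a x * ?K a x)) \<partial>\<mu>)" unfolding id ..
      also have "cmod \<dots> \<le> (\<integral>x. C * cmod (z - a) \<partial>\<mu>)"
      proof (rule Bochner_Integration.integral_norm_bound_integral)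
        show "integrable \<mu> (\<lambda>x. (z - a) * (?K z x * (?K a x * ?K a x)))"
          by (rule integrable_const_bound[of _ "C * cmod (z - a)"]) (rule AE_I2, rule bound, measurable)
        show "cmod ((z - a) * (?K z x * (?K a x * ?K a x))) \<le> C * cmod (z - a)" for x by (rule bound)
      qed simp
      also have "\<dots> = C * cmod (z - a)" using prob_space by simp
      finally show ?thesis .
    qed
    have "((\<lambda>z. cauchy_stieltjes \<mu> (z + of_real l)) has_field_derivative D) (at a)"
      unfolding has_field_derivative_iff
    proof (rule LIM_zero_cancel, rule Lim_null_comparison)
      show "eventually (\<lambda>z. norm ((cauchy_stieltjes \<mu> (z + of_real l) - cauchy_stieltjes \<mu> (a + of_real l)) / (z - a) - D)
          \<le> C * cmod (z - a)) (at a)"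
        unfolding eventually_at using quot a by (intro exI[of _ "Im a / 2"]) auto
      have "((\<lambda>z. C * cmod (z - a)) \<longlongrightarrow> C * cmod (a - a)) (at a)" by (intro tendsto_intros)
      then show "((\<lambda>z. C * cmod (z - a)) \<longlongrightarrow> 0) (at a)" by simp
    qed
    then show "(\<lambda>z. cauchy_stieltjes \<mu> (z + of_real l)) field_differentiable at a within {z. Im z > 0}"
      using field_differentiable_def field_differentiable_at_within by blast
  qed
qed

lemma cauchy_stieltjes_moment_series:
  assumes "real_distribution \<mu>" and B: "AE x in \<mu>. \<bar>x\<bar> \<le> B" and z: "cmod z > B" "B \<ge> 0"
  shows "(\<lambda>n. complex_of_real (\<integral>x. x ^ n \<partial>\<mu>) / z ^ Suc n) sums cauchy_stieltjes \<mu> z"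
proof -
  interpret real_distribution \<mu> by fact
  define f where "f n x = complex_of_real (x ^ n) / z ^ Suc n" for n x
  define q where "q = B / cmod z"
  have z0: "z \<noteq> 0" using z by auto
  have "cmod z > 0" using z0 by simp
  then have q: "0 \<le> q" "q < 1" using z by (auto simp: q_def divide_less_eq)
  have fb: "norm (f n x) \<le> q ^ n / cmod z" if "\<bar>x\<bar> \<le> B" for n x
  proof -
    have "\<bar>x\<bar> ^ n \<le> B ^ n" using that by (intro power_mono) auto
    then have "\<bar>x\<bar> ^ n / cmod z ^ n / cmod z \<le> B ^ n / cmod z ^ n / cmod z" by (intro divide_right_mono) auto
    then show ?thesis by (simp add: f_def q_def norm_divide norm_mult norm_power power_abs power_divide mult.commute)
  qed
  have meas [measurable]: "f n \<in> borel_measurable \<mu>" for n unfolding f_def by measurable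
  have intf: "integrable \<mu> (f n)" for n
    by (rule integrable_const_bound[of _ "q ^ n / cmod z"]) (use B fb in \<open>auto elim!: eventually_mono\<close>)
  have geo: "summable (\<lambda>n. q ^ n / cmod z)"
    using q by (intro summable_divide summable_geometric) auto
  have ae: "AE x in \<mu>. summable (\<lambda>n. norm (f n x))"
    using B by eventually_elim (rule summable_comparison_test'[OF geo], use fb in auto)
  have sum_int: "summable (\<lambda>n. \<integral>x. norm (f n x) \<partial>\<mu>)"
  proof (rule summable_comparison_test'[OF geo])
    fix n :: nat
    have "(\<integral>x. norm (f n x) \<partial>\<mu>) \<le> (\<integral>x. q ^ n / cmod z \<partial>\<mu>)"
      by (rule integral_mono_AE) (use intf B fb in \<open>auto elim!: eventually_mono\<close>)
    then show "norm (\<integral>x. norm (f n x) \<partial>\<mu>) \<le> q ^ n / cmod z" using prob_space by simp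
  qed
  have "(\<lambda>n. \<integral>x. f n x \<partial>\<mu>) sums (\<integral>x. (\<Sum>n. f n x) \<partial>\<mu>)"
    by (rule sums_integral[OF intf ae sum_int])
  also have "(\<integral>x. (\<Sum>n. f n x) \<partial>\<mu>) = cauchy_stieltjes \<mu> z"
    unfolding cauchy_stieltjes_def
  proof (rule integral_cong_AE)
    show "AE x in \<mu>. (\<Sum>n. f n x) = 1 / (z - complex_of_real x)"
      using B
    proof eventually_elim
      case (elim x)
      have "norm (complex_of_real x / z) < 1" using elim z z0 by (simp add: norm_divide)
      then have "(\<lambda>n. (complex_of_real x / z) ^ n) sums (1 / (1 - complex_of_real x / z))" by (rule geometric_sums)
      then have "(\<lambda>n. (complex_of_real x / z) ^ n / z) sums (1 / (1 - complex_of_real x / z) / z)" by (rule sums_divide)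
      moreover have "(\<lambda>n. (complex_of_real x / z) ^ n / z) = (\<lambda>n. f n x)"
        by (auto simp: f_def power_divide mult.commute)
      moreover have "1 / (1 - complex_of_real x / z) / z = 1 / (z - complex_of_real x)"
      proof -
        have "(1 - complex_of_real x / z) * z = z - complex_of_real x" using z0 by (simp add: field_simps)
        then show ?thesis by (simp only: divide_divide_eq_left)
      qed
      ultimately show ?case using sums_unique by metis
    qed
  qed measurable
  also have "(\<lambda>n. \<integral>x. f n x \<partial>\<mu>) = (\<lambda>n. complex_of_real (\<integral>x. x ^ n \<partial>\<mu>) / z ^ Suc n)"
    unfolding f_def by (simp del: of_real_power power_Suc)
  finally show ?thesis .
qed

text \<open>For large \<open>y\<close> the transform is the limit of the vacuum resolvents at \<open>l + \<i> * y\<close>, by Tannery's theorem with the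
geometric majorant from \<open>vacuum_moment_bound\<close>.\<close>

lemma cauchy_stieltjes_imaginary_axis:
  assumes lim: "is_limit_distribution l \<mu>"
  obtains y\<^sub>0 where "y\<^sub>0 > 0"
    "\<And>y. y > y\<^sub>0 \<Longrightarrow> cauchy_stieltjes \<mu> (\<i> * of_real y + of_real l) * (of_real l + G_recip (\<i> * of_real y)) = 1"
proof -
  have dist: "real_distribution \<mu>" using lim by (simp add: is_limit_distribution_def)
  obtain K where K: "compact K" "AE x in \<mu>. x \<in> K" using lim unfolding is_limit_distribution_def by blast
  obtain B0 where B0: "\<And>x. x \<in> K \<Longrightarrow> \<bar>x\<bar> \<le> B0"
    using compact_imp_bounded[OF K(1)] by (auto simp: bounded_iff)
  define B where "B = max 0 B0"
  have B: "AE x in \<mu>. \<bar>x\<bar> \<le> B" using K(2) by eventually_elim (use B0 in \<open>force simp: B_def\<close>)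
  define y0 where "y0 = max (2 + \<bar>l\<bar>) B"
  show thesis
  proof (rule that[of y0])
    have "2 + \<bar>l\<bar> \<le> y0" by (simp add: y0_def)
    then show "y0 > 0" by linarith
    fix y assume y: "y > y0"
    then have yl: "y > 2 + \<bar>l\<bar>" and yB: "y > B" by (auto simp: y0_def)
    then have ypos: "y > 0" by linarith
    define z where "z = complex_of_real l + \<i> * of_real y"
    have zy: "cmod z \<ge> y" using abs_Im_le_cmod[of z] by (simp add: z_def)
    define q where "q = (2 + \<bar>l\<bar>) / cmod z"
    have q: "0 \<le> q" "q < 1" using yl zy by (auto simp: q_def divide_less_eq)
    define s where "s = y * T0_inv (ln (y\<^sup>2 / (y\<^sup>2 + 2)) / 2)"
    have G_recip: "G_recip (\<i> * of_real y) = \<i> * of_real s" unfolding s_def by (rule G_recip_imaginary_axis[OF ypos])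
    then have "s \<noteq> 0" using G_recip_nonzero[of "\<i> * of_real y"] ypos by auto
    then have nz: "complex_of_real l + \<i> * of_real s \<noteq> 0" by (auto simp: complex_eq_iff)
    have "((\<lambda>N. \<Sum>n. vacuum_state (S_op l N ^^ n) / z ^ Suc n)
        \<longlonglongrightarrow> (\<Sum>n. complex_of_real (\<integral>x. x ^ n \<partial>\<mu>) / z ^ Suc n))"
    proof (rule conjunct2[OF conjunct2[OF tannerys_theorem]])
      show "(\<lambda>N. vacuum_state (S_op l N ^^ n) / z ^ Suc n) \<longlonglongrightarrow> complex_of_real (\<integral>x. x ^ n \<partial>\<mu>) / z ^ Suc n" for n
      proof (rule tendsto_divide)
        show "(\<lambda>N. vacuum_state (S_op l N ^^ n)) \<longlonglongrightarrow> complex_of_real (\<integral>x. x ^ n \<partial>\<mu>)"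
          using lim by (simp add: is_limit_distribution_def)
        show "z ^ Suc n \<noteq> 0" using zy ypos by auto
      qed simp
      show "summable (\<lambda>n. q ^ n / cmod z)" using q by (intro summable_divide summable_geometric) auto
      have "eventually (\<lambda>p. True \<and> snd p \<ge> (1::nat)) (at_top \<times>\<^sub>F sequentially)"
        using eventually_prodI[of "\<lambda>_. True" at_top "\<lambda>N. N \<ge> (1::nat)" sequentially]
        by (simp add: eventually_ge_at_top)
      then show "eventually (\<lambda>(n, N). norm (vacuum_state (S_op l N ^^ n) / z ^ Suc n) \<le> q ^ n / cmod z) (at_top \<times>\<^sub>F sequentially)"
      proof (rule eventually_mono, clarify)
        fix n N :: nat assume N: "snd (n, N) \<ge> (1::nat)"
        then have "cmod (vacuum_state (S_op l N ^^ n)) / cmod z ^ n / cmod z \<le> (2 + \<bar>l\<bar>) ^ n / cmod z ^ n / cmod z"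
          using vacuum_moment_bound[of N n l] by (intro divide_right_mono) auto
        then show "norm (vacuum_state (S_op l N ^^ n) / z ^ Suc n) \<le> q ^ n / cmod z"
          by (simp add: norm_divide norm_mult norm_power q_def power_divide mult.commute)
      qed
    qed simp
    also have "(\<Sum>n. complex_of_real (\<integral>x. x ^ n \<partial>\<mu>) / z ^ Suc n) = cauchy_stieltjes \<mu> z"
    proof (rule sums_unique[symmetric], rule cauchy_stieltjes_moment_series[OF dist B])
      show "B < cmod z" using yB zy by linarith
      show "0 \<le> B" by (simp add: B_def)
    qed
    finally have L1: "(\<lambda>N. \<Sum>n. vacuum_state (S_op l N ^^ n) / z ^ Suc n) \<longlonglongrightarrow> cauchy_stieltjes \<mu> z" .
    have ev: "eventually (\<lambda>N. (\<Sum>n. vacuum_state (S_op l N ^^ n) / z ^ Suc n)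
        = 1 / (l + \<i> * up_acc (1 / N) y N N)) sequentially"
      using eventually_ge_at_top[of 1]
    proof eventually_elim
      case (elim N)
      then show ?case using moment_series_up_acc[OF elim yl] unfolding z_def by (intro sums_unique[symmetric])
    qed
    have "(\<lambda>N. 1 / (complex_of_real l + \<i> * of_real (up_acc (1 / real N) y N N))) \<longlonglongrightarrow> 1 / (complex_of_real l + \<i> * of_real s)"
      unfolding s_def by (intro tendsto_intros up_acc_tendsto[OF ypos] nz[unfolded s_def])
    from this have L2: "(\<lambda>N. \<Sum>n. vacuum_state (S_op l N ^^ n) / z ^ Suc n) \<longlonglongrightarrow> 1 / (complex_of_real l + \<i> * of_real s)"
      using tendsto_cong[OF ev] by simp
    have "cauchy_stieltjes \<mu> z = 1 / (complex_of_real l + \<i> * of_real s)"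
      using L1 L2 by (rule LIMSEQ_unique)
    then show "cauchy_stieltjes \<mu> (\<i> * of_real y + of_real l) * (of_real l + G_recip (\<i> * of_real y)) = 1"
      unfolding G_recip using nz by (simp add: z_def add.commute)
  qed
qed

theorem proposition6p5:
  fixes l :: real and \<mu> :: "real measure"
  assumes "is_limit_distribution l \<mu>"
  shows "\<forall>z. Im z > 0 \<longrightarrow>
    cauchy_stieltjes \<mu> z =
      G_fun (z - complex_of_real l) / (1 + complex_of_real l * G_fun (z - complex_of_real l))"
proof (intro allI impI)
  fix z :: complex assume z: "Im z > 0"
  obtain y0 where y0: "y0 > 0"
    "\<And>y. y > y0 \<Longrightarrow> cauchy_stieltjes \<mu> (\<i> * of_real y + of_real l) * (of_real l + G_recip (\<i> * of_real y)) = 1"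
    by (rule cauchy_stieltjes_imaginary_axis[OF assms], rule that)
  have "real_distribution \<mu>" using assms by (simp add: is_limit_distribution_def)
  then have hol: "(\<lambda>u. cauchy_stieltjes \<mu> (u + of_real l)) holomorphic_on {u. Im u > 0}"
    by (rule cauchy_stieltjes_holomorphic)
  have "Im (z - of_real l) > 0" using z by simp
  from G_fun_continuation[OF hol y0(2,1) this]
  show "cauchy_stieltjes \<mu> z =
      G_fun (z - complex_of_real l) / (1 + complex_of_real l * G_fun (z - complex_of_real l))"
    by simp
qed

end
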